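(* Let $\mathcal F$ be the family of self-dual codes of length $N=2n$ of a given Type over a finite field $\mathbb F$, and let $\mathcal V$, $T$, $\mathcal Y_m$ $(0\le m\le n)$ be the associated vector space, Kneser-Hecke-operator and subspaces (see context). Assume that for every $0\le m\le n$ a subset $\mathcal M^0_m\subseteq\mathcal M^*_m$ is given such that (1) $\mathcal V_m=\{v\in\mathcal V_{m-1} : a_X(v)=0 \text{ for all } X\in\mathcal M^0_m\}$, and (2) the sum $\sum_{E\in\mathcal E_C(\underline c)}\alpha_E(C)$ takes the same value, denoted $\alpha_m$, for all codes $C\in\mathcal F$ and all $\underline c\in C^m$ with $\operatorname{mon}(\underline c)\in\mathcal M^0_m$. Put $\beta_m:=\frac{|\mathbb F|^m-1}{|\mathbb F|-1}$ and $\nu_m:=\alpha_m-\beta_m$. Then for every $0\le m\le n$ for which $\alpha_m$ is defined (i.e. for which at least one pair $(C,\underline c)$ as in (2) exists), the space $\mathcal Y_m$ is exactly the $\nu_m$-eigenspace of $T$ in $\mathcal V$, i.e. $\mathcal Y_m=\{v\in\mathcal V : T(v)=\nu_m v\}$.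
   Context: Form. $\mathbb F$ is a finite field of characteristic $p$, $N=2n$ is a positive even integer, and $b(x,y)=\sum_{i=1}^N x_i\overline{y_i}$ on $\mathbb F^N$, where $\overline{\phantom{s}}$ is either the identity (bilinear case) or a field automorphism of $\mathbb F$ of order 2 (Hermitian case). $C^\perp$ is the orthogonal space of a subspace $C\le\mathbb F^N$ with respect to $b$; $C$ is self-dual if $C=C^\perp$ (then $\dim C=n$). Type. For $r\in\mathbb F$ let $m_r:\mathbb F\times\mathbb F\to\mathbb Q/\mathbb Z$, $m_r(x,y)=\frac1p\operatorname{Tr}_{\mathbb F/\mathbb F_p}(r x\overline{y})$. A Type (for the given $\mathbb F$ and $\overline{\phantom{s}}$) is specified by an additive group $\Phi$ of maps $\varphi:\mathbb F\to\mathbb Q/\mathbb Z$ with $\varphi(0)=0$ such that: for each $\varphi\in\Phi$ the map $(x,y)\mapsto\varphi(x+y)-\varphi(x)-\varphi(y)$ equals $m_r$ for some $r\in\mathbb F$; for $\varphi\in\Phi$, $r\in\mathbb F$ the map $x\mapsto\varphi(rx)$ is in $\Phi$; and $x\mapsto m_r(x,x)$ is in $\Phi$ for all $r\in\mathbb F$. The family $\mathcal F$ of self-dual codes of length $N$ of this Type is the set of all $\mathbb F$-subspaces $C\le\mathbb F^N$ with $C=C^\perp$ and $\sum_{i=1}^N\varphi(c_i)=0$ for all $c\in C$, $\varphi\in\Phi$. Vector space and operator. Two codes are equivalent if a coordinate permutation in $S_N$ maps one onto the other; $[C]$ is the equivalence class of $C$; $\operatorname{Aut}(C)=\{\pi\in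 S_N:\pi(C)=C\}$. $\mathcal V$ is the $\mathbb C$-vector space with basis $\mathcal B=\{[C]:C\in\mathcal F\}$, with the positive definite Hermitian scalar product given by $([C],[D])=|\operatorname{Aut}(C)|\,\delta_{[C],[D]}$. $T:\mathcal V\to\mathcal V$ is the linear operator with $T([C])=\sum_D[D]$, the sum over all $D\in\mathcal F$ with $\dim(C\cap D)=n-1$. Weight-enumerators. For $m\ge0$ let $\mathcal P_m=\mathbb C[x_a: a\in\mathbb F^m]$. For $\underline c=(c^{(1)},\dots,c^{(m)})\in(\mathbb F^N)^m$ let $\operatorname{mon}(\underline c)=\prod_{v\in\mathbb F^m}x_v^{a_v(\underline c)}$, where $a_v(\underline c)$ is the number of $i\in\{1,\dots,N\}$ with $(c^{(1)}_i,\dots,c^{(m)}_i)=v$. Let $\operatorname{cwe}_m:\mathcal V\to\mathcal P_m$ be the linear map with $\operatorname{cwe}_m([C])=\sum_{\underline c\in C^m}\operatorname{mon}(\underline c)$ for $m\ge 1$ and $\operatorname{cwe}_0([C])=1$. Put $\mathcal V_{-1}=\mathcal V$, $\mathcal V_m=\ker(\operatorname{cwe}_m)$ for $m\ge0$, $\mathcal W_m=\mathcal V_m^\perp$ (orthogonal complement in $\mathcal V$), and $\mathcal Y_m=\mathcal W_m\cap\mathcal V_{m-1}$ for $0\le m\le n$. Monomials. $\mathcal M_m$ is the set of monomials of degree $N$ in $\mathcal P_m$; the rank of $X=\prod_a x_a^{e_a}$ is $\dim\langle a\in\mathbb F^m:e_a>0\rangle$; $\mathcal M_m^*$ is the set of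 $X\in\mathcal M_m$ of rank $m$. For $X\in\mathcal M_m$, $a_X:\mathcal V\to\mathbb C$ is the linear map with $a_X([C])=|\{\underline c\in C^m:\operatorname{mon}(\underline c)=X\}|$. For $C\in\mathcal F$ and $\underline c\in C^m$: $\mathcal E_C(\underline c)$ is the set of subspaces $E\le C$ with $\dim E=n-1$ and $\underline c\in E^m$; $\alpha_E(C)$ is the number of $D\in\mathcal F$ with $D\cap C=E$. *)

theory Defs
  imports "HOL-Analysis.Analysis" "HOL-Library.Poly_Mapping" "HOL-Library.Function_Algebras"
begin

section \<open>The group of rationals modulo integers\<close>

quotient_type qmodz = rat / "\<lambda>x y. x - y \<in> \<int>"
  morphisms rep_qmodz to_qmodz
proof (rule equivpI)
  show "reflp (\<lambda>x y :: rat. x - y \<in> \<int>)"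
    by (simp add: reflp_def)
  show "symp (\<lambda>x y :: rat. x - y \<in> \<int>)"
  proof (rule sympI)
    fix x y :: rat
    assume "x - y \<in> \<int>"
    from Ints_minus[OF this] show "y - x \<in> \<int>" by simp
  qed
  show "transp (\<lambda>x y :: rat. x - y \<in> \<int>)"
  proof (rule transpI)
    fix x y z :: rat
    assume "x - y \<in> \<int>" "y - z \<in> \<int>"
    from Ints_add[OF this] show "x - z \<in> \<int>" by simp
  qed
qed

instantiation qmodz :: ab_group_add
begin

lift_definition zero_qmodz :: qmodz is 0 .

lift_definition plus_qmodz :: "qmodz \<Rightarrow> qmodz \<Rightarrow> qmodz" is "(+)"
proof -
  fix a b c d :: rat
  assume "a - b \<in> \<int>" "c - d \<in> \<int>"
  from Ints_add[OF this] show "a + c - (b + d) \<in> \<int>" by (simp add: algebra_simps)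
qed

lift_definition uminus_qmodz :: "qmodz \<Rightarrow> qmodz" is "\<lambda>x. - x"
proof -
  fix a b :: rat
  assume "a - b \<in> \<int>"
  from Ints_minus[OF this] show "- a - - b \<in> \<int>" by simp
qed

lift_definition minus_qmodz :: "qmodz \<Rightarrow> qmodz \<Rightarrow> qmodz" is "(-)"
proof -
  fix a b c d :: rat
  assume "a - b \<in> \<int>" "c - d \<in> \<int>"
  from Ints_diff[OF this] show "a - c - (b - d) \<in> \<int>" by (simp add: algebra_simps)
qed

instance
proof
  fix a b c :: qmodz
  show "a + b + c = a + (b + c)" by transfer (simp add: add.assoc)
  show "a + b = b + a" by transfer (simp add: add.commute)
  show "0 + a = a" by transfer simp
  show "- a + a = 0" by transfer simp
  show "a - b = a + - b" by transfer simp
qed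

end


section \<open>Forms on a finite field\<close>

definition field_automorphism :: "('a::field \<Rightarrow> 'a) \<Rightarrow> bool" where
  "field_automorphism \<sigma> \<longleftrightarrow>
     bij \<sigma> \<and> (\<forall>x y. \<sigma> (x + y) = \<sigma> x + \<sigma> y) \<and> (\<forall>x y. \<sigma> (x * y) = \<sigma> x * \<sigma> y)"

definition admissible_conj :: "('a::field \<Rightarrow> 'a) \<Rightarrow> bool" where
  "admissible_conj bar \<longleftrightarrow>
     bar = id \<or> (field_automorphism bar \<and> bar \<noteq> id \<and> bar \<circ> bar = id)"

text \<open>A finite field is Galois over its prime field, and every automorphism fixes the
  prime field; the absolute trace is therefore the sum over all automorphisms.\<close>

definition abs_trace :: "'a::{field,finite} \<Rightarrow> 'a" where
  "abs_trace x = (\<Sum>\<sigma> | field_automorphism \<sigma>. \<sigma> x)"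

text \<open>The embedding \<open>z \<mapsto> z / p\<close> of the prime field into the rationals modulo integers:
  choose any integer representing \<open>z\<close>, see \<open>prime_field_div_char_of_int\<close> below.\<close>

definition prime_field_div_char :: "'a::{field,finite} \<Rightarrow> qmodz" where
  "prime_field_div_char z =
     to_qmodz (of_int (SOME k. of_int k = z) / of_nat CHAR('a))"

lemma prime_field_div_char_of_int:
  "prime_field_div_char (of_int k :: 'a::{field,finite}) = to_qmodz (of_int k / of_nat CHAR('a))"
proof -
  define l where "l = (SOME l. of_int l = (of_int k :: 'a))"
  have "of_int l = (of_int k :: 'a)"
    unfolding l_def by (rule someI[where x = k]) simp
  hence "of_int (l - k) = (0 :: 'a)" by simp
  hence "int CHAR('a) dvd l - k" by (simp only: of_int_eq_0_iff_char_dvd)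
  then obtain j where j: "l - k = int CHAR('a) * j" by blast
  have p: "CHAR('a) > 0" by (rule finite_imp_CHAR_pos) simp
  have "(of_int l / of_nat CHAR('a) - of_int k / of_nat CHAR('a) :: rat)
          = of_int (l - k) / of_nat CHAR('a)"
    by (simp add: diff_divide_distrib)
  also have "\<dots> = of_int j" using p by (simp add: j)
  finally have "(of_int l / of_nat CHAR('a) - of_int k / of_nat CHAR('a) :: rat) \<in> \<int>"
    by simp
  thus ?thesis
    unfolding prime_field_div_char_def l_def[symmetric] by (simp add: qmodz.abs_eq_iff)
qed

definition trace_form :: "('a::{field,finite} \<Rightarrow> 'a) \<Rightarrow> 'a \<Rightarrow> 'a \<Rightarrow> 'a \<Rightarrow> qmodz" where
  "trace_form bar r x y = prime_field_div_char (abs_trace (r * x * bar y))"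

definition is_type :: "('a::{field,finite} \<Rightarrow> 'a) \<Rightarrow> ('a \<Rightarrow> qmodz) set \<Rightarrow> bool" where
  "is_type bar \<Phi> \<longleftrightarrow>
     (\<lambda>x. 0) \<in> \<Phi> \<and>
     (\<forall>\<phi>\<in>\<Phi>. \<forall>\<psi>\<in>\<Phi>. (\<lambda>x. \<phi> x + \<psi> x) \<in> \<Phi>) \<and>
     (\<forall>\<phi>\<in>\<Phi>. (\<lambda>x. - \<phi> x) \<in> \<Phi>) \<and>
     (\<forall>\<phi>\<in>\<Phi>. \<phi> 0 = 0) \<and>
     (\<forall>\<phi>\<in>\<Phi>. \<exists>r. \<forall>x y. \<phi> (x + y) - \<phi> x - \<phi> y = trace_form bar r x y) \<and>
     (\<forall>\<phi>\<in>\<Phi>. \<forall>r. (\<lambda>x. \<phi> (r * x)) \<in> \<Phi>) \<and>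
     (\<forall>r. (\<lambda>x. trace_form bar r x x) \<in> \<Phi>)"


section \<open>Self-dual codes of a given type\<close>

definition form :: "('a::{field,finite} \<Rightarrow> 'a) \<Rightarrow> 'a ^ 'n \<Rightarrow> 'a ^ 'n \<Rightarrow> 'a" where
  "form bar x y = (\<Sum>i\<in>UNIV. x $ i * bar (y $ i))"

definition dual_code :: "('a::{field,finite} \<Rightarrow> 'a) \<Rightarrow> ('a ^ 'n) set \<Rightarrow> ('a ^ 'n) set" where
  "dual_code bar C = {y. \<forall>x\<in>C. form bar x y = 0}"

definition self_dual_codes ::
  "('a::{field,finite} \<Rightarrow> 'a) \<Rightarrow> ('a \<Rightarrow> qmodz) set \<Rightarrow> ('a ^ 'n) set set" where
  "self_dual_codes bar \<Phi> =
     {C. vec.subspace C \<and> C = dual_code bar C \<and> (\<forall>c\<in>C. \<forall>\<phi>\<in>\<Phi>. (\<Sum>i\<in>UNIV. \<phi> (c $ i)) = 0)}"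

definition perm_vec :: "('n \<Rightarrow> 'n) \<Rightarrow> 'a ^ 'n \<Rightarrow> 'a ^ 'n" where
  "perm_vec \<pi> x = (\<chi> i. x $ inv \<pi> i)"

definition perm_code :: "('n \<Rightarrow> 'n) \<Rightarrow> ('a ^ 'n) set \<Rightarrow> ('a ^ 'n) set" where
  "perm_code \<pi> C = perm_vec \<pi> ` C"

text \<open>The class of a code in \<open>self_dual_codes bar \<Phi>\<close> stays inside that family, see
  \<open>self_dual_codes_perm\<close> below.\<close>

definition code_class :: "('a ^ 'n) set \<Rightarrow> ('a ^ 'n) set set" where
  "code_class C = {perm_code \<pi> C | \<pi>. \<pi> permutes UNIV}"

definition code_aut :: "('a ^ 'n) set \<Rightarrow> ('n \<Rightarrow> 'n) set" where
  "code_aut C = {\<pi>. \<pi> permutes UNIV \<and> perm_code \<pi> C = C}"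

definition code_classes :: "('a ^ 'n) set set \<Rightarrow> ('a ^ 'n) set set set" where
  "code_classes \<F> = code_class ` \<F>"

text \<open>A representative of an equivalence class. Everything below that is computed from a
  representative does not depend on its choice; this is proved at the end of the theory.\<close>

definition class_rep :: "('a ^ 'n) set set \<Rightarrow> ('a ^ 'n) set" where
  "class_rep K = (SOME C. C \<in> K)"


section \<open>Tuples, monomials and polynomials\<close>

text \<open>Elements of the \<open>m\<close>-dimensional coordinate space over \<open>'a\<close> are functions
  \<open>nat \<Rightarrow> 'a\<close> vanishing outside \<open>{..<m}\<close>. A monomial in the variables \<open>x\<^sub>a\<close> is an exponent
  function \<open>(nat \<Rightarrow> 'a) \<Rightarrow>\<^sub>0 nat\<close>, a polynomial a finitely supported function on monomials.\<close>

definition coord_space :: "nat \<Rightarrow> (nat \<Rightarrow> 'a::zero) set" where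
  "coord_space m = {a. \<forall>j\<ge>m. a j = 0}"

definition coord_scale :: "'a::field \<Rightarrow> (nat \<Rightarrow> 'a) \<Rightarrow> (nat \<Rightarrow> 'a)" where
  "coord_scale r a = (\<lambda>j. r * a j)"

interpretation coord: vector_space coord_scale
  by standard (auto simp: coord_scale_def fun_eq_iff algebra_simps)

definition tuples :: "nat \<Rightarrow> 'b set \<Rightarrow> 'b list set" where
  "tuples m C = {cs. length cs = m \<and> set cs \<subseteq> C}"

definition column :: "('a::zero ^ 'n) list \<Rightarrow> 'n \<Rightarrow> nat \<Rightarrow> 'a" where
  "column cs i = (\<lambda>j. if j < length cs then (cs ! j) $ i else 0)"

definition mon :: "('a::zero ^ 'n) list \<Rightarrow> (nat \<Rightarrow> 'a) \<Rightarrow>\<^sub>0 nat" where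
  "mon cs = Abs_poly_mapping (\<lambda>v. card {i. column cs i = v})"

lemma lookup_mon: "Poly_Mapping.lookup (mon (cs :: ('a::zero ^ 'n) list)) v = card {i. column cs i = v}"
proof -
  have "{v. card {i. column cs i = v} \<noteq> 0} \<subseteq> range (column cs)"
    by (auto simp: card_eq_0_iff)
  hence "finite {v. card {i. column cs i = v} \<noteq> 0}"
    by (rule finite_subset) simp
  thus ?thesis
    unfolding mon_def by (subst Abs_poly_mapping_inverse) (simp_all only: mem_Collect_eq)
qed

definition monomials :: "nat \<Rightarrow> nat \<Rightarrow> ((nat \<Rightarrow> 'a::zero) \<Rightarrow>\<^sub>0 nat) set" where
  "monomials N m = {X. Poly_Mapping.keys X \<subseteq> coord_space m \<and> (\<Sum>a\<in>Poly_Mapping.keys X. Poly_Mapping.lookup X a) = N}"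

definition mon_rank :: "((nat \<Rightarrow> 'a::field) \<Rightarrow>\<^sub>0 nat) \<Rightarrow> nat" where
  "mon_rank X = coord.dim (coord.span (Poly_Mapping.keys X))"

definition full_rank_monomials :: "nat \<Rightarrow> nat \<Rightarrow> ((nat \<Rightarrow> 'a::field) \<Rightarrow>\<^sub>0 nat) set" where
  "full_rank_monomials N m = {X \<in> monomials N m. mon_rank X = m}"

definition cwe_code ::
  "nat \<Rightarrow> ('a::field ^ 'n) set \<Rightarrow> ((nat \<Rightarrow> 'a) \<Rightarrow>\<^sub>0 nat) \<Rightarrow>\<^sub>0 complex" where
  "cwe_code m C = (if m = 0 then 1 else (\<Sum>cs\<in>tuples m C. Poly_Mapping.single (mon cs) 1))"


section \<open>The space spanned by the equivalence classes\<close>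

text \<open>A vector is given by its coordinates with respect to the basis of equivalence classes,
  extended by zero.\<close>

type_synonym ('a, 'n) code_vec = "('a ^ 'n) set set \<Rightarrow> complex"

definition code_space :: "('a ^ 'n) set set \<Rightarrow> ('a, 'n) code_vec set" where
  "code_space \<F> = {v. \<forall>K. K \<notin> code_classes \<F> \<longrightarrow> v K = 0}"

definition basis_vec :: "('a ^ 'n) set set \<Rightarrow> ('a, 'n) code_vec" where
  "basis_vec K = (\<lambda>L. if L = K then 1 else 0)"

definition code_inner :: "('a ^ 'n) set set \<Rightarrow> ('a, 'n) code_vec \<Rightarrow> ('a, 'n) code_vec \<Rightarrow> complex" where
  "code_inner \<F> v w =
     (\<Sum>K\<in>code_classes \<F>. of_nat (card (code_aut (class_rep K))) * v K * cnj (w K))"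

definition kneser_hecke ::
  "('a::field ^ 'n) set set \<Rightarrow> nat \<Rightarrow> ('a, 'n) code_vec \<Rightarrow> ('a, 'n) code_vec" where
  "kneser_hecke \<F> n v = (\<lambda>L. \<Sum>K\<in>code_classes \<F>.
     v K * (\<Sum>D | D \<in> \<F> \<and> vec.dim (class_rep K \<inter> D) = n - 1. basis_vec (code_class D) L))"

definition cwe ::
  "('a::field ^ 'n) set set \<Rightarrow> nat \<Rightarrow> ('a, 'n) code_vec \<Rightarrow> ((nat \<Rightarrow> 'a) \<Rightarrow>\<^sub>0 nat) \<Rightarrow>\<^sub>0 complex" where
  "cwe \<F> m v = (\<Sum>K\<in>code_classes \<F>. Poly_Mapping.single 0 (v K) * cwe_code m (class_rep K))"

definition mon_coeff ::
  "('a::field ^ 'n) set set \<Rightarrow> nat \<Rightarrow> ((nat \<Rightarrow> 'a) \<Rightarrow>\<^sub>0 nat) \<Rightarrow> ('a, 'n) code_vec \<Rightarrow> complex" where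
  "mon_coeff \<F> m X v =
     (\<Sum>K\<in>code_classes \<F>. v K * of_nat (card {cs \<in> tuples m (class_rep K). mon cs = X}))"

definition V_space :: "('a::field ^ 'n) set set \<Rightarrow> int \<Rightarrow> ('a, 'n) code_vec set" where
  "V_space \<F> m =
     (if m < 0 then code_space \<F> else {v \<in> code_space \<F>. cwe \<F> (nat m) v = 0})"

definition W_space :: "('a::field ^ 'n) set set \<Rightarrow> int \<Rightarrow> ('a, 'n) code_vec set" where
  "W_space \<F> m = {w \<in> code_space \<F>. \<forall>v\<in>V_space \<F> m. code_inner \<F> v w = 0}"

definition Y_space :: "('a::field ^ 'n) set set \<Rightarrow> nat \<Rightarrow> ('a, 'n) code_vec set" where
  "Y_space \<F> m = W_space \<F> (int m) \<inter> V_space \<F> (int m - 1)"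

definition hyperplanes_through ::
  "nat \<Rightarrow> ('a::field ^ 'n) set \<Rightarrow> ('a ^ 'n) list \<Rightarrow> ('a ^ 'n) set set" where
  "hyperplanes_through n C cs =
     {E. vec.subspace E \<and> E \<subseteq> C \<and> vec.dim E = n - 1 \<and> set cs \<subseteq> E}"

definition neighbour_count :: "('a ^ 'n) set set \<Rightarrow> ('a ^ 'n) set \<Rightarrow> ('a ^ 'n) set \<Rightarrow> nat" where
  "neighbour_count \<F> E C = card {D \<in> \<F>. D \<inter> C = E}"


section \<open>Independence of the chosen representatives\<close>

lemma perm_vec_comp:
  assumes "\<pi> permutes UNIV" "\<rho> permutes UNIV"
  shows "perm_vec \<pi> (perm_vec \<rho> x) = perm_vec (\<pi> \<circ> \<rho>) x"
  using assms by (simp add: perm_vec_def vec_eq_iff o_inv_distrib permutes_bij)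

lemma perm_code_comp:
  assumes "\<pi> permutes UNIV" "\<rho> permutes UNIV"
  shows "perm_code \<pi> (perm_code \<rho> C) = perm_code (\<pi> \<circ> \<rho>) C"
  using assms by (simp add: perm_code_def image_image perm_vec_comp)

lemma perm_vec_id [simp]: "perm_vec id x = x"
  by (simp add: perm_vec_def vec_eq_iff)

lemma perm_code_id [simp]: "perm_code id C = C"
  by (simp add: perm_code_def)

lemma perm_code_inv:
  assumes "\<pi> permutes UNIV"
  shows "perm_code (inv \<pi>) (perm_code \<pi> C) = C" "perm_code \<pi> (perm_code (inv \<pi>) C) = C"
  using assms by (simp_all add: perm_code_comp permutes_inv permutes_inv_o)

lemma inj_perm_vec: "\<pi> permutes UNIV \<Longrightarrow> inj (perm_vec \<pi>)"
  by (rule inj_on_inverseI[where g = "perm_vec (inv \<pi>)"])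
     (simp add: perm_vec_comp permutes_inv permutes_inv_o)

lemma code_class_self: "C \<in> code_class C"
  unfolding code_class_def using permutes_id perm_code_id by fastforce

lemma class_rep_code_class: "class_rep (code_class C) \<in> code_class C"
  unfolding class_rep_def by (rule someI) (rule code_class_self)

lemma code_class_perm:
  assumes "\<pi> permutes UNIV"
  shows "code_class (perm_code \<pi> C) = code_class C"
proof (intro equalityI subsetI)
  fix D assume "D \<in> code_class (perm_code \<pi> C)"
  thus "D \<in> code_class C"
    unfolding code_class_def using assms by (auto simp: perm_code_comp intro: permutes_compose)
next
  fix D assume "D \<in> code_class C"
  then obtain \<rho> where \<rho>: "\<rho> permutes UNIV" "D = perm_code \<rho> C"
    by (auto simp: code_class_def)
  have "D = perm_code (\<rho> \<circ> inv \<pi>) (perm_code \<pi> C)"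
    using assms \<rho> by (simp add: perm_code_comp permutes_inv permutes_compose o_assoc[symmetric] permutes_inv_o)
  thus "D \<in> code_class (perm_code \<pi> C)"
    unfolding code_class_def using permutes_compose[OF permutes_inv[OF assms] \<rho>(1)] by blast
qed

lemma card_code_aut_class:
  fixes C :: "('a ^ 'n) set"
  assumes "D \<in> code_class C"
  shows "card (code_aut D) = card (code_aut C)"
proof -
  obtain \<pi> where \<pi>: "\<pi> permutes UNIV" and D: "D = perm_code \<pi> C"
    using assms by (auto simp: code_class_def)
  have iv: "inv \<pi> permutes UNIV" using \<pi> by (rule permutes_inv)
  have "bij_betw (\<lambda>\<rho>. \<pi> \<circ> \<rho> \<circ> inv \<pi>) (code_aut C) (code_aut D)"
  proof (rule bij_betw_byWitness[where f' = "\<lambda>\<rho>. inv \<pi> \<circ> \<rho> \<circ> \<pi>"])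
    show "\<forall>\<rho>\<in>code_aut C. inv \<pi> \<circ> (\<pi> \<circ> \<rho> \<circ> inv \<pi>) \<circ> \<pi> = \<rho>"
      by (simp add: fun_eq_iff permutes_inverses[OF \<pi>])
    show "\<forall>\<rho>\<in>code_aut D. \<pi> \<circ> (inv \<pi> \<circ> \<rho> \<circ> \<pi>) \<circ> inv \<pi> = \<rho>"
      by (simp add: fun_eq_iff permutes_inverses[OF \<pi>])
    show "(\<lambda>\<rho>. \<pi> \<circ> \<rho> \<circ> inv \<pi>) ` code_aut C \<subseteq> code_aut D"
      using \<pi> iv by (auto simp: code_aut_def D permutes_compose perm_code_comp[symmetric] perm_code_inv)
    show "(\<lambda>\<rho>. inv \<pi> \<circ> \<rho> \<circ> \<pi>) ` code_aut D \<subseteq> code_aut C"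
      using \<pi> iv by (auto simp: code_aut_def D permutes_compose perm_code_comp[symmetric] perm_code_inv)
  qed
  thus ?thesis by (simp add: bij_betw_same_card)
qed

lemma mon_perm:
  fixes cs :: "('a::zero ^ 'n) list"
  assumes "\<pi> permutes UNIV"
  shows "mon (map (perm_vec \<pi>) cs) = mon cs"
proof -
  have "card {i. column (map (perm_vec \<pi>) cs) i = v} = card {i. column cs i = v}" for v
  proof -
    have *: "column (map (perm_vec \<pi>) cs) i = column cs (inv \<pi> i)" for i
      by (auto simp: column_def perm_vec_def)
    have "{i. column (map (perm_vec \<pi>) cs) i = v} = \<pi> ` {i. column cs i = v}"
      using permutes_inverses[OF assms] by (force simp: * image_iff)
    thus ?thesis
      by (simp add: card_image permutes_inj_on[OF assms])
  qed
  thus ?thesis by (simp add: mon_def)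
qed

lemma tuples_perm:
  "tuples m (perm_code \<pi> C) = map (perm_vec \<pi>) ` tuples m C"
proof (intro equalityI subsetI)
  fix cs assume "cs \<in> tuples m (perm_code \<pi> C)"
  hence "length cs = m" "cs \<in> lists (perm_vec \<pi> ` C)"
    by (auto simp: tuples_def perm_code_def)
  thus "cs \<in> map (perm_vec \<pi>) ` tuples m C"
    unfolding lists_image tuples_def by auto
qed (auto 4 3 simp: tuples_def perm_code_def)

lemma inj_map_perm_vec: "\<pi> permutes UNIV \<Longrightarrow> inj_on (map (perm_vec \<pi>)) A"
  using inj_mapI[OF inj_perm_vec] by (rule inj_on_subset) auto

lemma cwe_code_class:
  assumes "D \<in> code_class C"
  shows "cwe_code m D = cwe_code m C"
  using assms unfolding code_class_def cwe_code_def
  by (auto simp: tuples_perm sum.reindex inj_map_perm_vec mon_perm)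

lemma card_mon_class:
  assumes "D \<in> code_class C"
  shows "card {cs \<in> tuples m D. mon cs = X} = card {cs \<in> tuples m C. mon cs = X}"
proof -
  obtain \<pi> where \<pi>: "\<pi> permutes UNIV" and D: "D = perm_code \<pi> C"
    using assms by (auto simp: code_class_def)
  have "{cs \<in> tuples m D. mon cs = X} = map (perm_vec \<pi>) ` {cs \<in> tuples m C. mon cs = X}"
    unfolding D tuples_perm by (auto simp: mon_perm[OF \<pi>])
  thus ?thesis by (simp add: card_image inj_map_perm_vec[OF \<pi>])
qed

lemma sum_perm_vec:
  assumes "\<pi> permutes (UNIV :: 'n::finite set)"
  shows "(\<Sum>i\<in>UNIV. g (x $ inv \<pi> i)) = (\<Sum>i\<in>(UNIV :: 'n set). (g (x $ i) :: 'b::comm_monoid_add))"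
  by (rule sum.reindex_bij_betw[where h = "inv \<pi>" and g = "\<lambda>i. g (x $ i)"])
     (use permutes_inv[OF assms] in \<open>simp add: permutes_bij\<close>)

lemma form_perm:
  fixes x y :: "'a::{field,finite} ^ 'n"
  assumes "\<pi> permutes UNIV"
  shows "form bar (perm_vec \<pi> x) (perm_vec \<pi> y) = form bar x y"
  unfolding form_def perm_vec_def
  by simp (rule sum.reindex_bij_betw[where h = "inv \<pi>" and g = "\<lambda>i. x $ i * bar (y $ i)"],
     use permutes_inv[OF assms] in \<open>simp add: permutes_bij\<close>)

lemma linear_perm_vec: "Vector_Spaces.linear (*s) (*s) (perm_vec \<pi> :: 'a::field ^ 'n \<Rightarrow> 'a ^ 'n)"
  by (simp add: Vector_Spaces.linear_iff vec.vector_space_axioms perm_vec_def vec_eq_iff)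

lemma self_dual_codes_perm:
  fixes C :: "('a::{field,finite} ^ 'n) set"
  assumes "C \<in> self_dual_codes bar \<Phi>" and \<pi>: "\<pi> permutes UNIV"
  shows "perm_code \<pi> C \<in> self_dual_codes bar \<Phi>"
proof -
  have C: "vec.subspace C" "C = dual_code bar C"
      "\<And>c \<phi>. c \<in> C \<Longrightarrow> \<phi> \<in> \<Phi> \<Longrightarrow> (\<Sum>i\<in>UNIV. \<phi> (c $ i)) = 0"
    using assms(1) by (auto simp: self_dual_codes_def)
  have inv: "perm_vec \<pi> (perm_vec (inv \<pi>) y) = y" for y :: "'a ^ 'n"
    by (simp add: perm_vec_comp[OF \<pi> permutes_inv[OF \<pi>]] permutes_inv_o[OF \<pi>])
  have "vec.subspace (perm_code \<pi> C)"
    unfolding perm_code_def using linear_perm_vec C(1) by (rule vec.linear_subspace_image)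
  moreover have "dual_code bar (perm_code \<pi> C) = perm_code \<pi> (dual_code bar C)"
  proof (intro equalityI subsetI)
    fix y assume "y \<in> dual_code bar (perm_code \<pi> C)"
    hence "form bar (perm_vec \<pi> x) (perm_vec \<pi> (perm_vec (inv \<pi>) y)) = 0" if "x \<in> C" for x
      using that by (simp add: dual_code_def perm_code_def inv)
    hence "perm_vec (inv \<pi>) y \<in> dual_code bar C"
      by (simp add: form_perm[OF \<pi>] dual_code_def)
    thus "y \<in> perm_code \<pi> (dual_code bar C)"
      unfolding perm_code_def by (metis imageI inv)
  qed (auto simp: dual_code_def perm_code_def form_perm[OF \<pi>])
  moreover have "(\<Sum>i\<in>UNIV. \<phi> (perm_vec \<pi> c $ i)) = 0" if "c \<in> C" "\<phi> \<in> \<Phi>" for c \<phi>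
    using C(3)[OF that] by (simp add: perm_vec_def sum_perm_vec[OF \<pi>])
  ultimately show ?thesis
    using C(2) by (auto simp: self_dual_codes_def perm_code_def)
qed

lemma neighbour_sum_class:
  fixes C :: "('a::{field,finite} ^ 'n) set"
  assumes "C' \<in> code_class C" and \<F>: "\<F> = self_dual_codes bar \<Phi>"
  shows "(\<Sum>D | D \<in> \<F> \<and> vec.dim (C' \<inter> D) = k. basis_vec (code_class D) L)
       = (\<Sum>D | D \<in> \<F> \<and> vec.dim (C \<inter> D) = k. basis_vec (code_class D) L)"
proof -
  obtain \<pi> where \<pi>: "\<pi> permutes UNIV" and C': "C' = perm_code \<pi> C"
    using assms by (auto simp: code_class_def)
  have dim: "vec.dim (perm_code \<pi> A) = vec.dim A" for A :: "('a ^ 'n) set"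
    unfolding perm_code_def
    by (rule vec.dim_image_eq[OF linear_perm_vec]) (rule inj_on_subset[OF inj_perm_vec[OF \<pi>]], simp)
  have int: "perm_code \<pi> C \<inter> perm_code \<pi> D = perm_code \<pi> (C \<inter> D)" for D
    unfolding perm_code_def by (rule image_Int[symmetric]) (rule inj_perm_vec[OF \<pi>])
  have "bij_betw (perm_code \<pi>) {D. D \<in> \<F> \<and> vec.dim (C \<inter> D) = k}
          {D. D \<in> \<F> \<and> vec.dim (C' \<inter> D) = k}"
  proof (rule bij_betw_byWitness[where f' = "perm_code (inv \<pi>)"])
    show "perm_code \<pi> ` {D. D \<in> \<F> \<and> vec.dim (C \<inter> D) = k}
            \<subseteq> {D. D \<in> \<F> \<and> vec.dim (C' \<inter> D) = k}"
      by (auto simp: \<F> C' int dim self_dual_codes_perm \<pi>)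
    show "perm_code (inv \<pi>) ` {D. D \<in> \<F> \<and> vec.dim (C' \<inter> D) = k}
            \<subseteq> {D. D \<in> \<F> \<and> vec.dim (C \<inter> D) = k}"
    proof clarify
      fix D assume D: "D \<in> \<F>" and k: "k = vec.dim (C' \<inter> D)"
      have "C' \<inter> D = perm_code \<pi> (C \<inter> perm_code (inv \<pi>) D)"
        by (simp add: C' int[symmetric] perm_code_inv \<pi>)
      thus "perm_code (inv \<pi>) D \<in> \<F> \<and> vec.dim (C \<inter> perm_code (inv \<pi>) D) = vec.dim (C' \<inter> D)"
        using D by (simp add: dim \<F> self_dual_codes_perm permutes_inv \<pi>)
    qed
  qed (simp_all add: perm_code_inv \<pi>)
  thus ?thesis
    by (rule sum.reindex_bij_betw[symmetric, THEN trans]) (simp add: code_class_perm \<pi>)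
qed

end

theory Submission
  imports Defs
begin

text \<open>
  For \<open>X\<close> in \<open>M0 m\<close> count the tuples of monomial \<open>X\<close> in the neighbours \<open>D\<close> of a code \<open>C\<close>.
  A tuple inside \<open>C\<close> lies in exactly \<open>\<alpha>\<^sub>m\<close> neighbours. A tuple not contained in \<open>C\<close> lies in at
  most one, and in one precisely when a hyperplane of its coefficient vectors yields words of \<open>C\<close>;
  summing over the \<open>\<beta>\<^sub>m\<close> hyperplanes expresses the number of these tuples by numbers of
  \<open>(m - 1)\<close>-tuples of \<open>C\<close> with given monomials, minus \<open>\<beta>\<^sub>m\<close> times the number of tuples inside
  \<open>C\<close>. Hence \<open>a\<^sub>X(T v) = \<nu>\<^sub>m a\<^sub>X(v)\<close> on \<open>V\<^bsub>m-1\<^esub>\<close>. As \<open>T\<close> is self-adjoint and \<open>V\<^sub>n = 0\<close>,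
  the claim follows once the \<open>\<nu>\<^sub>m\<close> are known to be distinct. For this, the number of \<open>D\<close> with
  \<open>D \<inter> C = E\<close> is either \<open>0\<close> or a constant of the Type, and it is nonzero as soon as \<open>E\<close> contains
  a certain vector \<open>w\<close> common to all codes; since adjoining \<open>w\<close> raises the dimension of the span
  of an \<open>m\<close>-tuple by at most one, \<open>\<alpha>\<^sub>m\<close> does not increase with \<open>m\<close>.
\<close>

section \<open>An additive character of a finite field\<close>

text \<open>Condition (2) gives no formula for the \<open>\<nu>\<close>, so their distinctness has
  to come from the geometry of neighbours. For a hyperplane E of C, the plane (dual of E)/E is
  spanned by some e in C and some f outside C, and the D with D \<inter> C = E correspond to the t
  for which f + \<open>bar t\<close> e satisfies the Type. An additive member of the Type gives a
  condition free of t, which may fail: this is why the count can drop to 0. These conditions do hold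
  when f is orthogonal to w. For i < j, forcing w into the span of the i-tuple costs at most one
  dimension, while the full rank of the j-tuple supplies at least one more. The two balance and give
  only the weak inequality between the \<open>\<alpha>\<close>, so strictness comes entirely from
  the \<open>\<beta>\<close>. Solvability of the remaining conditions on t is a statement about
  characters of subgroups of the field, and orthogonality of characters also gives the size of a
  dual code, for bilinear and Hermitian forms alike. Hence the additive character at the start, and
  hyperplanes measured by size. A level m at which no pair as in (2) exists does not shrink the
  filtration, so an arbitrary value of \<open>\<alpha> m\<close> there does no harm.\<close>

lift_definition unit_char :: "qmodz \<Rightarrow> complex" is "\<lambda>x. cis (2 * pi * of_rat x)"
proof -
  fix x y :: rat
  assume "x - y \<in> \<int>"
  then obtain k where k: "x = y + of_int k"
    by (metis Ints_cases add.commute diff_add_cancel)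
  have "cis (2 * pi * of_rat x) = cis (2 * pi * of_rat y) * cis (2 * pi * of_int k)"
    by (simp add: k of_rat_add distrib_left flip: cis_mult)
  also have "cis (2 * pi * of_int k) = 1"
    by (rule cis_multiple_2pi) simp
  finally show "cis (2 * pi * of_rat x) = cis (2 * pi * of_rat y)" by simp
qed

lemma unit_char_add: "unit_char (x + y) = unit_char x * unit_char y"
  by transfer (simp add: of_rat_add cis_mult distrib_left)

lemma unit_char_0 [simp]: "unit_char 0 = 1"
  by transfer simp

lemma unit_char_uminus: "unit_char (- x) = cnj (unit_char x)"
  by transfer (simp add: of_rat_minus cis_cnj)

lemma unit_char_eq_1_iff: "unit_char x = 1 \<longleftrightarrow> x = 0"
proof
  assume "unit_char x = 1"
  thus "x = 0"
  proof transfer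
    fix x :: rat
    assume "cis (2 * pi * of_rat x) = 1"
    hence "cos (2 * pi * of_rat x) = 1"
      by (simp add: complex_eq_iff)
    then obtain k :: int where "2 * pi * of_rat x = of_int k * 2 * pi"
      by (auto simp: cos_one_2pi_int)
    hence "(of_rat x :: real) = of_rat (of_int k)" by simp
    hence "x = of_int k" by (simp only: of_rat_eq_iff)
    thus "x - 0 \<in> \<int>" by simp
  qed
qed simp

section \<open>Automorphisms, Frobenius and the absolute trace\<close>

lemma field_automorphismD:
  assumes "field_automorphism \<sigma>"
  shows "\<sigma> (x + y) = \<sigma> x + \<sigma> y" "\<sigma> (x * y) = \<sigma> x * \<sigma> y" "\<sigma> 0 = 0" "\<sigma> 1 = 1"
proof -
  show 1: "\<sigma> (x + y) = \<sigma> x + \<sigma> y" for x y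
    using assms by (simp add: field_automorphism_def)
  show 2: "\<sigma> (x * y) = \<sigma> x * \<sigma> y" for x y
    using assms by (simp add: field_automorphism_def)
  show 3: "\<sigma> 0 = 0" using 1[of 0 0] by (metis add.right_neutral add_left_cancel)
  have "inj \<sigma>" using assms by (simp add: field_automorphism_def bij_is_inj)
  hence "\<sigma> 1 \<noteq> 0" using 3 by (metis injD zero_neq_one)
  thus "\<sigma> 1 = 1" using 2[of 1 1] by simp
qed

text \<open>Dedekind's independence of characters. Subtracting \<open>\<tau> y\<close> times the
  relation at x from the relation at \<open>y * x\<close> removes the term of \<open>\<tau>\<close>,
  and the induction hypothesis applies to the shorter relation.\<close>

lemma automorphisms_independent:
  fixes c :: "('a::field \<Rightarrow> 'a) \<Rightarrow> 'a"
  assumes "finite S" "\<And>\<sigma>. \<sigma> \<in> S \<Longrightarrow> field_automorphism \<sigma>"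
    "\<And>x. (\<Sum>\<sigma>\<in>S. c \<sigma> * \<sigma> x) = 0" "\<sigma> \<in> S"
  shows "c \<sigma> = 0"
  using assms
proof (induction S arbitrary: c \<sigma> rule: finite_induct)
  case empty
  thus ?case by simp
next
  case (insert \<tau> S)
  note aut = field_automorphismD[OF insert.prems(1)]
  have "(\<Sum>\<sigma>\<in>S. (c \<sigma> * (\<sigma> y - \<tau> y)) * \<sigma> x) = 0" for x y
  proof -
    have "0 = (\<Sum>\<sigma>\<in>insert \<tau> S. c \<sigma> * \<sigma> (y * x)) - \<tau> y * (\<Sum>\<sigma>\<in>insert \<tau> S. c \<sigma> * \<sigma> x)"
      by (simp only: insert.prems(2)) simp
    also have "\<dots> = (\<Sum>\<sigma>\<in>insert \<tau> S. (c \<sigma> * (\<sigma> y - \<tau> y)) * \<sigma> x)"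
      by (simp only: sum_distrib_left sum_subtractf[symmetric])
        (rule sum.cong, simp_all only: aut(2) algebra_simps)
    finally show ?thesis using insert.hyps by simp
  qed
  hence *: "c \<rho> * (\<rho> y - \<tau> y) = 0" if "\<rho> \<in> S" for \<rho> y
    using insert.IH[of "\<lambda>\<sigma>. c \<sigma> * (\<sigma> y - \<tau> y)" \<rho>] insert.prems(1) that by simp
  have S0: "c \<rho> = 0" if "\<rho> \<in> S" for \<rho>
  proof -
    have "\<rho> \<noteq> \<tau>" using that insert.hyps by auto
    then obtain y where "\<rho> y \<noteq> \<tau> y" by auto
    thus ?thesis using *[OF that, of y] by simp
  qed
  have "c \<tau> = 0"
    using insert.prems(2)[of 1] insert.hyps S0 aut(4)[of \<tau>] by simp
  with S0 insert.prems(3) show ?case by auto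
qed

lemma prime_CHAR_finite: "prime CHAR('a::{field,finite})"
  by (rule prime_CHAR_semidom) (rule finite_imp_CHAR_pos, simp)

lemma frobenius_add:
  fixes x y :: "'a::{field,finite}"
  shows "(x + y) ^ CHAR('a) = x ^ CHAR('a) + y ^ CHAR('a)"
proof -
  let ?p = "CHAR('a)"
  have p: "prime ?p" by (rule prime_CHAR_finite)
  have "of_nat (?p choose k) = (0 :: 'a)" if "k \<in> {1..<?p}" for k
    using that dvd_choose_prime[of k ?p] p by (auto simp: of_nat_eq_0_iff_char_dvd)
  hence "(\<Sum>k\<in>{1..<?p}. of_nat (?p choose k) * x ^ k * y ^ (?p - k)) = 0"
    by (intro sum.neutral) auto
  moreover have "{..?p} = insert 0 (insert ?p {1..<?p})"
    using prime_gt_0_nat[OF p] by auto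
  ultimately show ?thesis
    using prime_gt_0_nat[OF p] by (simp add: binomial_ring)
qed

lemma frobenius_automorphism: "field_automorphism (\<lambda>x :: 'a::{field,finite}. x ^ CHAR('a))"
proof -
  have p: "prime CHAR('a)" by (rule prime_CHAR_finite)
  have "inj (\<lambda>x :: 'a. x ^ CHAR('a))"
  proof (rule injI)
    fix x y :: 'a
    assume "x ^ CHAR('a) = y ^ CHAR('a)"
    hence "(x - y) ^ CHAR('a) = 0"
      using frobenius_add[of "x - y" y] by simp
    thus "x = y" by simp
  qed
  hence "bij (\<lambda>x :: 'a. x ^ CHAR('a))"
    by (simp add: bij_def finite_UNIV_inj_surj)
  thus ?thesis
    by (simp add: field_automorphism_def frobenius_add power_mult_distrib)
qed

text \<open>The polynomial x^p - x has at most p roots, and the images of 0, ..., p - 1 are already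
  p of them.\<close>

lemma frobenius_fixed_iff:
  "(z :: 'a::{field,finite}) ^ CHAR('a) = z \<longleftrightarrow> z \<in> range of_int"
proof -
  let ?p = "CHAR('a)"
  have p: "prime ?p" by (rule prime_CHAR_finite)
  define P :: "'a poly" where "P = monom 1 ?p - monom 1 1"
  have deg: "coeff P ?p = 1" "degree P \<le> ?p"
    using prime_gt_1_nat[OF p] by (auto simp: P_def intro!: degree_diff_le degree_monom_le order.trans[OF degree_monom_le])
  hence P0: "P \<noteq> 0" by auto
  have roots: "{z. poly P z = 0} = {z. z ^ ?p = z}"
    by (auto simp: P_def poly_monom)
  have nat: "(of_nat k :: 'a) ^ ?p = of_nat k" for k
    using prime_gt_0_nat[OF p] by (induction k) (simp_all add: frobenius_add)
  have "inj_on (of_nat :: nat \<Rightarrow> 'a) {..<?p}"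
  proof (rule linorder_inj_onI')
    fix i j assume "i \<in> {..<?p}" "j \<in> {..<?p}" "i < j"
    hence "\<not> ?p dvd j - i" by (auto dest: dvd_imp_le)
    hence "of_nat (j - i) \<noteq> (0 :: 'a)" by (simp only: of_nat_eq_0_iff_char_dvd not_False_eq_True)
    thus "of_nat i \<noteq> (of_nat j :: 'a)" using \<open>i < j\<close> by (simp add: of_nat_diff)
  qed
  hence "card ((of_nat :: nat \<Rightarrow> 'a) ` {..<?p}) = ?p" by (simp add: card_image)
  moreover have "card {z :: 'a. z ^ ?p = z} \<le> ?p"
    using card_poly_roots_bound[OF P0] deg(2) roots by simp
  ultimately have eq: "(of_nat :: nat \<Rightarrow> 'a) ` {..<?p} = {z. z ^ ?p = z}"
    by (intro card_seteq) (auto simp: nat)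
  show ?thesis
  proof
    assume "z ^ ?p = z"
    then obtain k where "z = of_nat k" using eq by blast
    thus "z \<in> range of_int" by (metis of_int_of_nat_eq rangeI)
  next
    assume "z \<in> range of_int"
    then obtain k where k: "z = of_int k" by blast
    have pp: "0 < int ?p" using prime_gt_0_nat[OF p] by simp
    have "(of_int (k div int ?p * int ?p + k mod int ?p) :: 'a) = of_int (k mod int ?p)"
      by (simp only: of_int_add of_int_mult of_int_of_nat_eq of_nat_CHAR mult_zero_right add_0)
    hence "z = of_int (k mod int ?p)" by (simp only: k div_mult_mod_eq)
    hence "z = of_nat (nat (k mod int ?p))" using pp by simp
    thus "z ^ ?p = z" by (simp only: nat)
  qed
qed

lemma abs_trace_add: "abs_trace (x + y) = abs_trace x + abs_trace y"
  unfolding abs_trace_def sum.distrib[symmetric] by (rule sum.cong) (auto simp: field_automorphismD)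

text \<open>Composition with Frobenius permutes the automorphisms, so the trace is a fixed point of
  Frobenius. Hence the integer chosen in \<open>prime_field_div_char\<close> exists for every trace
  value.\<close>

lemma abs_trace_in_prime_field: "abs_trace (x :: 'a::{field,finite}) \<in> range of_int"
proof -
  let ?\<phi> = "\<lambda>x :: 'a. x ^ CHAR('a)"
  let ?A = "{\<sigma> :: 'a \<Rightarrow> 'a. field_automorphism \<sigma>}"
  have \<phi>: "field_automorphism ?\<phi>" by (rule frobenius_automorphism)
  have bij: "bij ?\<phi>" using \<phi> by (simp only: field_automorphism_def)
  have inj: "inj_on (\<lambda>\<sigma>. ?\<phi> \<circ> \<sigma>) ?A"
  proof (rule inj_onI)
    fix \<sigma> \<tau>
    assume "?\<phi> \<circ> \<sigma> = ?\<phi> \<circ> \<tau>"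
    thus "\<sigma> = \<tau>" using injD[OF bij_is_inj[OF bij]] by (simp add: fun_eq_iff)
  qed
  have "field_automorphism (?\<phi> \<circ> \<sigma>)" if "field_automorphism \<sigma>" for \<sigma>
    unfolding field_automorphism_def
  proof (intro conjI)
    show "bij (?\<phi> \<circ> \<sigma>)"
      using that by (intro bij_comp[OF _ bij]) (simp add: field_automorphism_def)
  qed (simp_all add: field_automorphismD[OF that] frobenius_add power_mult_distrib)
  hence "(\<lambda>\<sigma>. ?\<phi> \<circ> \<sigma>) ` ?A \<subseteq> ?A" by blast
  hence img: "(\<lambda>\<sigma>. ?\<phi> \<circ> \<sigma>) ` ?A = ?A"
    using inj by (intro endo_inj_surj) auto
  have "?\<phi> (\<Sum>\<sigma>\<in>B. \<sigma> x) = (\<Sum>\<sigma>\<in>B. ?\<phi> (\<sigma> x))" if "finite B" for B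
    using that by (induction B rule: finite_induct)
      (simp_all add: frobenius_add prime_gt_0_nat[OF prime_CHAR_finite])
  hence "?\<phi> (abs_trace x) = (\<Sum>\<sigma>\<in>?A. (?\<phi> \<circ> \<sigma>) x)"
    unfolding abs_trace_def by simp
  also have "\<dots> = (\<Sum>\<sigma>\<in>?A. \<sigma> x)"
    using sum.reindex[OF inj, of "\<lambda>\<sigma>. \<sigma> x"] unfolding img by (simp add: o_def)
  finally show ?thesis
    by (simp add: abs_trace_def frobenius_fixed_iff)
qed

text \<open>Otherwise the automorphisms would satisfy a linear relation with all coefficients
  1.\<close>

lemma abs_trace_nonzero: "\<exists>x :: 'a::{field,finite}. abs_trace x \<noteq> 0"
proof (rule ccontr)
  assume "\<nexists>x :: 'a. abs_trace x \<noteq> 0"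
  hence 0: "(\<Sum>\<sigma> | field_automorphism \<sigma>. 1 * \<sigma> x) = 0" for x :: 'a
    unfolding abs_trace_def mult_1 by blast
  have "1 = (0 :: 'a)"
  proof (rule automorphisms_independent[OF _ _ 0])
    show "(id :: 'a \<Rightarrow> 'a) \<in> {\<sigma>. field_automorphism \<sigma>}"
      by (simp add: field_automorphism_def)
  qed simp_all
  thus False by simp
qed

section \<open>The trace character and character sums\<close>

definition trace_char :: "'a::{field,finite} \<Rightarrow> qmodz" where
  "trace_char x = prime_field_div_char (abs_trace x)"

lemma trace_form_eq: "trace_form bar r x y = trace_char (r * x * bar y)"
  by (simp add: trace_form_def trace_char_def)

lemma trace_char_add: "trace_char (x + y :: 'a::{field,finite}) = trace_char x + trace_char y"
proof -
  obtain k l where "abs_trace x = of_int k" "abs_trace y = of_int l"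
    using abs_trace_in_prime_field[of x] abs_trace_in_prime_field[of y] by blast
  moreover from this have "abs_trace (x + y) = of_int (k + l)"
    by (simp add: abs_trace_add)
  ultimately show ?thesis
    unfolding trace_char_def
    by (simp only: prime_field_div_char_of_int) (transfer, simp add: add_divide_distrib)
qed

lemma trace_char_0 [simp]: "trace_char 0 = 0"
  using trace_char_add[of 0 0] by simp

lemma trace_char_sum: "trace_char (sum f S) = (\<Sum>i\<in>S. trace_char (f i))"
  by (induction S rule: infinite_finite_induct) (simp_all add: trace_char_add)

lemma trace_char_nonzero: "\<exists>x :: 'a::{field,finite}. trace_char x \<noteq> 0"
proof -
  obtain x :: 'a where x: "abs_trace x \<noteq> 0" using abs_trace_nonzero by blast
  obtain k where k: "abs_trace x = of_int k" using abs_trace_in_prime_field by blast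
  have "trace_char x \<noteq> 0"
  proof
    assume "trace_char x = 0"
    hence "to_qmodz (of_int k / of_nat CHAR('a)) = to_qmodz 0"
      unfolding trace_char_def k prime_field_div_char_of_int by (simp add: zero_qmodz_def)
    hence "(of_int k / of_nat CHAR('a) :: rat) \<in> \<int>"
      by (simp add: qmodz.abs_eq_iff)
    then obtain l where "(of_int k / of_nat CHAR('a) :: rat) = of_int l"
      by (auto elim: Ints_cases)
    hence "(of_int k :: rat) = of_int (l * int CHAR('a))"
      using prime_gt_0_nat[OF prime_CHAR_finite[where 'a = 'a]] by (simp add: field_simps)
    hence "k = l * int CHAR('a)" by (simp only: of_int_eq_iff)
    hence "of_int k = (0 :: 'a)" by simp
    thus False using x k by simp
  qed
  thus ?thesis ..
qed

lemma trace_char_nondegenerate: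
  fixes c :: "'a::{field,finite}"
  assumes "\<And>r. trace_char (r * c) = 0"
  shows "c = 0"
proof (rule ccontr)
  assume "c \<noteq> 0"
  hence "trace_char x = 0" for x :: 'a using assms[of "x / c"] by simp
  thus False using trace_char_nonzero by blast
qed

text \<open>Translation by y permutes the finite set S and multiplies the sum by \<open>h y\<close>.
  Read contrapositively, this is the orthogonality of characters.\<close>

lemma character_sum_trivial:
  fixes h :: "'b::ab_group_add \<Rightarrow> complex"
  assumes "finite S" "\<And>x y. x \<in> S \<Longrightarrow> y \<in> S \<Longrightarrow> x + y \<in> S"
    "\<And>x y. x \<in> S \<Longrightarrow> y \<in> S \<Longrightarrow> h (x + y) = h x * h y" "sum h S \<noteq> 0" "y \<in> S"
  shows "h y = 1"
proof -
  have inj: "inj_on (\<lambda>x. y + x) S" by (simp add: inj_on_def)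
  have "(\<lambda>x. y + x) ` S = S"
    using assms(1,2,5) inj by (intro endo_inj_surj) auto
  hence "sum h S = (\<Sum>x\<in>S. h (y + x))"
    using sum.reindex[OF inj, of h] by simp
  also have "\<dots> = h y * sum h S"
    using assms(3,5) by (simp add: sum_distrib_left)
  finally show ?thesis using assms(4) by simp
qed

definition psi :: "'a::{field,finite} \<Rightarrow> complex" where
  "psi x = unit_char (trace_char x)"

lemma psi_add: "psi (x + y) = psi x * psi y"
  by (simp add: psi_def trace_char_add unit_char_add)

lemma psi_0 [simp]: "psi 0 = 1"
  by (simp add: psi_def)

lemma sum_psi_mult:
  "(\<Sum>x\<in>UNIV. psi (x * c)) = (if c = 0 then of_nat CARD('a) else 0 :: complex)"
  for c :: "'a::{field,finite}"
proof (cases "c = 0")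
  case False
  have "(\<Sum>x\<in>UNIV. psi (x * c)) = (0 :: complex)"
  proof (rule ccontr)
    assume "(\<Sum>x\<in>UNIV. psi (x * c)) \<noteq> 0"
    hence "psi (r * c) = 1" for r
      using character_sum_trivial[of UNIV "\<lambda>x. psi (x * c)" r] by (simp add: psi_add distrib_right)
    hence "trace_char (r * c) = 0" for r by (simp add: psi_def unit_char_eq_1_iff)
    thus False using trace_char_nondegenerate False by blast
  qed
  thus ?thesis using False by simp
qed simp

text \<open>Summing \<open>\<bar>\<Sum>\<^bsub>r\<in>R\<^esub> e(g r - \<chi>(r t))\<bar>\<^sup>2\<close> over all \<open>t\<close> gives
  \<open>q |R| \<noteq> 0\<close>, so for some \<open>t\<close> the character \<open>g - \<chi>(\<cdot> t)\<close> of \<open>R\<close> has a nonzero sum.\<close>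

lemma character_extends:
  fixes R :: "'a::{field,finite} set" and g :: "'a \<Rightarrow> qmodz"
  assumes R: "0 \<in> R" "\<And>x y. x \<in> R \<Longrightarrow> y \<in> R \<Longrightarrow> x + y \<in> R"
    and g: "\<And>x y. x \<in> R \<Longrightarrow> y \<in> R \<Longrightarrow> g (x + y) = g x + g y"
  shows "\<exists>t. \<forall>r\<in>R. g r = trace_char (r * t)"
proof -
  define h where "h t r = unit_char (g r - trace_char (r * t))" for t r
  have split: "h t r * cnj (h t r') = unit_char (g r - g r') * psi (t * (r' - r))" for t r r'
  proof -
    have "r' * t = t * (r' - r) + r * t" by (simp add: algebra_simps)
    hence "trace_char (r' * t) = trace_char (t * (r' - r)) + trace_char (r * t)"
      by (metis trace_char_add)
    hence "(g r - trace_char (r * t)) + - (g r' - trace_char (r' * t))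
        = (g r - g r') + trace_char (t * (r' - r))"
      by simp
    thus ?thesis
      unfolding h_def psi_def by (simp only: unit_char_uminus[symmetric] unit_char_add[symmetric])
  qed
  have "(\<Sum>t\<in>UNIV. sum (h t) R * cnj (sum (h t) R))
      = (\<Sum>t\<in>UNIV. \<Sum>r\<in>R. \<Sum>r'\<in>R. unit_char (g r - g r') * psi (t * (r' - r)))"
    by (simp add: sum_product split)
  also have "\<dots> = (\<Sum>r\<in>R. \<Sum>r'\<in>R. unit_char (g r - g r') * (\<Sum>t\<in>UNIV. psi (t * (r' - r))))"
    unfolding sum_distrib_left
    by (subst sum.swap, rule sum.cong, rule refl, subst sum.swap, rule refl)
  also have "\<dots> = (\<Sum>r\<in>R. \<Sum>r'\<in>R. if r' = r then of_nat CARD('a) else 0)"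
    by (intro sum.cong refl) (simp add: sum_psi_mult)
  also have "\<dots> = of_nat (card R * CARD('a))"
    by simp
  finally have eq: "(\<Sum>t\<in>UNIV. sum (h t) R * cnj (sum (h t) R)) = of_nat (card R * CARD('a))" .
  have "card R \<noteq> 0" using R(1) by (auto simp: card_eq_0_iff)
  hence "(\<Sum>t\<in>UNIV. sum (h t) R * cnj (sum (h t) R)) \<noteq> 0"
    unfolding eq by simp
  then obtain t where t: "sum (h t) R \<noteq> 0"
    by (metis (no_types, lifting) mult_zero_left sum.neutral)
  have "h t r = 1" if "r \<in> R" for r
  proof (rule character_sum_trivial[OF _ R(2) _ t that])
    fix x y assume "x \<in> R" "y \<in> R"
    thus "h t (x + y) = h t x * h t y"
      by (simp add: h_def g algebra_simps trace_char_add flip: unit_char_add)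
  qed simp_all
  hence "g r = trace_char (r * t)" if "r \<in> R" for r
    using that by (simp add: h_def unit_char_eq_1_iff)
  thus ?thesis by blast
qed

section \<open>Subspaces and duality over a finite field\<close>

lemma card_span_insert:
  fixes E :: "('a::{field,finite} ^ 'n::finite) set"
  assumes E: "vec.subspace E" and f: "f \<notin> E"
  shows "card (vec.span (insert f E)) = CARD('a) * card E"
proof -
  have "inj_on (\<lambda>(k, x). x + k *s f) (UNIV \<times> E)"
  proof (rule inj_onI, clarify)
    fix k l x y
    assume xy: "x \<in> E" "y \<in> E" and eq: "x + k *s f = y + l *s f"
    have "(k - l) *s f = y - x" using eq by (simp add: vec.scale_left_diff_distrib algebra_simps)
    hence *: "(k - l) *s f \<in> E" using xy vec.subspace_diff[OF E] by simp
    have "k = l"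
    proof (rule ccontr)
      assume "k \<noteq> l"
      hence "f = inverse (k - l) *s ((k - l) *s f)" by (simp only: vec.scale_scale) simp
      also have "\<dots> \<in> E" by (rule vec.subspace_scale[OF E *])
      finally show False using f by simp
    qed
    thus "k = l \<and> x = y" using eq by simp
  qed
  moreover have "vec.span (insert f E) = (\<lambda>(k, x). x + k *s f) ` (UNIV \<times> E)"
  proof (intro equalityI subsetI)
    fix x assume "x \<in> vec.span (insert f E)"
    then obtain k where "x - k *s f \<in> E"
      using E by (auto simp: vec.span_breakdown_eq vec.span_eq_iff[THEN iffD2])
    thus "x \<in> (\<lambda>(k, x). x + k *s f) ` (UNIV \<times> E)"
      by (intro image_eqI[where x = "(k, x - k *s f)"]) auto
  next
    fix x assume "x \<in> (\<lambda>(k, x). x + k *s f) ` (UNIV \<times> E)"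
    then obtain k y where "y \<in> E" "x = y + k *s f" by auto
    thus "x \<in> vec.span (insert f E)"
      by (metis insertI1 insertI2 vec.span_add vec.span_base vec.span_scale)
  qed
  ultimately show ?thesis by (simp add: card_image card_cartesian_product)
qed

lemma card_span_independent:
  fixes B :: "('a::{field,finite} ^ 'n::finite) set"
  assumes "vec.independent B"
  shows "card (vec.span B) = CARD('a) ^ card B"
proof -
  have "finite B" by simp
  thus ?thesis using assms
  proof (induction B rule: finite_induct)
    case (insert b B)
    have B: "vec.independent B" "b \<notin> vec.span B"
      using insert.prems insert.hyps by (auto simp: vec.independent_insert)
    have "vec.span (insert b B) = vec.span (insert b (vec.span B))"
      by (simp only: vec.span_insert vec.span_span)
    thus ?case
      using insert B card_span_insert[OF vec.subspace_span B(2)] by simp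
  qed simp
qed

lemma card_subspace:
  fixes S :: "('a::{field,finite} ^ 'n::finite) set"
  assumes "vec.subspace S"
  shows "card S = CARD('a) ^ vec.dim S"
proof -
  obtain B where B: "B \<subseteq> S" "vec.independent B" "S \<subseteq> vec.span B" "card B = vec.dim S"
    by (rule vec.basis_exists)
  have "vec.span B = S" using B(1,3) assms vec.span_subspace by blast
  thus ?thesis using card_span_independent[OF B(2)] B(4) by simp
qed

lemma card_field_gt_1: "CARD('a::{field,finite}) > 1"
proof -
  have "card {0, 1 :: 'a} \<le> CARD('a)" by (rule card_mono) auto
  thus ?thesis by simp
qed

section \<open>The form and the size of a dual code\<close>

locale conj_form =
  fixes bar :: "'a::{field,finite} \<Rightarrow> 'a"
  assumes admissible: "admissible_conj bar"
begin

lemma bar_add: "bar (x + y) = bar x + bar y"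
  and bar_mult: "bar (x * y) = bar x * bar y"
  and bar_0 [simp]: "bar 0 = 0"
  and bar_1 [simp]: "bar 1 = 1"
  and bar_bar [simp]: "bar (bar x) = x"
proof -
  have *: "field_automorphism bar" "bar \<circ> bar = id"
    using admissible by (auto simp: admissible_conj_def field_automorphism_def)
  show "bar (x + y) = bar x + bar y" "bar (x * y) = bar x * bar y" "bar 0 = 0" "bar 1 = 1"
    using field_automorphismD[OF *(1)] by blast+
  show "bar (bar x) = x" using *(2) by (metis comp_apply id_apply)
qed

lemma bar_eq_0_iff [simp]: "bar x = 0 \<longleftrightarrow> x = 0"
  by (metis bar_0 bar_bar)

lemma bar_sum: "bar (sum f S) = (\<Sum>i\<in>S. bar (f i))"
  by (induction S rule: infinite_finite_induct) (simp_all add: bar_add)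

lemma form_add_left: "form bar (x + y) z = form bar x z + form bar y z"
  by (simp add: form_def distrib_right sum.distrib)

lemma form_add_right: "form bar x (y + z) = form bar x y + form bar x z"
  by (simp add: form_def distrib_left bar_add sum.distrib)

lemma form_scale_left: "form bar (r *s x) y = r * form bar x y"
  by (simp add: form_def sum_distrib_left mult.assoc)

lemma form_scale_right: "form bar x (r *s y) = bar r * form bar x y"
  by (simp add: form_def sum_distrib_left bar_mult mult_ac)

lemma form_commute: "form bar y x = bar (form bar x y)"
  by (simp add: form_def bar_sum bar_mult mult.commute)

lemma form_eq_0_commute: "form bar y x = 0 \<longleftrightarrow> form bar x y = 0"
  by (subst form_commute) simp

lemma form_0_left [simp]: "form bar 0 x = 0"
  by (simp add: form_def)

lemma form_diff_right: "form bar x (y - z) = form bar x y - form bar x z"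
  using form_add_right[of x "y - z" z] by simp

lemma subspace_form_kernel:
  assumes "vec.subspace C"
  shows "vec.subspace {x \<in> C. form bar x f = 0}"
  using assms by (auto simp: vec.subspace_def form_add_left form_scale_left)

text \<open>Double counting of \<open>psi (form bar x y)\<close> over x in E and all y: the sum over
  y survives only for x = 0, the sum over x only for y in the dual code.\<close>

lemma card_dual_code:
  fixes E :: "('a ^ 'n::finite) set"
  assumes E: "vec.subspace E"
  shows "card E * card (dual_code bar E) = CARD('a) ^ CARD('n)"
proof -
  have inner1: "(\<Sum>y\<in>UNIV. psi (form bar x y)) = (if x = 0 then of_nat (CARD('a) ^ CARD('n)) else 0)"
    for x :: "'a ^ 'n"
  proof (cases "x = 0")
    case False
    then obtain i where i: "x $ i \<noteq> 0" by (auto simp: vec_eq_iff)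
    have "(\<Sum>y\<in>UNIV. psi (form bar x y)) = 0"
    proof (rule ccontr)
      assume *: "(\<Sum>y\<in>UNIV. psi (form bar x y)) \<noteq> 0"
      have 1: "psi (form bar x y) = 1" for y
        by (rule character_sum_trivial[OF _ _ _ *]) (simp_all add: form_add_right psi_add)
      have "trace_char (r * x $ i) = 0" for r
      proof -
        \<comment> \<open>The entry is \<open>bar r\<close> because the form conjugates its second
          argument.\<close>
        have "form bar x (axis i (bar r)) = (\<Sum>j\<in>UNIV. if j = i then x $ j * r else 0)"
          unfolding form_def by (rule sum.cong) (auto simp: axis_def)
        hence "form bar x (axis i (bar r)) = r * x $ i" by (simp add: mult.commute)
        thus ?thesis using 1[of "axis i (bar r)"] by (simp add: psi_def unit_char_eq_1_iff)
      qed
      thus False using trace_char_nondegenerate i by blast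
    qed
    thus ?thesis using False by simp
  qed simp
  have inner2: "(\<Sum>x\<in>E. psi (form bar x y)) = (if y \<in> dual_code bar E then of_nat (card E) else 0)" for y
  proof (cases "y \<in> dual_code bar E")
    case False
    have "(\<Sum>x\<in>E. psi (form bar x y)) = 0"
    proof (rule ccontr)
      assume *: "(\<Sum>x\<in>E. psi (form bar x y)) \<noteq> 0"
      have 1: "psi (form bar x y) = 1" if "x \<in> E" for x
        by (rule character_sum_trivial[OF _ _ _ * that])
          (use E in \<open>simp_all add: form_add_left psi_add vec.subspace_add\<close>)
      have "form bar x y = 0" if "x \<in> E" for x
      proof (rule trace_char_nondegenerate)
        fix r
        have "r *s x \<in> E" by (rule vec.subspace_scale[OF E that])
        from 1[OF this] show "trace_char (r * form bar x y) = 0"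
          by (simp add: form_scale_left psi_def unit_char_eq_1_iff)
      qed
      thus False using False by (simp add: dual_code_def)
    qed
    thus ?thesis using False by simp
  qed (simp add: dual_code_def)
  have "of_nat (card E * card (dual_code bar E)) = (\<Sum>y\<in>UNIV. \<Sum>x\<in>E. psi (form bar x y))"
    by (simp add: inner2 sum.If_cases mult.commute)
  also have "\<dots> = (\<Sum>x\<in>E. \<Sum>y\<in>UNIV. psi (form bar x y))"
    by (rule sum.swap)
  also have "\<dots> = of_nat (CARD('a) ^ CARD('n))"
    using vec.subspace_0[OF E] by (simp add: inner1 del: of_nat_power)
  finally show ?thesis by (simp only: of_nat_eq_iff)
qed

end

section \<open>Neighbours of a self-dual code\<close>

locale code_family = conj_form bar for bar :: "'a::{field,finite} \<Rightarrow> 'a" +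
  fixes \<Phi> :: "('a \<Rightarrow> qmodz) set" and n :: nat and \<F> :: "('a ^ 'n::finite) set set"
  assumes length: "CARD('n) = 2 * n" and type: "is_type bar \<Phi>"
    and family: "\<F> = self_dual_codes bar \<Phi>"
begin

definition type_null :: "'a ^ 'n \<Rightarrow> bool" where
  "type_null x \<longleftrightarrow> (\<forall>\<phi>\<in>\<Phi>. (\<Sum>i\<in>UNIV. \<phi> (x $ i)) = 0)"

definition neighbour :: "('a ^ 'n) set \<Rightarrow> ('a ^ 'n) set \<Rightarrow> bool" where
  "neighbour C D \<longleftrightarrow> vec.dim (C \<inter> D) = n - 1"

lemma q_gt_1: "CARD('a) > 1"
  by (rule card_field_gt_1)

lemma n_pos: "n > 0"
proof (rule ccontr)
  assume "\<not> n > 0"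
  hence "CARD('n) = 0" using length by simp
  thus False by simp
qed

lemma family_subspace: "C \<in> \<F> \<Longrightarrow> vec.subspace C"
  and family_dual: "C \<in> \<F> \<Longrightarrow> dual_code bar C = C"
  and family_null: "C \<in> \<F> \<Longrightarrow> x \<in> C \<Longrightarrow> type_null x"
  by (auto simp: family self_dual_codes_def type_null_def)

lemma family_form: "C \<in> \<F> \<Longrightarrow> x \<in> C \<Longrightarrow> y \<in> C \<Longrightarrow> form bar x y = 0"
  using family_dual[of C] by (auto simp: dual_code_def)

lemma family_memI: "C \<in> \<F> \<Longrightarrow> (\<And>x. x \<in> C \<Longrightarrow> form bar x y = 0) \<Longrightarrow> y \<in> C"
  using family_dual[of C] by (auto simp: dual_code_def)

lemma card_family:
  assumes "C \<in> \<F>"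
  shows "card C = CARD('a) ^ n"
proof -
  have "card C ^ 2 = (CARD('a) ^ n) ^ 2"
    using card_dual_code[OF family_subspace[OF assms]] family_dual[OF assms] length
    by (simp add: power2_eq_square mult_2 power_add)
  thus ?thesis by (simp add: power2_eq_iff_nonneg)
qed

lemma type_null_scale:
  assumes "type_null x"
  shows "type_null (r *s x)"
  unfolding type_null_def
proof
  fix \<phi> assume "\<phi> \<in> \<Phi>"
  hence "(\<lambda>y. \<phi> (r * y)) \<in> \<Phi>" using type by (simp add: is_type_def)
  thus "(\<Sum>i\<in>UNIV. \<phi> ((r *s x) $ i)) = 0"
    using assms by (auto simp: type_null_def)
qed

text \<open>Summed over the coordinates, a member of the Type becomes a map on vectors whose
  polarization is a trace of the form; nullity is therefore stable under adding orthogonal null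
  vectors.\<close>

lemma type_sum_add:
  assumes "\<And>x y. \<phi> (x + y) - \<phi> x - \<phi> y = trace_form bar r x y"
  shows "(\<Sum>i\<in>UNIV. \<phi> ((x + y) $ i))
    = (\<Sum>i\<in>UNIV. \<phi> (x $ i)) + (\<Sum>i\<in>UNIV. \<phi> (y $ i)) + trace_char (r * form bar x y)"
proof -
  have "\<phi> (a + b) = \<phi> a + \<phi> b + trace_char (r * a * bar b)" for a b
    using assms[of a b] by (simp add: trace_form_eq algebra_simps)
  thus ?thesis
    by (simp add: form_def sum.distrib sum_distrib_left trace_char_sum mult.assoc)
qed

lemma type_null_add:
  assumes "type_null x" "type_null y" "form bar x y = 0"
  shows "type_null (x + y)"
  unfolding type_null_def
proof
  fix \<phi> assume \<phi>: "\<phi> \<in> \<Phi>"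
  then obtain r where "\<And>x y. \<phi> (x + y) - \<phi> x - \<phi> y = trace_form bar r x y"
    using type unfolding is_type_def by blast
  thus "(\<Sum>i\<in>UNIV. \<phi> ((x + y) $ i)) = 0"
    using assms \<phi> by (subst type_sum_add) (auto simp: type_null_def)
qed

text \<open>The maps sending x to m_r(x,x) belong to the Type for all r, and the trace pairing is
  nondegenerate. Isotropy is what allows a null vector to be adjoined to a hyperplane of a
  code.\<close>

lemma type_null_isotropic:
  assumes "type_null x"
  shows "form bar x x = 0"
proof (rule trace_char_nondegenerate)
  fix r
  have "(\<lambda>x. trace_form bar r x x) \<in> \<Phi>" using type by (simp add: is_type_def)
  hence "(\<Sum>i\<in>UNIV. trace_form bar r (x $ i) (x $ i)) = 0"
    using assms by (auto simp: type_null_def)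
  thus "trace_char (r * form bar x x) = 0"
    by (simp add: form_def trace_form_eq trace_char_sum sum_distrib_left mult.assoc)
qed

lemma familyI:
  assumes C: "vec.subspace C" and card: "card C = CARD('a) ^ n"
    and orth: "\<And>x y. x \<in> C \<Longrightarrow> y \<in> C \<Longrightarrow> form bar x y = 0"
    and null: "\<And>x. x \<in> C \<Longrightarrow> type_null x"
  shows "C \<in> \<F>"
proof -
  have "CARD('a) ^ n * card (dual_code bar C) = CARD('a) ^ n * CARD('a) ^ n"
    using card_dual_code[OF C] card length by (simp add: mult_2 power_add)
  hence "card (dual_code bar C) = card C" using q_gt_1 card by simp
  moreover have "C \<subseteq> dual_code bar C" using orth by (auto simp: dual_code_def)
  ultimately have "C = dual_code bar C" by (intro card_subset_eq) auto
  thus ?thesis using C null by (simp add: family self_dual_codes_def type_null_def)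
qed

text \<open>The multiplicative condition avoids the truncated subtraction in \<open>n - 1\<close>;
  positivity of n makes the two agree.\<close>

lemma card_hyperplane_iff:
  fixes E :: "('a ^ 'n) set"
  assumes "vec.subspace E"
  shows "vec.dim E = n - 1 \<longleftrightarrow> CARD('a) * card E = CARD('a) ^ n"
proof -
  have "CARD('a) * card E = CARD('a) ^ Suc (vec.dim E)" by (simp add: card_subspace[OF assms])
  hence "CARD('a) * card E = CARD('a) ^ n \<longleftrightarrow> Suc (vec.dim E) = n"
    using q_gt_1 by (simp only: power_inject_exp)
  thus ?thesis using n_pos by auto
qed

lemma neighbour_iff:
  assumes "C \<in> \<F>" "D \<in> \<F>"
  shows "neighbour C D \<longleftrightarrow> CARD('a) * card (C \<inter> D) = CARD('a) ^ n"
  unfolding neighbour_def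
  by (rule card_hyperplane_iff) (intro vec.subspace_inter family_subspace assms)

lemma neighbour_commute: "neighbour C D \<longleftrightarrow> neighbour D C"
  by (simp add: neighbour_def Int_commute)

lemma exists_form_1:
  assumes "C \<in> \<F>" "f \<notin> C"
  obtains e where "e \<in> C" "form bar e f = 1"
proof -
  obtain x where x: "x \<in> C" "form bar x f \<noteq> 0"
    using family_memI[OF assms(1), of f] assms(2) by blast
  show ?thesis
  proof
    show "inverse (form bar x f) *s x \<in> C"
      by (rule vec.subspace_scale[OF family_subspace[OF assms(1)] x(1)])
    show "form bar (inverse (form bar x f) *s x) f = 1"
      using x(2) by (simp add: form_scale_left)
  qed
qed

lemma card_form_kernel:
  assumes C: "C \<in> \<F>" and f: "f \<notin> C"
  shows "CARD('a) * card {x \<in> C. form bar x f = 0} = CARD('a) ^ n"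
proof -
  let ?E = "{x \<in> C. form bar x f = 0}"
  have E: "vec.subspace ?E" by (rule subspace_form_kernel[OF family_subspace[OF C]])
  obtain e where e: "e \<in> C" "form bar e f = 1" using exists_form_1[OF C f] .
  have "vec.span (insert e ?E) = C"
  proof (intro equalityI subsetI)
    fix x assume "x \<in> vec.span (insert e ?E)"
    moreover have "vec.span (insert e ?E) \<subseteq> C"
      using e by (intro vec.span_minimal family_subspace[OF C]) auto
    ultimately show "x \<in> C" by blast
  next
    fix x assume x: "x \<in> C"
    have "x - form bar x f *s e \<in> C"
      by (intro vec.subspace_diff vec.subspace_scale family_subspace[OF C] x e)
    moreover have "form bar (x - form bar x f *s e) f = 0"
      using form_add_left[of "x - form bar x f *s e" "form bar x f *s e" f] e
      by (simp add: form_scale_left)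
    ultimately have "x - form bar x f *s e \<in> vec.span ?E" by (intro vec.span_base) simp
    thus "x \<in> vec.span (insert e ?E)" unfolding vec.span_breakdown_eq by blast
  qed
  thus ?thesis using card_span_insert[OF E, of e] e card_family[OF C] by simp
qed

text \<open>Nullity of f supplies the Type condition and, through isotropy, self-orthogonality of
  the span; its size q |E| is the one required for self-duality. A nonzero multiple of f in C would
  put f itself into C.\<close>

lemma span_insert_null_in_family:
  assumes C: "C \<in> \<F>" and E: "vec.subspace E" "E \<subseteq> C" "CARD('a) * card E = CARD('a) ^ n"
    and f: "f \<notin> C" "type_null f" "\<And>x. x \<in> E \<Longrightarrow> form bar x f = 0"
  shows "vec.span (insert f E) \<in> \<F>" "C \<inter> vec.span (insert f E) = E"
proof -
  have span: "\<exists>k. x - k *s f \<in> E" if "x \<in> vec.span (insert f E)" for x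
    using that E(1) by (auto simp: vec.span_breakdown_eq vec.span_eq_iff[THEN iffD2])
  have fE: "form bar f x = 0" if "x \<in> E" for x
    using f(3)[OF that] by (simp only: form_eq_0_commute)
  show "vec.span (insert f E) \<in> \<F>"
  proof (rule familyI)
    show "card (vec.span (insert f E)) = CARD('a) ^ n"
      using card_span_insert[OF E(1)] f(1) E(2,3) by auto
    fix x assume "x \<in> vec.span (insert f E)"
    then obtain k where k: "x - k *s f \<in> E" using span by blast
    have "type_null ((x - k *s f) + k *s f)"
      using k E(2) f family_null[OF C]
      by (intro type_null_add type_null_scale) (auto simp: form_scale_right)
    thus "type_null x" by simp
    fix y assume "y \<in> vec.span (insert f E)"
    then obtain l where l: "y - l *s f \<in> E" using span by blast
    have "form bar ((x - k *s f) + k *s f) ((y - l *s f) + l *s f) = 0"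
      unfolding form_add_left form_add_right form_scale_left form_scale_right
      using k l f(3)[OF k] fE[OF l] family_form[OF C, of "x - k *s f" "y - l *s f"] E(2)
        type_null_isotropic[OF f(2)] by auto
    thus "form bar x y = 0" by simp
  qed (rule vec.subspace_span)
  show "C \<inter> vec.span (insert f E) = E"
  proof (intro equalityI subsetI)
    fix x assume "x \<in> C \<inter> vec.span (insert f E)"
    then obtain k where x: "x \<in> C" and k: "x - k *s f \<in> E" using span by blast
    have "k *s f = x - (x - k *s f)" by simp
    hence kf: "k *s f \<in> C"
      using vec.subspace_diff[OF family_subspace[OF C] x] k E(2) by (metis subsetD)
    have "k = 0"
    proof (rule ccontr)
      assume "k \<noteq> 0"
      hence "f = inverse k *s (k *s f)" by (simp only: vec.scale_scale) simp
      hence "f \<in> C" using vec.subspace_scale[OF family_subspace[OF C] kf] by metis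
      thus False using f(1) by simp
    qed
    thus "x \<in> E" using k by simp
  qed (use E(2) in \<open>auto intro: vec.span_base\<close>)
qed

lemma family_eq_span_insert:
  assumes D: "D \<in> \<F>" and E: "vec.subspace E" "E \<subseteq> D" "CARD('a) * card E = CARD('a) ^ n"
    and f: "f \<in> D" "f \<notin> E"
  shows "D = vec.span (insert f E)"
proof -
  have "vec.span (insert f E) \<subseteq> D"
    using E(2) f(1) by (intro vec.span_minimal family_subspace[OF D]) auto
  moreover have "card (vec.span (insert f E)) = card D"
    using card_span_insert[OF E(1) f(2)] E(3) card_family[OF D] by simp
  ultimately show ?thesis by (intro card_subset_eq[symmetric]) auto
qed

text \<open>This is Kneser's neighbour construction, known from lattices.\<close>

definition neighbour_through :: "('a ^ 'n) set \<Rightarrow> 'a ^ 'n \<Rightarrow> ('a ^ 'n) set" where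
  "neighbour_through C f = vec.span (insert f {x \<in> C. form bar x f = 0})"

lemma neighbour_through:
  assumes C: "C \<in> \<F>" and f: "f \<notin> C" "type_null f"
  shows "neighbour_through C f \<in> \<F>" "neighbour C (neighbour_through C f)"
proof -
  let ?E = "{x \<in> C. form bar x f = 0}"
  have E: "vec.subspace ?E" by (rule subspace_form_kernel[OF family_subspace[OF C]])
  note * = span_insert_null_in_family[OF C E _ card_form_kernel[OF C f(1)] f]
  show 1: "neighbour_through C f \<in> \<F>"
    unfolding neighbour_through_def by (rule *(1)) auto
  have "C \<inter> neighbour_through C f = ?E"
    unfolding neighbour_through_def by (rule *(2)) auto
  thus "neighbour C (neighbour_through C f)"
    using card_form_kernel[OF C f(1)] neighbour_iff[OF C 1] by simp
qed

text \<open>D is self-orthogonal and contains f, so C \<inter> D lies in the kernel of f on C. Both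
  have index q in C, hence they coincide and D is spanned by f and this kernel. Thus a single vector
  outside C determines the neighbour containing it.\<close>

lemma neighbour_through_unique:
  assumes C: "C \<in> \<F>" and D: "D \<in> \<F>" "neighbour C D" and f: "f \<in> D" "f \<notin> C"
  shows "D = neighbour_through C f"
proof -
  let ?E = "{x \<in> C. form bar x f = 0}"
  have E: "vec.subspace ?E" by (rule subspace_form_kernel[OF family_subspace[OF C]])
  have "CARD('a) * card (C \<inter> D) = CARD('a) * card ?E"
    using card_form_kernel[OF C f(2)] neighbour_iff[OF C D(1)] D(2) by simp
  moreover have "C \<inter> D \<subseteq> ?E" using family_form[OF D(1)] f(1) by auto
  ultimately have "C \<inter> D = ?E" using q_gt_1 by (intro card_subset_eq) auto
  hence "?E \<subseteq> D" by blast
  thus ?thesis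
    unfolding neighbour_through_def
    by (intro family_eq_span_insert D E card_form_kernel[OF C f(2)] f(1)) (use f(2) in auto)
qed

section \<open>Counting neighbours with a given intersection\<close>

definition polarizes :: "('a \<Rightarrow> qmodz) \<Rightarrow> 'a \<Rightarrow> bool" where
  "polarizes \<phi> r \<longleftrightarrow> (\<forall>x y. \<phi> (x + y) - \<phi> x - \<phi> y = trace_form bar r x y)"

definition polar_coeffs :: "'a set" where
  "polar_coeffs = {r. \<exists>\<phi>\<in>\<Phi>. polarizes \<phi> r}"

text \<open>The order of the annihilator of \<open>polar_coeffs\<close> under the trace pairing.
  Replacing f by f + \<open>bar t\<close> e moves the sum of each \<open>\<phi>\<close> by
  \<open>trace_char (r * t)\<close>, so the admissible t form either the empty set or a coset of
  this annihilator.\<close>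

definition neighbour_bound :: nat where
  "neighbour_bound = card {t. \<forall>r\<in>polar_coeffs. trace_char (r * t) = 0}"

text \<open>The additive members of \<open>\<Phi>\<close> obstruct the extension of a hyperplane \<open>E\<close> of a code by
  further null lines of \<open>E\<^sup>\<bottom>\<close>.\<close>

definition additive_null :: "'a ^ 'n \<Rightarrow> bool" where
  "additive_null f \<longleftrightarrow> (\<forall>\<phi>\<in>\<Phi>. polarizes \<phi> 0 \<longrightarrow> (\<Sum>i\<in>UNIV. \<phi> (f $ i)) = 0)"

lemma exists_polar: "\<phi> \<in> \<Phi> \<Longrightarrow> \<exists>r. polarizes \<phi> r"
  using type by (simp add: is_type_def polarizes_def)

lemma polarizes_add:
  assumes "polarizes \<phi> r" "polarizes \<psi> s"
  shows "polarizes (\<lambda>x. \<phi> x + \<psi> x) (r + s)"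
  unfolding polarizes_def
proof (intro allI)
  fix x y
  have "\<phi> (x + y) + \<psi> (x + y) - (\<phi> x + \<psi> x) - (\<phi> y + \<psi> y)
      = (\<phi> (x + y) - \<phi> x - \<phi> y) + (\<psi> (x + y) - \<psi> x - \<psi> y)"
    by (simp add: algebra_simps)
  also have "\<dots> = trace_form bar (r + s) x y"
    using assms by (simp add: polarizes_def trace_form_eq distrib_right trace_char_add)
  finally show "\<phi> (x + y) + \<psi> (x + y) - (\<phi> x + \<psi> x) - (\<phi> y + \<psi> y) = trace_form bar (r + s) x y" .
qed

lemma trace_char_minus: "trace_char (- x :: 'a) = - trace_char x"
  using trace_char_add[of x "- x"] by (simp add: eq_neg_iff_add_eq_0 add.commute)

lemma polarizes_uminus:
  assumes "polarizes \<phi> r"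
  shows "polarizes (\<lambda>x. - \<phi> x) (- r)"
  unfolding polarizes_def
proof (intro allI)
  fix x y
  have "- \<phi> (x + y) - - \<phi> x - - \<phi> y = - (\<phi> (x + y) - \<phi> x - \<phi> y)"
    by simp
  also have "\<dots> = trace_form bar (- r) x y"
    using assms by (simp add: polarizes_def trace_form_eq trace_char_minus)
  finally show "- \<phi> (x + y) - - \<phi> x - - \<phi> y = trace_form bar (- r) x y" .
qed

lemma type_add: "\<phi> \<in> \<Phi> \<Longrightarrow> \<psi> \<in> \<Phi> \<Longrightarrow> (\<lambda>x. \<phi> x + \<psi> x) \<in> \<Phi>"
  and type_uminus: "\<phi> \<in> \<Phi> \<Longrightarrow> (\<lambda>x. - \<phi> x) \<in> \<Phi>"
  and type_zero: "(\<lambda>x. 0) \<in> \<Phi>"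
  and type_at_0: "\<phi> \<in> \<Phi> \<Longrightarrow> \<phi> 0 = 0"
  using type by (simp_all add: is_type_def)

text \<open>Since e is null and pairs with f to 1, the shift adds only the polar term
  \<open>trace_char (r * t)\<close>; the conjugate on t cancels the one applied by the form.\<close>

lemma type_null_shift_iff:
  assumes C: "C \<in> \<F>" and e: "e \<in> C" "form bar e f = 1"
  shows "type_null (f + bar t *s e) \<longleftrightarrow>
    (\<forall>\<phi>\<in>\<Phi>. \<forall>r. polarizes \<phi> r \<longrightarrow> (\<Sum>i\<in>UNIV. \<phi> (f $ i)) + trace_char (r * t) = 0)"
proof -
  have "form bar f (bar t *s e) = t"
    using e(2) form_commute[of f e] by (simp add: form_scale_right)
  moreover have "type_null (bar t *s e)"
    by (intro type_null_scale family_null[OF C] e)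
  ultimately have *: "(\<Sum>i\<in>UNIV. \<phi> ((f + bar t *s e) $ i)) = (\<Sum>i\<in>UNIV. \<phi> (f $ i)) + trace_char (r * t)"
    if "\<phi> \<in> \<Phi>" "polarizes \<phi> r" for \<phi> r
    using type_sum_add[of \<phi> r f "bar t *s e"] that by (simp add: polarizes_def type_null_def)
  show ?thesis
    unfolding type_null_def using * exists_polar by metis
qed

text \<open>In the plane (dual of E)/E, spanned by e and f, the code C is the line of e. Every other
  line contains exactly one vector f + s e, and it yields a code of the family precisely when this
  vector is null.\<close>

lemma neighbour_count_eq:
  assumes C: "C \<in> \<F>" and E: "vec.subspace E" "E \<subseteq> C" "CARD('a) * card E = CARD('a) ^ n"
    and f: "f \<notin> C" "\<And>x. x \<in> E \<Longrightarrow> form bar x f = 0"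
    and e: "e \<in> C" "form bar e f = 1"
  shows "neighbour_count \<F> E C = card {t. type_null (f + bar t *s e)}"
proof -
  have eE: "e \<notin> E" using f(2)[of e] e(2) by auto
  have fe: "f + s *s e \<notin> C" for s
  proof
    assume "f + s *s e \<in> C"
    hence "(f + s *s e) - s *s e \<in> C"
      by (intro vec.subspace_diff vec.subspace_scale family_subspace[OF C] e(1))
    thus False using f(1) by simp
  qed
  have orth: "form bar x (f + s *s e) = 0" if "x \<in> E" for s x
    using f(2)[OF that] family_form[OF C, of x e] that E(2) e(1)
    by (auto simp: form_add_right form_scale_right)
  let ?D = "\<lambda>t. vec.span (insert (f + bar t *s e) E)"
  have "bij_betw ?D {t. type_null (f + bar t *s e)} {D \<in> \<F>. D \<inter> C = E}"
    unfolding bij_betw_def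
  proof
    show "inj_on ?D {t. type_null (f + bar t *s e)}"
    proof (rule inj_onI)
      fix t u assume tu: "t \<in> {t. type_null (f + bar t *s e)}" "u \<in> {t. type_null (f + bar t *s e)}"
        and eq: "?D t = ?D u"
      have "f + bar t *s e \<in> ?D t" "f + bar u *s e \<in> ?D t"
        by (simp add: vec.span_base, simp add: eq vec.span_base)
      hence "(f + bar t *s e) - (f + bar u *s e) \<in> ?D t" by (rule vec.span_diff)
      hence *: "(bar t - bar u) *s e \<in> ?D t" by (simp add: vec.scale_left_diff_distrib)
      moreover have "(bar t - bar u) *s e \<in> C"
        by (intro vec.subspace_scale family_subspace[OF C] e(1))
      ultimately have **: "(bar t - bar u) *s e \<in> E"
        using span_insert_null_in_family(2)[OF C E fe _ orth] tu(1) by blast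
      have "(bar t - bar u) * 1 = 0"
        using f(2)[OF **] by (simp only: form_scale_left e(2))
      hence "bar t = bar u" by simp
      hence "bar (bar t) = bar (bar u)" by (rule arg_cong)
      thus "t = u" by (simp only: bar_bar)
    qed
    show "?D ` {t. type_null (f + bar t *s e)} = {D \<in> \<F>. D \<inter> C = E}"
    proof (intro equalityI subsetI)
      fix D assume "D \<in> ?D ` {t. type_null (f + bar t *s e)}"
      thus "D \<in> {D \<in> \<F>. D \<inter> C = E}"
        using span_insert_null_in_family[OF C E fe _ orth] by auto
    next
      fix D assume "D \<in> {D \<in> \<F>. D \<inter> C = E}"
      hence D: "D \<in> \<F>" "D \<inter> C = E" by auto
      have "E \<noteq> D"
      proof
        assume "E = D"
        hence "CARD('a) * CARD('a) ^ n = 1 * CARD('a) ^ n" using card_family[OF D(1)] E(3) by simp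
        thus False using q_gt_1 by simp
      qed
      then obtain y where y: "y \<in> D" "y \<notin> C" using D(2) by blast
      have orthy: "form bar x y = 0" if "x \<in> E" for x
        using that D y(1) by (intro family_form[OF D(1)]) auto
      have CE: "\<exists>k. x - k *s e \<in> E" if "x \<in> C" for x
        using family_eq_span_insert[OF C E e(1) eE] that E(1)
        by (auto simp: vec.span_breakdown_eq vec.span_eq_iff[THEN iffD2])
      have ey: "form bar e y \<noteq> 0"
      proof
        assume 0: "form bar e y = 0"
        have "form bar x y = 0" if x: "x \<in> C" for x
        proof -
          obtain k where k: "x - k *s e \<in> E" using CE[OF x] by blast
          have "form bar ((x - k *s e) + k *s e) y = 0"
            unfolding form_add_left form_scale_left using orthy[OF k] 0 by simp
          thus ?thesis by simp
        qed
        thus False using family_memI[OF C] y(2) by blast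
      qed
      \<comment> \<open>Normalised so that z and f pair equally with e and with E, hence with all of
        C. Then z - f lies in the dual of C, which is C, and modulo E it is a multiple of e.\<close>
      define z where "z = bar (inverse (form bar e y)) *s y"
      have z: "z \<in> D" "form bar e z = 1" "\<And>x. x \<in> E \<Longrightarrow> form bar x z = 0"
        using ey y(1) orthy vec.subspace_scale[OF family_subspace[OF D(1)]]
        by (simp_all add: z_def form_scale_right)
      have "z - f \<in> C"
      proof (rule family_memI[OF C])
        fix x assume "x \<in> C"
        then obtain k where k: "x - k *s e \<in> E" using CE by blast
        have "form bar ((x - k *s e) + k *s e) (z - f) = 0"
          unfolding form_add_left form_scale_left form_diff_right using z f(2) e k by simp
        thus "form bar x (z - f) = 0" by simp
      qed
      then obtain s where s: "(z - f) - s *s e \<in> E" using CE by blast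
      have "z - ((z - f) - s *s e) \<in> D"
        using s D(2) by (intro vec.subspace_diff[OF family_subspace[OF D(1)] z(1)]) auto
      hence fD: "f + s *s e \<in> D" by (simp add: algebra_simps)
      have "D = ?D (bar s)"
        using D(2) fe fD by (intro family_eq_span_insert D(1) E(1,3)) (auto simp: E(2)[THEN subsetD])
      moreover have "type_null (f + bar (bar s) *s e)"
        using family_null[OF D(1) fD] by simp
      ultimately show "D \<in> ?D ` {t. type_null (f + bar t *s e)}" by blast
    qed
  qed
  thus ?thesis by (simp add: neighbour_count_def bij_betw_same_card)
qed

text \<open>Subtracting the conditions at one solution t leaves homogeneous additive conditions on u
  - t, and these no longer involve C, e or f.\<close>

lemma card_null_shifts:
  assumes C: "C \<in> \<F>" and e: "e \<in> C" "form bar e f = 1" and t: "type_null (f + bar t *s e)"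
  shows "card {t. type_null (f + bar t *s e)} = neighbour_bound"
proof -
  let ?K = "{t. \<forall>r\<in>polar_coeffs. trace_char (r * t) = 0}"
  note iff = type_null_shift_iff[OF C e]
  have "type_null (f + bar u *s e) \<longleftrightarrow> u - t \<in> ?K" for u
  proof -
    have "trace_char (r * u) = trace_char (r * (u - t)) + trace_char (r * t)" for r
      by (simp add: algebra_simps flip: trace_char_add)
    hence "(S + trace_char (r * u) = 0) = (trace_char (r * (u - t)) = 0)"
      if "S + trace_char (r * t) = 0" for S r
      using that by (metis add.left_commute add.right_neutral add_cancel_left_right)
    thus ?thesis
      using t unfolding iff polar_coeffs_def by blast
  qed
  hence "{u. type_null (f + bar u *s e)} = (\<lambda>s. s + t) ` ?K"
    by (auto simp: image_iff intro!: exI[where x = "_ - t"])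
  thus ?thesis by (simp add: card_image neighbour_bound_def)
qed

text \<open>The required value of \<open>trace_char (r * t)\<close> is minus the sum of any
  \<open>\<phi>\<close> polarized by r. Two choices of \<open>\<phi>\<close> differ by an additive
  member of the Type, whose sum over f vanishes by \<open>additive_null\<close>, so this value
  depends on r alone. It is additive in r, and \<open>character_extends\<close> provides t.\<close>

lemma exists_null_shift:
  assumes C: "C \<in> \<F>" and e: "e \<in> C" "form bar e f = 1" and f: "additive_null f"
  shows "\<exists>t. type_null (f + bar t *s e)"
proof -
  define g where "g r = - (\<Sum>i\<in>UNIV. (SOME \<phi>. \<phi> \<in> \<Phi> \<and> polarizes \<phi> r) (f $ i))" for r
  have g: "g r = - (\<Sum>i\<in>UNIV. \<phi> (f $ i))" if \<phi>: "\<phi> \<in> \<Phi>" "polarizes \<phi> r" for \<phi> r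
  proof -
    define \<psi> where "\<psi> = (SOME \<phi>. \<phi> \<in> \<Phi> \<and> polarizes \<phi> r)"
    have \<psi>: "\<psi> \<in> \<Phi>" "polarizes \<psi> r"
      unfolding \<psi>_def by (metis (mono_tags, lifting) someI \<phi>)+
    have "(\<lambda>x. \<psi> x + - \<phi> x) \<in> \<Phi>" "polarizes (\<lambda>x. \<psi> x + - \<phi> x) 0"
      using type_add[OF \<psi>(1) type_uminus[OF \<phi>(1)]] polarizes_add[OF \<psi>(2) polarizes_uminus[OF \<phi>(2)]]
      by simp_all
    hence "(\<Sum>i\<in>UNIV. \<psi> (f $ i) + - \<phi> (f $ i)) = 0"
      using f unfolding additive_null_def by blast
    thus ?thesis by (simp add: g_def sum_subtractf flip: \<psi>_def)
  qed
  have ex: "\<exists>t. \<forall>r\<in>polar_coeffs. g r = trace_char (r * t)"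
  proof (rule character_extends)
    have "polarizes (\<lambda>x. 0) 0" by (simp add: polarizes_def trace_form_eq)
    thus "0 \<in> polar_coeffs" using type_zero by (auto simp: polar_coeffs_def)
    fix r s assume "r \<in> polar_coeffs" "s \<in> polar_coeffs"
    then obtain \<phi> \<psi> where *: "\<phi> \<in> \<Phi>" "polarizes \<phi> r" "\<psi> \<in> \<Phi>" "polarizes \<psi> s"
      by (auto simp: polar_coeffs_def)
    note ** = type_add[OF *(1,3)] polarizes_add[OF *(2,4)]
    show "r + s \<in> polar_coeffs" using ** by (auto simp: polar_coeffs_def)
    show "g (r + s) = g r + g s"
      by (simp add: g[OF **] g[OF *(1,2)] g[OF *(3,4)] sum.distrib)
  qed
  then obtain t where "\<forall>r\<in>polar_coeffs. g r = trace_char (r * t)" by blast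
  hence "trace_char (r * t) = - (\<Sum>i\<in>UNIV. \<phi> (f $ i))" if "\<phi> \<in> \<Phi>" "polarizes \<phi> r" for \<phi> r
    using that g[OF that] by (auto simp: polar_coeffs_def)
  thus ?thesis unfolding type_null_shift_iff[OF C e] by (intro exI[of _ t]) auto
qed

lemma polarizes_0_additive:
  assumes "polarizes \<phi> 0"
  shows "\<phi> (x + y) = \<phi> x + \<phi> y"
  using assms by (simp add: polarizes_def trace_form_eq algebra_simps)

text \<open>Witness: \<open>w = 0\<close> if \<open>0\<close> is the only additive member of \<open>\<Phi>\<close>, and the all-ones
  vector otherwise.\<close>

lemma exists_additive_witness:
  obtains w where "\<And>C. C \<in> \<F> \<Longrightarrow> w \<in> C" "\<And>f. form bar w f = 0 \<Longrightarrow> additive_null f"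
proof (cases "\<exists>\<phi>\<in>\<Phi>. polarizes \<phi> 0 \<and> \<phi> \<noteq> (\<lambda>x. 0)")
  case False
  show ?thesis
  proof (rule that)
    show "0 \<in> C" if "C \<in> \<F>" for C using family_subspace[OF that] by (rule vec.subspace_0)
    show "additive_null f" for f
      using False by (auto simp: additive_null_def)
  qed
next
  case True
  then obtain \<phi> where \<phi>: "\<phi> \<in> \<Phi>" "polarizes \<phi> 0" "\<phi> \<noteq> (\<lambda>x. 0)" by blast
  define w :: "'a ^ 'n" where "w = (\<chi> i. 1)"
  have sum: "(\<Sum>i\<in>S. \<psi> (x $ i)) = \<psi> (\<Sum>i\<in>S. x $ i)"
    if "\<psi> \<in> \<Phi>" "polarizes \<psi> 0" for \<psi> x S
    by (induction S rule: infinite_finite_induct)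
      (simp_all add: type_at_0[OF that(1)] polarizes_0_additive[OF that(2)])
  show ?thesis
  proof (rule that)
    fix C assume C: "C \<in> \<F>"
    show "w \<in> C"
    proof (rule family_memI[OF C])
      fix x assume x: "x \<in> C"
      \<comment> \<open>If the coordinate sum of x were nonzero, its multiples would exhaust the
        field and \<open>\<phi>\<close> would vanish identically.\<close>
      have "\<phi> (r * (\<Sum>i\<in>UNIV. x $ i)) = 0" for r
      proof -
        have "type_null (r *s x)" by (intro type_null_scale family_null[OF C x])
        hence "(\<Sum>i\<in>UNIV. \<phi> ((r *s x) $ i)) = 0" using \<phi>(1) by (simp only: type_null_def)
        thus ?thesis by (simp only: sum[OF \<phi>(1,2)]) (simp add: sum_distrib_left)
      qed
      moreover obtain y where y: "\<phi> y \<noteq> 0" using \<phi>(3) by auto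
      ultimately have "(\<Sum>i\<in>UNIV. x $ i) = 0"
        by (metis nonzero_eq_divide_eq)
      thus "form bar x w = 0" by (simp add: form_def w_def)
    qed
  next
    fix f assume "form bar w f = 0"
    hence "bar (\<Sum>i\<in>UNIV. f $ i) = 0" by (simp add: form_def w_def bar_sum)
    hence "(\<Sum>i\<in>UNIV. f $ i) = 0" by (simp only: bar_eq_0_iff)
    thus "additive_null f"
      unfolding additive_null_def using sum type_at_0 by metis
  qed
qed

section \<open>Counting hyperplanes\<close>

definition hyperplanes :: "('a ^ 'n) set \<Rightarrow> ('a ^ 'n) set \<Rightarrow> ('a ^ 'n) set set" where
  "hyperplanes C S = {E. vec.subspace E \<and> E \<subseteq> C \<and> vec.dim E = n - 1 \<and> S \<subseteq> E}"

lemma hyperplanes_iff: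
  "E \<in> hyperplanes C S \<longleftrightarrow>
    vec.subspace E \<and> E \<subseteq> C \<and> CARD('a) * card E = CARD('a) ^ n \<and> S \<subseteq> E"
  using card_hyperplane_iff[of E] unfolding hyperplanes_def mem_Collect_eq by metis

lemma hyperplanes_through_eq: "hyperplanes_through n C cs = hyperplanes C (vec.span (set cs))"
proof -
  have "set cs \<subseteq> E \<longleftrightarrow> vec.span (set cs) \<subseteq> E" if "vec.subspace E" for E
    using that by (metis order_trans vec.span_minimal vec.span_superset)
  thus ?thesis by (auto simp: hyperplanes_through_def hyperplanes_def)
qed

lemma card_dual_code_hyperplane:
  fixes E :: "('a ^ 'n) set"
  assumes "vec.subspace E" "CARD('a) * card E = CARD('a) ^ n"
  shows "card (dual_code bar E) = CARD('a) ^ (n + 1)"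
proof -
  have "CARD('a) ^ n * card (dual_code bar E) = CARD('a) * (card E * card (dual_code bar E))"
    by (simp flip: assms(2) add: mult.assoc)
  also have "\<dots> = CARD('a) ^ n * CARD('a) ^ (n + 1)"
    by (simp add: card_dual_code[OF assms(1)] length mult_2 power_add)
  finally show ?thesis using q_gt_1 by simp
qed

text \<open>The dual of E has q^(n+1) elements, too many to fit into C.\<close>

lemma hyperplane_complement_vector:
  assumes C: "C \<in> \<F>" and E: "vec.subspace E" "CARD('a) * card E = CARD('a) ^ n"
  obtains f e where "f \<notin> C" "\<And>x. x \<in> E \<Longrightarrow> form bar x f = 0" "e \<in> C" "form bar e f = 1"
proof -
  have "\<not> dual_code bar E \<subseteq> C"
  proof
    assume "dual_code bar E \<subseteq> C"
    hence "card (dual_code bar E) \<le> card C" by (intro card_mono) auto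
    thus False using card_dual_code_hyperplane[OF E] card_family[OF C] q_gt_1 by simp
  qed
  then obtain f where f: "f \<in> dual_code bar E" "f \<notin> C" by blast
  obtain e where "e \<in> C" "form bar e f = 1" using exists_form_1[OF C f(2)] .
  thus ?thesis using that f by (auto simp: dual_code_def)
qed

lemma neighbour_count_le:
  assumes C: "C \<in> \<F>" and E: "E \<in> hyperplanes C S"
  shows "neighbour_count \<F> E C \<le> neighbour_bound"
proof -
  have E': "vec.subspace E" "E \<subseteq> C" "CARD('a) * card E = CARD('a) ^ n"
    using E by (simp_all add: hyperplanes_iff)
  obtain f e where f: "f \<notin> C" "\<And>x. x \<in> E \<Longrightarrow> form bar x f = 0" and e: "e \<in> C" "form bar e f = 1"
    by (rule hyperplane_complement_vector[OF C E'(1,3)]) blast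
  show ?thesis
  proof (cases "\<exists>t. type_null (f + bar t *s e)")
    case True
    thus ?thesis using neighbour_count_eq[OF C E' f e] card_null_shifts[OF C e] by auto
  next
    case False
    thus ?thesis using neighbour_count_eq[OF C E' f e] by simp
  qed
qed

text \<open>With w in E, every f orthogonal to E is orthogonal to w. The conditions free of t then
  hold, so a null shift exists and the count is that of a full coset.\<close>

lemma neighbour_count_eq_bound:
  assumes C: "C \<in> \<F>" and E: "E \<in> hyperplanes C S" and w: "w \<in> E"
    "\<And>f. form bar w f = 0 \<Longrightarrow> additive_null f"
  shows "neighbour_count \<F> E C = neighbour_bound"
proof -
  have E': "vec.subspace E" "E \<subseteq> C" "CARD('a) * card E = CARD('a) ^ n"
    using E by (simp_all add: hyperplanes_iff)
  obtain f e where f: "f \<notin> C" "\<And>x. x \<in> E \<Longrightarrow> form bar x f = 0" and e: "e \<in> C" "form bar e f = 1"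
    by (rule hyperplane_complement_vector[OF C E'(1,3)]) blast
  have "additive_null f" using w f(2) by blast
  thus ?thesis
    using neighbour_count_eq[OF C E' f e] exists_null_shift[OF C e] card_null_shifts[OF C e] by auto
qed

text \<open>Sending f to its kernel on C maps the vectors of the dual of S outside C onto the
  hyperplanes of C through S. The fibre over E is the dual of E without C, whose size does not
  depend on E.\<close>

lemma card_hyperplanes:
  assumes C: "C \<in> \<F>" and S: "S \<subseteq> C"
  shows "card (dual_code bar S) = CARD('a) ^ n + card (hyperplanes C S) * (CARD('a) ^ (n + 1) - CARD('a) ^ n)"
proof -
  let ?K = "\<lambda>f. {x \<in> C. form bar x f = 0}"
  have sub: "C \<subseteq> dual_code bar S"
    using family_form[OF C] S by (auto simp: dual_code_def)
  have K: "?K f \<in> hyperplanes C S" if f: "f \<in> dual_code bar S - C" for f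
  proof -
    have "CARD('a) * card (?K f) = CARD('a) ^ n" using f by (intro card_form_kernel[OF C]) blast
    moreover have "S \<subseteq> ?K f" using f S by (auto simp: dual_code_def)
    ultimately show ?thesis
      using subspace_form_kernel[OF family_subspace[OF C]] unfolding hyperplanes_iff by blast
  qed
  have fib: "{f \<in> dual_code bar S - C. ?K f = E} = dual_code bar E - C"
    and card_fib: "card (dual_code bar E - C) = CARD('a) ^ (n + 1) - CARD('a) ^ n"
    if E: "E \<in> hyperplanes C S" for E
  proof -
    have E': "vec.subspace E" "E \<subseteq> C" "CARD('a) * card E = CARD('a) ^ n" "S \<subseteq> E"
      using E by (simp_all add: hyperplanes_iff)
    have "?K f = E" if f: "f \<in> dual_code bar E - C" for f
    proof -
      have "E \<subseteq> ?K f" using f E'(2) by (auto simp: dual_code_def)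
      moreover have "CARD('a) * card (?K f) = CARD('a) * card E"
        using card_form_kernel[OF C, of f] f E'(3) by simp
      ultimately show ?thesis using q_gt_1 by (intro card_subset_eq[symmetric]) auto
    qed
    moreover have "f \<in> dual_code bar E" if "?K f = E" for f
      using that by (auto simp: dual_code_def)
    moreover have "dual_code bar E \<subseteq> dual_code bar S"
      using E'(4) by (auto simp: dual_code_def)
    ultimately show "{f \<in> dual_code bar S - C. ?K f = E} = dual_code bar E - C"
      by blast
    have "C \<subseteq> dual_code bar E"
      using family_form[OF C] E'(2) by (auto simp: dual_code_def)
    thus "card (dual_code bar E - C) = CARD('a) ^ (n + 1) - CARD('a) ^ n"
      by (simp only: card_Diff_subset[OF finite] card_dual_code_hyperplane[OF E'(1,3)] card_family[OF C])
  qed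
  have "card (dual_code bar S - C) = (\<Sum>E\<in>hyperplanes C S. card {f \<in> dual_code bar S - C. ?K f = E})"
    unfolding card_eq_sum
    by (rule sum.group[symmetric, OF finite finite]) (rule image_subsetI, rule K)
  also have "\<dots> = (\<Sum>E\<in>hyperplanes C S. CARD('a) ^ (n + 1) - CARD('a) ^ n)"
    by (rule sum.cong[OF refl]) (simp only: fib card_fib)
  also have "\<dots> = card (hyperplanes C S) * (CARD('a) ^ (n + 1) - CARD('a) ^ n)"
    by (simp only: sum_constant of_nat_id)
  finally have "card (dual_code bar S - C) = card (hyperplanes C S) * (CARD('a) ^ (n + 1) - CARD('a) ^ n)" .
  moreover have "card (dual_code bar S) = card C + card (dual_code bar S - C)"
    using card_Diff_subset[OF finite sub] card_mono[OF finite sub] by simp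
  ultimately show ?thesis by (simp only: card_family[OF C])
qed

text \<open>The product of the sizes of a subspace and its dual is constant, so the larger subspace
  has the smaller dual and, by \<open>card_hyperplanes\<close>, fewer hyperplanes through it, even
  across different codes.\<close>

lemma card_hyperplanes_mono:
  assumes C: "C \<in> \<F>" "vec.subspace S" "S \<subseteq> C" and D: "D \<in> \<F>" "vec.subspace U" "U \<subseteq> D"
    and le: "card S \<le> card U"
  shows "card (hyperplanes D U) \<le> card (hyperplanes C S)"
proof -
  have pos: "CARD('a) ^ (n + 1) - CARD('a) ^ n > 0"
    using q_gt_1 by simp
  have "card S * card (dual_code bar U) \<le> card U * card (dual_code bar U)"
    using le by simp
  also have "\<dots> = card S * card (dual_code bar S)"
    by (simp add: card_dual_code C D)
  finally have "card (dual_code bar U) \<le> card (dual_code bar S)"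
    using vec.subspace_0[OF C(2)] by (auto simp: card_eq_0_iff)
  thus ?thesis
    using pos by (simp add: card_hyperplanes[OF C(1,3)] card_hyperplanes[OF D(1,3)] del: power_Suc)
qed

text \<open>Through ds every hyperplane counts at most \<open>neighbour_bound\<close>, whereas
  through cs only those containing w are sure to attain it. The factor q in the hypothesis leaves
  room for adjoining w to the span of cs.\<close>

lemma sum_neighbour_count_mono:
  assumes C: "C \<in> \<F>" "set cs \<subseteq> C" and D: "D \<in> \<F>" "set ds \<subseteq> D"
    and le: "CARD('a) * card (vec.span (set cs)) \<le> card (vec.span (set ds))"
  shows "(\<Sum>E\<in>hyperplanes_through n D ds. neighbour_count \<F> E D)
    \<le> (\<Sum>E\<in>hyperplanes_through n C cs. neighbour_count \<F> E C)"
proof -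
  obtain w where w: "\<And>C. C \<in> \<F> \<Longrightarrow> w \<in> C" "\<And>f. form bar w f = 0 \<Longrightarrow> additive_null f"
    by (rule exists_additive_witness) blast
  let ?S = "vec.span (insert w (vec.span (set cs)))" and ?U = "vec.span (set ds)"
  have sub: "vec.span (set cs) \<subseteq> C" "?U \<subseteq> D"
    using C D by (simp_all add: vec.span_minimal family_subspace)
  hence sub': "?S \<subseteq> C"
    using C(1) w(1) by (simp add: vec.span_minimal family_subspace)
  have "card ?S \<le> CARD('a) * card (vec.span (set cs))"
  proof (cases "w \<in> vec.span (set cs)")
    case True
    hence "?S = vec.span (set cs)" by (simp add: insert_absorb)
    thus ?thesis using q_gt_1 by simp
  qed (simp add: card_span_insert)
  hence "card ?S \<le> card ?U" using le by linarith
  hence hyp: "card (hyperplanes D ?U) \<le> card (hyperplanes C ?S)"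
    by (intro card_hyperplanes_mono C D sub sub' vec.subspace_span)
  have "(\<Sum>E\<in>hyperplanes D ?U. neighbour_count \<F> E D) \<le> card (hyperplanes D ?U) * neighbour_bound"
    using neighbour_count_le[OF D(1)] by (intro sum_bounded_above[THEN order_trans]) auto
  also have "\<dots> \<le> card (hyperplanes C ?S) * neighbour_bound"
    using hyp by (intro mult_right_mono) auto
  also have "\<dots> = (\<Sum>E\<in>hyperplanes C ?S. neighbour_count \<F> E C)"
  proof -
    have "w \<in> E" if "E \<in> hyperplanes C ?S" for E
      using that vec.span_base[of w "insert w (vec.span (set cs))"] by (auto simp: hyperplanes_def)
    hence "neighbour_count \<F> E C = neighbour_bound" if "E \<in> hyperplanes C ?S" for E
      using neighbour_count_eq_bound[OF C(1)] w(2) that by blast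
    thus ?thesis by simp
  qed
  also have "\<dots> \<le> (\<Sum>E\<in>hyperplanes C (vec.span (set cs)). neighbour_count \<F> E C)"
  proof (rule sum_mono2)
    have "vec.span (set cs) \<subseteq> ?S" by (meson subset_insertI vec.span_superset order_trans)
    thus "hyperplanes C ?S \<subseteq> hyperplanes C (vec.span (set cs))" by (auto simp: hyperplanes_def)
  qed simp_all
  finally show ?thesis by (simp only: hyperplanes_through_eq)
qed

end

section \<open>Tuples with a given monomial\<close>

text \<open>Equal monomials mean equal multisets of columns. Coordinate permutations therefore act
  transitively on the tuples with a given monomial and length.\<close>

lemma mon_eq_imp_perm:
  fixes cs ds :: "('a::zero ^ 'n::finite) list"
  assumes "mon cs = mon ds" "length cs = length ds"
  obtains \<pi> where "\<pi> permutes UNIV" "ds = map (perm_vec \<pi>) cs"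
proof -
  have "card {i. column cs i = v} = card {i. column ds i = v}" for v
    using assms(1) by (metis lookup_mon)
  hence "image_mset (column cs) (mset_set UNIV) = image_mset (column ds) (mset_set UNIV)"
    by (intro multiset_eqI) (simp add: count_image_mset' sum.If_cases Int_def eq_commute)
  then obtain \<pi> where \<pi>: "\<pi> permutes UNIV" "\<And>i. column cs i = column ds (\<pi> i)"
    using image_mset_eq_implies_permutes[of UNIV "column cs" "column ds"] by auto
  have "ds ! j = perm_vec \<pi> (cs ! j)" if "j < length cs" for j
  proof (subst vec_eq_iff, rule allI)
    fix k
    have "column ds k j = column cs (inv \<pi> k) j"
      using \<pi> by (simp add: permutes_inverses)
    thus "ds ! j $ k = perm_vec \<pi> (cs ! j) $ k"
      using that assms(2) by (simp add: column_def perm_vec_def)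
  qed
  hence "ds = map (perm_vec \<pi>) cs"
    using assms(2) by (intro nth_equalityI) auto
  thus ?thesis using that \<pi>(1) by blast
qed

definition tuples_of_mon :: "nat \<Rightarrow> ((nat \<Rightarrow> 'a::zero) \<Rightarrow>\<^sub>0 nat) \<Rightarrow> ('a ^ 'n) list set" where
  "tuples_of_mon m X = {cs. length cs = m \<and> mon cs = X}"

definition occurrences :: "nat \<Rightarrow> ((nat \<Rightarrow> 'a::zero) \<Rightarrow>\<^sub>0 nat) \<Rightarrow> ('a ^ 'n) set \<Rightarrow> nat" where
  "occurrences m X C = card {cs \<in> tuples m C. mon cs = X}"

lemma finite_tuples_of_mon:
  "finite (tuples_of_mon m X :: ('a::{zero,finite} ^ 'n::finite) list set)"
  by (rule finite_subset[OF _ finite_lists_length_eq[of UNIV m]]) (auto simp: tuples_of_mon_def)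

lemma occurrences_eq: "occurrences m X C = card {cs \<in> tuples_of_mon m X. set cs \<subseteq> C}"
  unfolding occurrences_def tuples_of_mon_def tuples_def by (rule arg_cong[of _ _ card]) auto

text \<open>One elimination step with pivot \<open>ds ! l\<close>; the pivot itself is dropped. When
  the result lies in C, the tuple spans at most one dimension modulo C.\<close>

definition reduce :: "nat \<Rightarrow> (nat \<Rightarrow> 'a::field) \<Rightarrow> ('a ^ 'n) list \<Rightarrow> ('a ^ 'n) list" where
  "reduce l u ds = map (\<lambda>i. ds ! i - u i *s ds ! l) (filter (\<lambda>i. i \<noteq> l) [0..<length ds])"

lemma length_reduce: "l < length ds \<Longrightarrow> length (reduce l u ds) = length ds - 1"
proof -
  assume l: "l < length ds"
  have "length (filter (\<lambda>i. i \<noteq> l) [0..<length ds]) = card ({..<length ds} - {l})"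
    by (subst distinct_card[symmetric]) (auto intro: arg_cong[of _ _ card])
  thus ?thesis using l by (simp add: reduce_def)
qed

lemma set_reduce: "set (reduce l u ds) = {ds ! i - u i *s ds ! l | i. i < length ds \<and> i \<noteq> l}"
  by (auto simp: reduce_def)

lemma reduce_perm:
  "l < length ds \<Longrightarrow> reduce l u (map (perm_vec \<pi>) ds) = map (perm_vec \<pi>) (reduce l u ds)"
  by (simp add: reduce_def perm_vec_def vec_eq_iff)

text \<open>Reduction commutes with coordinate permutations, which are transitive on tuples with a
  given monomial. Hence all reduced tuples share one monomial and all fibres have the same size.
  This trades m-tuples for (m - 1)-tuples inside C.\<close>

lemma card_reduce_in:
  fixes ds :: "('a::{field,finite} ^ 'n::finite) list" and C :: "('a ^ 'n) set"
  assumes ds: "ds \<in> tuples_of_mon m X" and l: "l < m"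
  shows "card {es \<in> tuples_of_mon m X. set (reduce l u es) \<subseteq> C}
    = card {es \<in> tuples_of_mon m X. reduce l u es = reduce l u ds}
      * occurrences (m - 1) (mon (reduce l u ds)) C"
proof -
  let ?A = "tuples_of_mon m X :: ('a ^ 'n) list set" and ?r = "reduce l u"
  let ?B = "{cs \<in> tuples (m - 1) C. mon cs = mon (?r ds)}"
  have length: "length ds = m" and X: "mon ds = X" using ds by (auto simp: tuples_of_mon_def)
  have perm_mem: "map (perm_vec \<pi>) es \<in> ?A" if "es \<in> ?A" "\<pi> permutes UNIV" for es \<pi>
    using that by (simp add: tuples_of_mon_def mon_perm)
  have mon_r: "mon (?r es) = mon (?r ds)" if es: "es \<in> ?A" for es
  proof -
    obtain \<pi> where "\<pi> permutes UNIV" "es = map (perm_vec \<pi>) ds"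
      using mon_eq_imp_perm[of ds es] es length X by (auto simp: tuples_of_mon_def)
    thus ?thesis using length l by (simp add: reduce_perm mon_perm)
  qed
  have fib: "card {es \<in> ?A. ?r es = cs} = card {es \<in> ?A. ?r es = ?r ds}" if cs: "cs \<in> ?B" for cs
  proof -
    obtain \<pi> where \<pi>: "\<pi> permutes UNIV" "cs = map (perm_vec \<pi>) (?r ds)"
      using mon_eq_imp_perm[of "?r ds" cs] cs length l by (auto simp: tuples_def length_reduce)
    have iv: "inv \<pi> permutes UNIV" by (rule permutes_inv[OF \<pi>(1)])
    have inv1: "map (perm_vec (inv \<pi>)) (map (perm_vec \<pi>) es) = es"
      and inv2: "map (perm_vec \<pi>) (map (perm_vec (inv \<pi>)) es) = es" for es :: "('a ^ 'n) list"
      by (auto simp: perm_vec_comp \<pi>(1) iv permutes_inv_o[OF \<pi>(1)] intro!: map_idI)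
    have "{es \<in> ?A. ?r es = cs} = map (perm_vec \<pi>) ` {es \<in> ?A. ?r es = ?r ds}"
    proof (intro equalityI subsetI)
      fix es assume es: "es \<in> {es \<in> ?A. ?r es = cs}"
      hence "map (perm_vec (inv \<pi>)) es \<in> ?A" using perm_mem iv by simp
      moreover have "?r (map (perm_vec (inv \<pi>)) es) = ?r ds"
        using es l inv1[of "?r ds"] \<pi>(2) by (simp add: reduce_perm tuples_of_mon_def)
      ultimately show "es \<in> map (perm_vec \<pi>) ` {es \<in> ?A. ?r es = ?r ds}"
        using inv2[of es] by (metis (mono_tags, lifting) image_eqI mem_Collect_eq)
    next
      fix es assume "es \<in> map (perm_vec \<pi>) ` {es \<in> ?A. ?r es = ?r ds}"
      then obtain fs where fs: "fs \<in> ?A" "?r fs = ?r ds" "es = map (perm_vec \<pi>) fs" by blast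
      have "length fs = m" using fs(1) by (simp add: tuples_of_mon_def)
      thus "es \<in> {es \<in> ?A. ?r es = cs}"
        using fs \<pi> l perm_mem[OF fs(1) \<pi>(1)] by (simp add: reduce_perm)
    qed
    thus ?thesis by (simp add: card_image inj_map_perm_vec[OF \<pi>(1)])
  qed
  let ?S = "{es \<in> ?A. set (?r es) \<subseteq> C}"
  have finB: "finite ?B"
    by (rule finite_subset[OF _ finite_lists_length_eq[of UNIV "m - 1"]]) (auto simp: tuples_def)
  have finS: "finite ?S" by (simp add: finite_tuples_of_mon)
  have img: "?r ` ?S \<subseteq> ?B"
    using mon_r l by (auto simp: tuples_def length_reduce tuples_of_mon_def)
  have "card ?S = (\<Sum>cs\<in>?B. card {es \<in> ?S. ?r es = cs})"
    unfolding card_eq_sum by (rule sum.group[symmetric, OF finS finB img])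
  also have "\<dots> = (\<Sum>cs\<in>?B. card {es \<in> ?A. ?r es = cs})"
    by (intro sum.cong refl arg_cong[of _ _ card]) (auto simp: tuples_def)
  also have "\<dots> = (\<Sum>cs\<in>?B. card {es \<in> ?A. ?r es = ?r ds})"
    by (rule sum.cong[OF refl fib])
  finally show ?thesis by (simp add: occurrences_def mult.commute)
qed

text \<open>A hyperplane of coefficient vectors is the kernel of a unique \<open>v\<close> whose first nonzero entry is
  \<open>v\<^sub>l = 1\<close>; the members of \<open>tails m l\<close> are the possible entries after position \<open>l\<close>, and
  \<open>reduce l v\<close> applies a basis of that hyperplane to a tuple.\<close>

definition tails :: "nat \<Rightarrow> nat \<Rightarrow> (nat \<Rightarrow> 'a::zero) set" where
  "tails m l = {u. \<forall>i. \<not> (l < i \<and> i < m) \<longrightarrow> u i = 0}"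

lemma card_supported:
  assumes "finite I"
  shows "card {u. \<forall>i. i \<notin> I \<longrightarrow> u i = (0 :: 'a::{zero,finite})} = CARD('a) ^ card I"
proof -
  have "bij_betw (\<lambda>u. restrict u I) {u. \<forall>i. i \<notin> I \<longrightarrow> u i = 0} (I \<rightarrow>\<^sub>E (UNIV :: 'a set))"
    by (rule bij_betw_byWitness[where f' = "\<lambda>u i. if i \<in> I then u i else 0"])
      (auto simp: fun_eq_iff restrict_def PiE_def extensional_def)
  from bij_betw_same_card[OF this] show ?thesis
    using assms by (simp add: card_PiE)
qed

lemma card_tails: "card (tails m l :: (nat \<Rightarrow> 'a::{zero,finite}) set) = CARD('a) ^ (m - 1 - l)"
  using card_supported[of "{l<..<m}"] by (simp add: tails_def)

lemma finite_tails: "finite (tails m l :: (nat \<Rightarrow> 'a::{zero,finite}) set)"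
proof (rule card_ge_0_finite)
  show "card (tails m l :: (nat \<Rightarrow> 'a) set) > 0" by (simp add: card_tails)
qed

text \<open>This is the origin of \<open>\<beta>\<close>: the pairs of a pivot and its tail are
  normalised representatives of the points of a projective space of dimension m - 1.\<close>

lemma sum_card_tails:
  "(\<Sum>l<m. card (tails m l :: (nat \<Rightarrow> 'a::{zero,finite}) set)) = (\<Sum>i<m. CARD('a) ^ i)"
  unfolding card_tails using sum.nat_diff_reindex[of "\<lambda>i. CARD('a) ^ i" m] by simp

section \<open>Tuples contained in neighbours of a code\<close>

context code_family
begin

text \<open>A neighbour containing the pivot \<open>ds ! l\<close> is spanned by it together with a
  hyperplane of C, so each entry agrees with a multiple of the pivot modulo C. Conversely, the
  neighbour through the pivot contains the whole tuple.\<close>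

lemma tuple_in_neighbour_iff:
  assumes C: "C \<in> \<F>" and D0: "D0 \<in> \<F>" "set ds \<subseteq> D0" and l: "l < length ds" "ds ! l \<notin> C"
  shows "(\<exists>D\<in>\<F>. neighbour C D \<and> set ds \<subseteq> D)
    \<longleftrightarrow> (\<exists>u. \<forall>i<length ds. ds ! i - u i *s ds ! l \<in> C)"
proof
  assume "\<exists>D\<in>\<F>. neighbour C D \<and> set ds \<subseteq> D"
  then obtain D where D: "D \<in> \<F>" "neighbour C D" "set ds \<subseteq> D" by blast
  have E: "vec.subspace (C \<inter> D)" "CARD('a) * card (C \<inter> D) = CARD('a) ^ n"
    using D C neighbour_iff by (auto intro: vec.subspace_inter family_subspace)
  have "D = vec.span (insert (ds ! l) (C \<inter> D))"
    using D(3) l by (intro family_eq_span_insert D(1) E) auto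
  hence "\<exists>k. ds ! i - k *s ds ! l \<in> C \<inter> D" if "i < length ds" for i
    using that D(3) E(1) nth_mem[OF that] vec.span_breakdown_eq[of "ds ! i" "ds ! l" "C \<inter> D"]
    by (metis subsetD vec.span_eq_iff)
  thus "\<exists>u. \<forall>i<length ds. ds ! i - u i *s ds ! l \<in> C" by (metis IntD1)
next
  assume "\<exists>u. \<forall>i<length ds. ds ! i - u i *s ds ! l \<in> C"
  then obtain u where u: "\<And>i. i < length ds \<Longrightarrow> ds ! i - u i *s ds ! l \<in> C" by blast
  let ?D = "neighbour_through C (ds ! l)"
  have mem: "ds ! i \<in> D0" if "i < length ds" for i using that D0(2) by auto
  have "ds ! i \<in> ?D" if i: "i < length ds" for i
  proof -
    \<comment> \<open>Membership in the common code D0 makes the difference orthogonal to the pivot,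
      which is what the neighbour through the pivot demands of vectors of C.\<close>
    have "ds ! i - u i *s ds ! l \<in> D0"
      by (intro vec.subspace_diff vec.subspace_scale family_subspace[OF D0(1)] mem i l)
    hence "form bar (ds ! i - u i *s ds ! l) (ds ! l) = 0"
      using mem[OF l(1)] family_form[OF D0(1)] by blast
    hence "ds ! i - u i *s ds ! l \<in> vec.span {x \<in> C. form bar x (ds ! l) = 0}"
      using u[OF i] by (intro vec.span_base) simp
    thus ?thesis unfolding neighbour_through_def vec.span_breakdown_eq by blast
  qed
  hence "set ds \<subseteq> ?D" by (auto simp: in_set_conv_nth)
  moreover have "type_null (ds ! l)" by (rule family_null[OF D0(1) mem[OF l(1)]])
  ultimately show "\<exists>D\<in>\<F>. neighbour C D \<and> set ds \<subseteq> D"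
    using neighbour_through[OF C l(2)] by blast
qed

lemma card_neighbours_containing:
  assumes C: "C \<in> \<F>" and ds: "\<not> set ds \<subseteq> C"
  shows "card {D \<in> \<F>. neighbour C D \<and> set ds \<subseteq> D} = of_bool (\<exists>D\<in>\<F>. neighbour C D \<and> set ds \<subseteq> D)"
proof (cases "\<exists>D\<in>\<F>. neighbour C D \<and> set ds \<subseteq> D")
  case True
  obtain f where f: "f \<in> set ds" "f \<notin> C" using ds by blast
  have "{D \<in> \<F>. neighbour C D \<and> set ds \<subseteq> D} = {neighbour_through C f}"
    using True neighbour_through_unique[OF C _ _ _ f(2)] f(1) by blast
  thus ?thesis by (simp only: True of_bool_eq) simp
next
  case False
  hence "{D \<in> \<F>. neighbour C D \<and> set ds \<subseteq> D} = {}" by blast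
  thus ?thesis by (simp only: False card.empty of_bool_eq)
qed

text \<open>Grouping the neighbours D by D \<inter> C produces the sum that condition (2) assumes
  constant.\<close>

lemma card_neighbours_inside:
  assumes C: "C \<in> \<F>" and cs: "set cs \<subseteq> C"
  shows "card {D \<in> \<F>. neighbour C D \<and> set cs \<subseteq> D}
    = (\<Sum>E\<in>hyperplanes_through n C cs. neighbour_count \<F> E C)"
proof -
  let ?S = "{D \<in> \<F>. neighbour C D \<and> set cs \<subseteq> D}"
  have img: "(\<lambda>D. D \<inter> C) ` ?S \<subseteq> hyperplanes_through n C cs"
    using cs C by (auto simp: hyperplanes_through_def neighbour_def Int_commute
        intro: vec.subspace_inter family_subspace)
  have "card ?S = (\<Sum>E\<in>hyperplanes_through n C cs. card {D \<in> ?S. D \<inter> C = E})"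
    unfolding card_eq_sum by (rule sum.group[symmetric, OF finite finite img])
  also have "\<dots> = (\<Sum>E\<in>hyperplanes_through n C cs. neighbour_count \<F> E C)"
    unfolding neighbour_count_def
    by (intro sum.cong refl arg_cong[of _ _ card])
      (auto simp: hyperplanes_through_def neighbour_def Int_commute)
  finally show ?thesis .
qed

text \<open>A tuple inside C is counted on the right once for every pair (l, u). A tuple whose
  reduction lies in C while its pivot does not is outside C, and it arises from exactly one pair.
  Moving the inside contribution to the left keeps the identity in the natural numbers.\<close>

lemma card_outside_tuples:
  assumes C: "C \<in> \<F>" and X: "\<And>ds. ds \<in> tuples_of_mon m X \<Longrightarrow> \<exists>D\<in>\<F>. set ds \<subseteq> D"
  shows "card {ds \<in> tuples_of_mon m X. \<not> set ds \<subseteq> C \<and> (\<exists>D\<in>\<F>. neighbour C D \<and> set ds \<subseteq> D)}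
      + (\<Sum>i<m. CARD('a) ^ i) * occurrences m X C
    = (\<Sum>l<m. \<Sum>u\<in>tails m l. card {ds \<in> tuples_of_mon m X. set (reduce l u ds) \<subseteq> C})"
proof -
  let ?A = "tuples_of_mon m X :: ('a ^ 'n) list set"
  let ?S = "\<lambda>(l, u). {ds \<in> ?A. ds ! l \<notin> C \<and> set (reduce l u ds) \<subseteq> C}"
  let ?I = "SIGMA l:{..<m}. (tails m l :: (nat \<Rightarrow> 'a) set)"
  have red: "set (reduce l u ds) \<subseteq> C \<longleftrightarrow> (\<forall>i<m. i \<noteq> l \<longrightarrow> ds ! i - u i *s ds ! l \<in> C)"
    if "ds \<in> ?A" for l u ds
    using that by (auto simp: set_reduce tuples_of_mon_def)
  note sub = family_subspace[OF C]
  have split: "card {ds \<in> ?A. set (reduce l u ds) \<subseteq> C} = card (?S (l, u)) + occurrences m X C"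
    if l: "l < m" for l u
  proof -
    have "set (reduce l u ds) \<subseteq> C \<longleftrightarrow> set ds \<subseteq> C" if ds: "ds \<in> ?A" and dl: "ds ! l \<in> C" for ds
    proof -
      have "ds ! i - u i *s ds ! l \<in> C \<longleftrightarrow> ds ! i \<in> C" for i
        using vec.subspace_scale[OF sub dl, of "u i"]
        by (metis diff_add_cancel sub vec.subspace_add vec.subspace_diff)
      thus ?thesis using ds dl unfolding red[OF ds]
        by (force simp: tuples_of_mon_def subset_eq in_set_conv_nth)
    qed
    moreover have mem: "ds ! l \<in> C" if "ds \<in> ?A" "set ds \<subseteq> C" for ds
      using that l by (auto simp: tuples_of_mon_def)
    ultimately have "{ds \<in> ?A. set (reduce l u ds) \<subseteq> C} = ?S (l, u) \<union> {ds \<in> ?A. set ds \<subseteq> C}"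
      by blast
    moreover have "?S (l, u) \<inter> {ds \<in> ?A. set ds \<subseteq> C} = {}"
      using mem by auto
    ultimately show ?thesis
      by (simp add: occurrences_eq card_Un_disjoint finite_tuples_of_mon)
  qed
  have "{ds \<in> ?A. \<not> set ds \<subseteq> C \<and> (\<exists>D\<in>\<F>. neighbour C D \<and> set ds \<subseteq> D)} = (\<Union>p\<in>?I. ?S p)"
  proof (intro equalityI subsetI)
    fix ds assume "ds \<in> {ds \<in> ?A. \<not> set ds \<subseteq> C \<and> (\<exists>D\<in>\<F>. neighbour C D \<and> set ds \<subseteq> D)}"
    hence ds: "ds \<in> ?A" "\<not> set ds \<subseteq> C" "\<exists>D\<in>\<F>. neighbour C D \<and> set ds \<subseteq> D" by auto
    have len: "length ds = m" using ds(1) by (simp add: tuples_of_mon_def)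
    \<comment> \<open>The pivot is the first entry outside C; earlier entries lie in C already, so
      their coefficients may be set to 0.\<close>
    define l where "l = (LEAST l. l < m \<and> ds ! l \<notin> C)"
    have "\<exists>l. l < m \<and> ds ! l \<notin> C"
      using ds(2) len by (auto simp: in_set_conv_nth)
    hence l: "l < m" "ds ! l \<notin> C" unfolding l_def by (metis (mono_tags, lifting) LeastI_ex)+
    have least: "ds ! i \<in> C" if "i < l" for i
      using not_less_Least[of i "\<lambda>l. l < m \<and> ds ! l \<notin> C"] that l(1) by (auto simp flip: l_def)
    obtain D0 where "D0 \<in> \<F>" "set ds \<subseteq> D0" using X ds(1) by blast
    then obtain u where u: "\<And>i. i < m \<Longrightarrow> ds ! i - u i *s ds ! l \<in> C"
      using tuple_in_neighbour_iff[OF C, of D0 ds l] l len ds(3) by auto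
    define v where "v i = (if l < i \<and> i < m then u i else 0)" for i
    have "v \<in> tails m l" by (simp add: v_def tails_def)
    moreover have "set (reduce l v ds) \<subseteq> C"
      unfolding red[OF ds(1)] using u least by (auto simp: v_def)
    ultimately show "ds \<in> (\<Union>p\<in>?I. ?S p)" using l ds(1) by blast
  next
    fix ds assume "ds \<in> (\<Union>p\<in>?I. ?S p)"
    then obtain l u where l: "l < m" "u \<in> tails m l" "ds ! l \<notin> C"
      and ds: "ds \<in> ?A" "set (reduce l u ds) \<subseteq> C" by blast
    have len: "length ds = m" using ds(1) by (simp add: tuples_of_mon_def)
    obtain D0 where D0: "D0 \<in> \<F>" "set ds \<subseteq> D0" using X ds(1) by blast
    \<comment> \<open>The value 1 at the pivot makes the l-th difference 0, as \<open>reduce\<close>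
      says nothing about that position.\<close>
    have "\<forall>i<m. ds ! i - (u(l := 1)) i *s ds ! l \<in> C"
      using ds(2) vec.subspace_0[OF sub] unfolding red[OF ds(1)] by auto
    hence "\<exists>D\<in>\<F>. neighbour C D \<and> set ds \<subseteq> D"
      using tuple_in_neighbour_iff[OF C D0, of l] l len by blast
    moreover have "\<not> set ds \<subseteq> C" using l len nth_mem[of l ds] by blast
    ultimately show "ds \<in> {ds \<in> ?A. \<not> set ds \<subseteq> C \<and> (\<exists>D\<in>\<F>. neighbour C D \<and> set ds \<subseteq> D)}"
      using ds(1) by blast
  qed
  moreover have "card (\<Union>p\<in>?I. ?S p) = (\<Sum>p\<in>?I. card (?S p))"
  proof (rule card_UN_disjoint)
    show "finite ?I" by (simp add: finite_tails)
    show "\<forall>p\<in>?I. finite (?S p)" by (auto simp: finite_tuples_of_mon)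
    \<comment> \<open>Both pivots are the first entry outside C, since an earlier position has
      coefficient 0. With equal pivots, two different coefficients would put a nonzero multiple of
      the pivot into C.\<close>
    have "p = p'" if p: "p \<in> ?I" "p' \<in> ?I" and ds: "ds \<in> ?S p" "ds \<in> ?S p'" for p p' ds
    proof -
      obtain l u l' u' where pp: "p = (l, u)" "p' = (l', u')" by fastforce
      have l: "l < m" "u \<in> tails m l" "ds ! l \<notin> C" "l' < m" "u' \<in> tails m l'" "ds ! l' \<notin> C"
        and A: "ds \<in> ?A" and r: "set (reduce l u ds) \<subseteq> C" "set (reduce l' u' ds) \<subseteq> C"
        using p ds by (auto simp: pp)
      have "l \<le> l'"
      proof (rule ccontr)
        assume "\<not> l \<le> l'"
        hence "ds ! l' - u l' *s ds ! l \<in> C"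
          using r(1) l(4) unfolding red[OF A] by auto
        moreover have "u l' = 0" using \<open>\<not> l \<le> l'\<close> l(2) by (simp add: tails_def)
        ultimately show False using l(6) by simp
      qed
      moreover have "l' \<le> l"
      proof (rule ccontr)
        assume "\<not> l' \<le> l"
        hence "ds ! l - u' l *s ds ! l' \<in> C"
          using r(2) l(1) unfolding red[OF A] by auto
        moreover have "u' l = 0" using \<open>\<not> l' \<le> l\<close> l(5) by (simp add: tails_def)
        ultimately show False using l(3) by simp
      qed
      ultimately have ll: "l = l'" by simp
      have "u i = u' i" for i
      proof (cases "l < i \<and> i < m")
        case False
        thus ?thesis using l ll by (auto simp: tails_def)
      next
        case True
        hence "ds ! i - u i *s ds ! l \<in> C" "ds ! i - u' i *s ds ! l \<in> C"
          using r ll unfolding red[OF A] by auto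
        hence "(ds ! i - u i *s ds ! l) - (ds ! i - u' i *s ds ! l) \<in> C"
          by (rule vec.subspace_diff[OF sub])
        moreover have "(ds ! i - u i *s ds ! l) - (ds ! i - u' i *s ds ! l) = (u' i - u i) *s ds ! l"
          by (simp add: vec_eq_iff algebra_simps)
        ultimately have *: "(u' i - u i) *s ds ! l \<in> C" by simp
        show ?thesis
        proof (rule ccontr)
          assume "u i \<noteq> u' i"
          hence "ds ! l = inverse (u' i - u i) *s ((u' i - u i) *s ds ! l)"
            by (simp only: vec.scale_scale) simp
          thus False using vec.subspace_scale[OF sub *] l(3) by metis
        qed
      qed
      thus ?thesis using ll by (auto simp: pp)
    qed
    thus "\<forall>p\<in>?I. \<forall>p'\<in>?I. p \<noteq> p' \<longrightarrow> ?S p \<inter> ?S p' = {}" by blast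
  qed
  moreover have "(\<Sum>p\<in>?I. card (?S p)) = (\<Sum>l<m. \<Sum>u\<in>tails m l. card (?S (l, u)))"
    by (subst sum.Sigma) (auto simp: finite_tails case_prod_unfold)
  moreover have "(\<Sum>l<m. \<Sum>u\<in>tails m l. card {ds \<in> ?A. set (reduce l u ds) \<subseteq> C})
      = (\<Sum>l<m. \<Sum>u\<in>tails m l. card (?S (l, u))) + (\<Sum>l<m. card (tails m l :: (nat \<Rightarrow> 'a) set)) * occurrences m X C"
  proof -
    have "(\<Sum>l<m. \<Sum>u\<in>tails m l. card {ds \<in> ?A. set (reduce l u ds) \<subseteq> C})
        = (\<Sum>l<m. \<Sum>u\<in>tails m l. card (?S (l, u)) + occurrences m X C)"
      by (intro sum.cong refl split) simp
    thus ?thesis by (simp add: sum.distrib sum_distrib_right)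
  qed
  ultimately show ?thesis by (simp only: sum_card_tails)
qed

text \<open>Exchanging the sums over neighbours and tuples leaves the number of neighbours per
  tuple: \<open>\<alpha>\<close> inside C, at most 1 outside. Apart from multiples of
  \<open>occurrences m X C\<close>, only counts of (m - 1)-tuples remain, with weights independent
  of C.\<close>

lemma sum_neighbours_occurrences:
  assumes "m = length ds0" "mon ds0 = X" "D0 \<in> \<F>" "set ds0 \<subseteq> D0" and C: "C \<in> \<F>"
    and \<alpha>: "\<And>cs. cs \<in> tuples m C \<Longrightarrow> mon cs = X \<Longrightarrow>
      (\<Sum>E\<in>hyperplanes_through n C cs. neighbour_count \<F> E C) = \<alpha>"
  shows "(\<Sum>D | D \<in> \<F> \<and> neighbour C D. occurrences m X D) + (\<Sum>i<m. CARD('a) ^ i) * occurrences m X C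
    = \<alpha> * occurrences m X C
      + (\<Sum>l<m. \<Sum>u\<in>tails m l. card {es \<in> tuples_of_mon m X. reduce l u es = reduce l u ds0}
          * occurrences (m - 1) (mon (reduce l u ds0)) C)"
proof -
  let ?A = "tuples_of_mon m X :: ('a ^ 'n) list set"
  let ?N = "{D. D \<in> \<F> \<and> neighbour C D}"
  have ds0: "ds0 \<in> ?A" using assms by (simp add: tuples_of_mon_def)
  \<comment> \<open>One tuple in D0 suffices: all others with monomial X are its coordinate
    permutations, and the family is closed under these.\<close>
  have X: "\<exists>D\<in>\<F>. set ds \<subseteq> D" if "ds \<in> ?A" for ds
  proof -
    have "mon ds0 = mon ds" "length ds0 = length ds"
      using that assms(1,2) by (simp_all add: tuples_of_mon_def)
    then obtain \<pi> where \<pi>: "\<pi> permutes UNIV" "ds = map (perm_vec \<pi>) ds0"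
      by (rule mon_eq_imp_perm)
    have "perm_code \<pi> D0 \<in> \<F>"
      using assms(3) self_dual_codes_perm \<pi>(1) by (simp add: family)
    moreover have "set ds \<subseteq> perm_code \<pi> D0" using assms(4) \<pi>(2) by (auto simp: perm_code_def)
    ultimately show ?thesis by blast
  qed
  have "(\<Sum>D\<in>?N. occurrences m X D) = (\<Sum>D\<in>?N. \<Sum>ds\<in>?A. of_bool (set ds \<subseteq> D))"
    by (simp add: occurrences_eq finite_tuples_of_mon of_bool_def sum.If_cases Int_def)
  also have "\<dots> = (\<Sum>ds\<in>?A. card {D \<in> \<F>. neighbour C D \<and> set ds \<subseteq> D})"
    by (subst sum.swap) (simp add: of_bool_def sum.If_cases Int_def conj_ac)
  also have "\<dots> = (\<Sum>ds\<in>?A. \<alpha> * of_bool (set ds \<subseteq> C)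
      + of_bool (\<not> set ds \<subseteq> C \<and> (\<exists>D\<in>\<F>. neighbour C D \<and> set ds \<subseteq> D)))"
  proof (rule sum.cong[OF refl])
    fix ds assume ds: "ds \<in> ?A"
    show "card {D \<in> \<F>. neighbour C D \<and> set ds \<subseteq> D} = \<alpha> * of_bool (set ds \<subseteq> C)
      + of_bool (\<not> set ds \<subseteq> C \<and> (\<exists>D\<in>\<F>. neighbour C D \<and> set ds \<subseteq> D))"
    proof (cases "set ds \<subseteq> C")
      case True
      thus ?thesis using card_neighbours_inside[OF C True] \<alpha>[of ds] ds
        by (simp add: tuples_of_mon_def tuples_def)
    next
      case False
      thus ?thesis using card_neighbours_containing[OF C False] by simp
    qed
  qed
  also have "\<dots> = \<alpha> * occurrences m X C
      + card {ds \<in> ?A. \<not> set ds \<subseteq> C \<and> (\<exists>D\<in>\<F>. neighbour C D \<and> set ds \<subseteq> D)}"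
    by (simp add: sum.distrib occurrences_eq finite_tuples_of_mon of_bool_def sum.If_cases Int_def
        flip: sum_distrib_left)
  finally have "(\<Sum>D\<in>?N. occurrences m X D) + (\<Sum>i<m. CARD('a) ^ i) * occurrences m X C
      = \<alpha> * occurrences m X C
        + (\<Sum>l<m. \<Sum>u\<in>tails m l. card {ds \<in> ?A. set (reduce l u ds) \<subseteq> C})"
    using card_outside_tuples[OF C X, of m X] by simp
  thus ?thesis using card_reduce_in[OF ds0] by simp
qed

end

section \<open>Monomials of full rank\<close>

lemma keys_mon: "Poly_Mapping.keys (mon cs) = range (column (cs :: ('a::zero ^ 'n::finite) list))"
  by (auto simp: lookup_mon card_eq_0_iff in_keys_iff)

text \<open>The kernel of a is a subspace containing the keys, and by full rank these span every
  unit vector. Since the keys will be columns of a tuple, such an a is a linear relation among its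
  entries.\<close>

lemma full_rank_functional:
  fixes X :: "(nat \<Rightarrow> 'a::field) \<Rightarrow>\<^sub>0 nat"
  assumes X: "X \<in> full_rank_monomials N m"
    and a: "\<And>v. v \<in> Poly_Mapping.keys X \<Longrightarrow> (\<Sum>j<m. a j * v j) = 0" and j: "j < m"
  shows "a j = 0"
proof -
  define e :: "nat \<Rightarrow> nat \<Rightarrow> 'a" where "e k i = (if i = k then 1 else 0)" for k i
  have sum_e: "(\<Sum>i<m. b i * e k i) = b k" if "k < m" for b k
    using that by (simp add: e_def mult_delta_right)
  have sub: "coord.subspace {v. (\<Sum>i<m. a i * v i) = 0}"
  proof (rule coord.subspaceI)
    fix c x assume "x \<in> {v. (\<Sum>i<m. a i * v i) = 0}"
    moreover have "(\<Sum>i<m. a i * (c * x i)) = c * (\<Sum>i<m. a i * x i)"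
      by (simp add: sum_distrib_left mult_ac)
    ultimately show "coord_scale c x \<in> {v. (\<Sum>i<m. a i * v i) = 0}"
      by (simp add: coord_scale_def)
  qed (auto simp: distrib_left sum.distrib)
  have coord_span: "coord_space m \<subseteq> coord.span (e ` {..<m})"
  proof
    fix v :: "nat \<Rightarrow> 'a" assume v: "v \<in> coord_space m"
    have sum_apply: "sum f A i = (\<Sum>k\<in>A. f k i)" for f :: "nat \<Rightarrow> nat \<Rightarrow> 'a" and A i
      by (induction A rule: infinite_finite_induct) auto
    have "v = (\<Sum>k<m. coord_scale (v k) (e k))"
      using v by (auto simp: fun_eq_iff sum_apply coord_scale_def coord_space_def e_def mult_delta_right)
    also have "\<dots> \<in> coord.span (e ` {..<m})"
      by (intro coord.span_sum coord.span_scale coord.span_base) auto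
    finally show "v \<in> coord.span (e ` {..<m})" .
  qed
  obtain B where B: "B \<subseteq> Poly_Mapping.keys X" "coord.independent B"
    "Poly_Mapping.keys X \<subseteq> coord.span B" "card B = coord.dim (Poly_Mapping.keys X)"
    by (rule coord.basis_exists)
  have dim: "card B = m" using X B(4) by (simp add: full_rank_monomials_def mon_rank_def)
  have keys: "Poly_Mapping.keys X \<subseteq> coord_space m"
    using X by (simp add: full_rank_monomials_def monomials_def)
  have e_mem: "e j \<in> coord_space m" using j by (auto simp: coord_space_def e_def)
  have card_e: "card (e ` {..<m}) \<le> m" using card_image_le[of "{..<m}" e] by simp
  have "e j \<in> coord.span B"
  \<comment> \<open>Otherwise B with \<open>e j\<close> added would be m + 1 independent vectors in
    the span of m unit vectors.\<close>
  proof (rule ccontr)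
    assume nin: "e j \<notin> coord.span B"
    have "coord.independent (insert (e j) B)"
      by (rule coord.independent_insertI[OF nin B(2)])
    moreover have "insert (e j) B \<subseteq> coord.span (e ` {..<m})"
      using e_mem keys B(1) coord_span by blast
    ultimately have *: "finite (insert (e j) B)" "card (insert (e j) B) \<le> card (e ` {..<m})"
      using coord.independent_span_bound[of "e ` {..<m}" "insert (e j) B"] by auto
    have "e j \<notin> B" using nin coord.span_base by blast
    hence "card (insert (e j) B) = Suc m" using *(1) dim by simp
    thus False using *(2) card_e by simp
  qed
  also have "coord.span B \<subseteq> {v. (\<Sum>i<m. a i * v i) = 0}"
    using a B(1) by (intro coord.span_minimal sub) auto
  finally show ?thesis using sum_e[OF j, of a] by simp
qed

text \<open>Two coefficient vectors with the same combination differ by a functional vanishing on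
  all columns, so the q^m combinations are distinct.\<close>

lemma card_span_full_rank:
  fixes ds :: "('a::{field,finite} ^ 'n::finite) list"
  assumes X: "mon ds \<in> full_rank_monomials N m" and len: "length ds = m"
  shows "CARD('a) ^ m \<le> card (vec.span (set ds))"
proof -
  let ?U = "{u. \<forall>i. i \<notin> {..<m} \<longrightarrow> u i = (0 :: 'a)}"
  let ?f = "\<lambda>u. \<Sum>j<m. u j *s ds ! j"
  have "inj_on ?f ?U"
  proof (rule inj_onI)
    fix u v assume u: "u \<in> ?U" and v: "v \<in> ?U" and eq: "?f u = ?f v"
    have "u j - v j = 0" if j: "j < m" for j
    proof (rule full_rank_functional[OF X _ j])
      fix w assume "w \<in> Poly_Mapping.keys (mon ds)"
      then obtain k where w: "w = column ds k" by (auto simp: keys_mon)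
      have "(\<Sum>j<m. u j * ds ! j $ k) = (\<Sum>j<m. v j * ds ! j $ k)"
        using arg_cong[OF eq, of "\<lambda>x. x $ k"] by simp
      thus "(\<Sum>j<m. (u j - v j) * w j) = 0"
        by (simp add: w column_def len left_diff_distrib sum_subtractf)
    qed
    hence "u j = v j" for j using u v by (cases "j < m") auto
    thus "u = v" by (rule ext)
  qed
  hence "card (?f ` ?U) = CARD('a) ^ m"
    using card_supported[of "{..<m}", where 'a = 'a] by (simp add: card_image)
  moreover have "?f u \<in> vec.span (set ds)" for u
    using len by (intro vec.span_sum vec.span_scale) (simp add: vec.span_base)
  hence "card (?f ` ?U) \<le> card (vec.span (set ds))"
    by (intro card_mono image_subsetI) simp_all
  ultimately show ?thesis by simp
qed

lemma card_span_set_le: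
  fixes cs :: "('a::{field,finite} ^ 'n::finite) list"
  shows "card (vec.span (set cs)) \<le> CARD('a) ^ length cs"
proof -
  have "vec.dim (vec.span (set cs)) \<le> length cs"
    using vec.dim_le_card[of "vec.span (set cs)" "set cs"] card_length[of cs] by simp
  thus ?thesis
    using card_field_gt_1[where 'a = 'a] by (simp add: card_subspace power_increasing)
qed

section \<open>The Kneser-Hecke operator as an adjacency operator\<close>

text \<open>Orbit-stabilizer for the coordinate permutations.\<close>

lemma card_class_mult_aut:
  "card (code_class C) * card (code_aut C) = card {\<pi> :: 'n::finite \<Rightarrow> 'n. \<pi> permutes UNIV}"
  for C :: "('a ^ 'n) set"
proof -
  let ?P = "{\<pi> :: 'n \<Rightarrow> 'n. \<pi> permutes UNIV}"
  have fin: "finite ?P" by simp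
  have img: "(\<lambda>\<pi>. perm_code \<pi> C) ` ?P = code_class C" by (auto simp: code_class_def)
  have fib: "card {\<pi> \<in> ?P. perm_code \<pi> C = D} = card (code_aut C)" if D: "D \<in> code_class C" for D
  proof -
    obtain \<rho> where \<rho>: "\<rho> permutes UNIV" "D = perm_code \<rho> C" using D unfolding code_class_def by blast
    have iv: "inv \<rho> permutes UNIV" by (rule permutes_inv[OF \<rho>(1)])
    have "bij_betw (\<lambda>\<pi>. \<rho> \<circ> \<pi>) (code_aut C) {\<pi> \<in> ?P. perm_code \<pi> C = D}"
    proof (rule bij_betw_byWitness[where f' = "\<lambda>\<pi>. inv \<rho> \<circ> \<pi>"])
      show "\<forall>\<pi>\<in>code_aut C. inv \<rho> \<circ> (\<rho> \<circ> \<pi>) = \<pi>"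
        by (simp add: fun_eq_iff permutes_inverses[OF \<rho>(1)])
      show "\<forall>\<pi>\<in>{\<pi> \<in> ?P. perm_code \<pi> C = D}. \<rho> \<circ> (inv \<rho> \<circ> \<pi>) = \<pi>"
        by (simp add: fun_eq_iff permutes_inverses[OF \<rho>(1)])
      show "(\<lambda>\<pi>. \<rho> \<circ> \<pi>) ` code_aut C \<subseteq> {\<pi> \<in> ?P. perm_code \<pi> C = D}"
        using \<rho> by (auto simp: code_aut_def permutes_compose simp flip: perm_code_comp)
      show "(\<lambda>\<pi>. inv \<rho> \<circ> \<pi>) ` {\<pi> \<in> ?P. perm_code \<pi> C = D} \<subseteq> code_aut C"
        using \<rho> iv by (auto simp: code_aut_def permutes_compose perm_code_inv simp flip: perm_code_comp)
    qed
    thus ?thesis by (simp add: bij_betw_same_card)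
  qed
  have "card ?P = (\<Sum>D\<in>code_class C. card {\<pi> \<in> ?P. perm_code \<pi> C = D})"
    unfolding card_eq_sum using img
    by (intro sum.group[symmetric, OF fin]) (auto simp flip: img)
  also have "\<dots> = (\<Sum>D\<in>code_class C. card (code_aut C))"
    by (rule sum.cong[OF refl fib])
  also have "\<dots> = card (code_class C) * card (code_aut C)" by simp
  finally show ?thesis by simp
qed

lemma code_class_eq:
  assumes "D \<in> code_class C"
  shows "code_class D = code_class C"
proof -
  obtain \<pi> where "\<pi> permutes UNIV" "D = perm_code \<pi> C"
    using assms unfolding code_class_def by blast
  thus ?thesis by (simp only: code_class_perm)
qed

lemma finite_code_class: "finite (code_class (C :: ('a ^ 'n::finite) set))"
proof -
  have "code_class C = (\<lambda>\<pi>. perm_code \<pi> C) ` {\<pi>. \<pi> permutes UNIV}"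
    by (auto simp: code_class_def)
  thus ?thesis by simp
qed

lemma card_code_class_pos: "card (code_class (C :: ('a ^ 'n::finite) set)) > 0"
  using code_class_self[of C] finite_code_class[of C] by (auto simp: card_gt_0_iff)

lemma card_code_aut_pos: "card (code_aut (C :: ('a ^ 'n::finite) set)) > 0"
proof -
  have "id \<in> code_aut C" by (simp add: code_aut_def permutes_id)
  moreover have "finite (code_aut C)" by (simp add: code_aut_def)
  ultimately show ?thesis by (auto simp: card_gt_0_iff)
qed

text \<open>Identifying \<open>[C]\<close> with the average of the codes in its class turns a vector into
  a function on codes, the operator into summation over neighbours, and the Hermitian product
  into a multiple of the standard one.\<close>

definition averaged :: "('a, 'n::finite) code_vec \<Rightarrow> ('a ^ 'n) set \<Rightarrow> complex" where
  "averaged v C = v (code_class C) / of_nat (card (code_class C))"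

lemma perm_code_image_dim:
  fixes A :: "('a::field ^ 'n::finite) set"
  assumes "\<pi> permutes UNIV"
  shows "vec.dim (perm_code \<pi> A) = vec.dim A"
  unfolding perm_code_def
  by (rule vec.dim_image_eq[OF linear_perm_vec]) (rule inj_on_subset[OF inj_perm_vec[OF assms]], simp)

lemma perm_code_Int:
  assumes "\<pi> permutes UNIV"
  shows "perm_code \<pi> (C \<inter> D) = perm_code \<pi> C \<inter> perm_code \<pi> D"
  unfolding perm_code_def by (rule image_Int[OF inj_perm_vec[OF assms]])

context code_family
begin

abbreviation "\<K> \<equiv> code_classes \<F>"

abbreviation "T \<equiv> kneser_hecke \<F> n"

lemma family_perm: "C \<in> \<F> \<Longrightarrow> \<pi> permutes UNIV \<Longrightarrow> perm_code \<pi> C \<in> \<F>"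
  using self_dual_codes_perm by (simp add: family)

lemma class_in_family:
  assumes "K \<in> \<K>"
  shows "{C \<in> \<F>. code_class C = K} = K"
proof -
  obtain C0 where C0: "C0 \<in> \<F>" "K = code_class C0" using assms by (auto simp: code_classes_def)
  have "C \<in> \<F>" if "C \<in> K" for C
    using that C0 family_perm by (auto simp: code_class_def)
  thus ?thesis using C0 code_class_self code_class_eq by blast
qed

lemma class_rep_mem: "K \<in> \<K> \<Longrightarrow> class_rep K \<in> K"
  by (auto simp: code_classes_def class_rep_code_class)

text \<open>Dividing by the class size compensates for each class being met once per member; this
  removes class representatives from all later sums.\<close>

lemma sum_classes:
  assumes g: "\<And>C D. C \<in> \<F> \<Longrightarrow> D \<in> code_class C \<Longrightarrow> g D = g C"
  shows "(\<Sum>K\<in>\<K>. v K * g (class_rep K)) = (\<Sum>C\<in>\<F>. averaged v C * g C)"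
proof -
  have "(\<Sum>C\<in>\<F>. averaged v C * g C) = (\<Sum>K\<in>\<K>. \<Sum>C | C \<in> \<F> \<and> code_class C = K. averaged v C * g C)"
    by (rule sum.group[symmetric, OF finite finite]) (auto simp: code_classes_def)
  also have "\<dots> = (\<Sum>K\<in>\<K>. v K * g (class_rep K))"
  proof (rule sum.cong[OF refl])
    fix K assume K: "K \<in> \<K>"
    note fam = class_in_family[OF K]
    have "averaged v C * g C = v K / of_nat (card K) * g (class_rep K)" if "C \<in> K" for C
    proof -
      have "C \<in> \<F>" "code_class C = K" using that fam by auto
      thus ?thesis using g[of C "class_rep K"] class_rep_mem[OF K] by (simp add: averaged_def)
    qed
    moreover have "card K \<noteq> 0" using class_rep_mem[OF K] by (auto simp: card_eq_0_iff)
    ultimately show "(\<Sum>C | C \<in> \<F> \<and> code_class C = K. averaged v C * g C) = v K * g (class_rep K)"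
      unfolding fam by simp
  qed
  finally show ?thesis by simp
qed

lemma mon_coeff_eq: "mon_coeff \<F> m X v = (\<Sum>C\<in>\<F>. averaged v C * of_nat (occurrences m X C))"
  unfolding mon_coeff_def occurrences_def
  by (rule sum_classes[where g = "\<lambda>C. of_nat (card {cs \<in> tuples m C. mon cs = X})"])
    (simp add: card_mon_class)

text \<open>By orbit-stabilizer, the weight |Aut(C)| times the class size is the constant N!, and
  the class size is absorbed by passing to averages.\<close>

lemma code_inner_eq:
  "code_inner \<F> v w = of_nat (card {\<pi> :: 'n \<Rightarrow> 'n. \<pi> permutes UNIV})
    * (\<Sum>C\<in>\<F>. averaged v C * cnj (averaged w C))"
proof -
  have rep: "code_class (class_rep K) = K" if "K \<in> \<K>" for K
    using class_in_family[OF that] class_rep_mem[OF that] by blast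
  have "code_inner \<F> v w = (\<Sum>K\<in>\<K>. v K *
      (of_nat (card (code_aut (class_rep K))) * cnj (w (code_class (class_rep K)))))"
    unfolding code_inner_def by (rule sum.cong) (simp_all add: rep)
  also have "\<dots> = (\<Sum>C\<in>\<F>. averaged v C * (of_nat (card (code_aut C)) * cnj (w (code_class C))))"
    by (rule sum_classes[where g = "\<lambda>C. of_nat (card (code_aut C)) * cnj (w (code_class C))"])
      (simp add: card_code_aut_class code_class_eq)
  also have "\<dots> = (\<Sum>C\<in>\<F>. averaged v C
      * (of_nat (card {\<pi> :: 'n \<Rightarrow> 'n. \<pi> permutes UNIV}) * cnj (averaged w C)))"
  proof (rule sum.cong[OF refl])
    fix C :: "('a ^ 'n) set"
    have cancel: "x * (b * y) = x * (a * b * (y / a))" if "a \<noteq> 0" for a b x y :: complex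
      using that by simp
    have "(of_nat (card (code_class C)) :: complex) \<noteq> 0"
      using card_code_class_pos[of C] by (simp only: of_nat_eq_0_iff)
    from cancel[OF this]
    show "averaged v C * (of_nat (card (code_aut C)) * cnj (w (code_class C)))
      = averaged v C * (of_nat (card {\<pi> :: 'n \<Rightarrow> 'n. \<pi> permutes UNIV}) * cnj (averaged w C))"
      unfolding card_class_mult_aut[of C, symmetric] averaged_def[of w]
      by (simp only: of_nat_mult complex_cnj_divide complex_cnj_of_nat)
  qed
  finally show ?thesis by (simp add: sum_distrib_left mult_ac)
qed

lemma neighbour_perm:
  "\<pi> permutes UNIV \<Longrightarrow> neighbour (perm_code \<pi> C) (perm_code \<pi> D) \<longleftrightarrow> neighbour C D"
  by (simp add: neighbour_def perm_code_image_dim flip: perm_code_Int)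

lemma averaged_perm: "\<pi> permutes UNIV \<Longrightarrow> averaged v (perm_code \<pi> C) = averaged v C"
  by (simp add: averaged_def code_class_perm)

text \<open>The coefficient of \<open>T v\<close> at the class of D counts neighbours lying in that
  class. Adjacency is invariant under permutations, so after exchanging sums every member of the
  class contributes equally and the class size cancels.\<close>

lemma averaged_T:
  assumes D: "D \<in> \<F>"
  shows "averaged (T v) D = (\<Sum>C | C \<in> \<F> \<and> neighbour C D. averaged v C)"
proof -
  define S where "S D = (\<Sum>C | C \<in> \<F> \<and> neighbour C D. averaged v C)" for D
  have S: "S D' = S D" if D': "D' \<in> code_class D" for D'
  proof -
    obtain \<pi> where \<pi>: "\<pi> permutes UNIV" "D' = perm_code \<pi> D" using D' by (auto simp: code_class_def)
    have iv: "inv \<pi> permutes UNIV" by (rule permutes_inv[OF \<pi>(1)])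
    have "bij_betw (perm_code \<pi>) {C. C \<in> \<F> \<and> neighbour C D} {C. C \<in> \<F> \<and> neighbour C D'}"
    proof (rule bij_betw_byWitness[where f' = "perm_code (inv \<pi>)"])
      show "perm_code (inv \<pi>) ` {C. C \<in> \<F> \<and> neighbour C D'} \<subseteq> {C. C \<in> \<F> \<and> neighbour C D}"
        using \<pi> iv neighbour_perm[OF iv, of _ D'] by (auto simp: perm_code_inv family_perm)
    qed (use \<pi> in \<open>auto simp: perm_code_inv family_perm neighbour_perm\<close>)
    from sum.reindex_bij_betw[OF this, of "averaged v"] show ?thesis
      by (simp add: S_def averaged_perm \<pi>(1))
  qed
  have sub: "code_class D \<subseteq> \<F>"
    using family_perm D by (auto simp: code_class_def)
  have "T v (code_class D) = (\<Sum>C\<in>\<F>. averaged v C *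
      (\<Sum>D' | D' \<in> \<F> \<and> neighbour C D'. basis_vec (code_class D') (code_class D)))"
    unfolding kneser_hecke_def neighbour_def
    by (rule sum_classes[where g = "\<lambda>C. \<Sum>D' | D' \<in> \<F> \<and> vec.dim (C \<inter> D') = n - 1.
          basis_vec (code_class D') (code_class D)"]) (rule neighbour_sum_class[OF _ family])
  also have "\<dots> = (\<Sum>C\<in>\<F>. averaged v C * (\<Sum>D'\<in>code_class D. of_bool (neighbour C D')))"
  proof (rule sum.cong[OF refl])
    fix C
    have "{D' \<in> \<F>. neighbour C D'} \<inter> {D'. code_class D = code_class D'} = code_class D \<inter> {D'. neighbour C D'}"
      using sub code_class_self code_class_eq by blast
    hence "(\<Sum>D' | D' \<in> \<F> \<and> neighbour C D'. basis_vec (code_class D') (code_class D))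
        = (\<Sum>D'\<in>code_class D. of_bool (neighbour C D') :: complex)"
      by (simp add: basis_vec_def of_bool_def sum.If_cases finite_code_class)
    thus "averaged v C * (\<Sum>D' | D' \<in> \<F> \<and> neighbour C D'. basis_vec (code_class D') (code_class D))
        = averaged v C * (\<Sum>D'\<in>code_class D. of_bool (neighbour C D'))"
      by (simp only:)
  qed
  also have "\<dots> = (\<Sum>D'\<in>code_class D. S D')"
    unfolding S_def sum_distrib_left
    by (subst sum.swap) (simp add: of_bool_def if_distrib sum.If_cases Int_def cong: if_cong)
  also have "\<dots> = of_nat (card (code_class D)) * S D"
    by (simp add: S)
  finally have "averaged (T v) D = of_nat (card (code_class D)) * S D / of_nat (card (code_class D))"
    by (simp only: averaged_def)
  moreover have "(of_nat (card (code_class D)) :: complex) \<noteq> 0"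
    using card_code_class_pos[of D] by (simp only: of_nat_eq_0_iff)
  ultimately have "averaged (T v) D = S D" by (metis nonzero_mult_div_cancel_left)
  thus ?thesis by (simp only: S_def)
qed

lemma code_inner_T: "code_inner \<F> (T v) w = code_inner \<F> v (T w)"
proof -
  have sum_if: "(\<Sum>C | C \<in> \<F> \<and> P C. f C) = (\<Sum>C\<in>\<F>. if P C then f C else 0)"
    for P and f :: "('a ^ 'n) set \<Rightarrow> complex"
    by (simp add: sum.If_cases Int_def)
  have "(\<Sum>D\<in>\<F>. averaged (T v) D * cnj (averaged w D))
      = (\<Sum>D\<in>\<F>. \<Sum>C\<in>\<F>. if neighbour C D then averaged v C * cnj (averaged w D) else 0)"
    by (intro sum.cong refl) (simp add: averaged_T sum_if sum_distrib_right if_distribR if_distrib cong: if_cong)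
  also have "\<dots> = (\<Sum>C\<in>\<F>. \<Sum>D\<in>\<F>. if neighbour C D then averaged v C * cnj (averaged w D) else 0)"
    by (rule sum.swap)
  also have "\<dots> = (\<Sum>C\<in>\<F>. averaged v C * cnj (averaged (T w) C))"
    by (intro sum.cong refl)
      (simp add: averaged_T sum_if sum_distrib_left neighbour_commute if_distrib cong: if_cong)
  finally show ?thesis by (simp add: code_inner_eq)
qed

lemma mon_coeff_T:
  "mon_coeff \<F> m X (T v)
    = (\<Sum>C\<in>\<F>. averaged v C * of_nat (\<Sum>D | D \<in> \<F> \<and> neighbour C D. occurrences m X D))"
proof -
  have "mon_coeff \<F> m X (T v)
      = (\<Sum>D\<in>\<F>. \<Sum>C\<in>\<F>. if neighbour C D then averaged v C * of_nat (occurrences m X D) else 0)"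
    unfolding mon_coeff_eq
    by (intro sum.cong refl)
      (simp add: averaged_T sum_distrib_right sum.If_cases Int_def)
  also have "\<dots> = (\<Sum>C\<in>\<F>. \<Sum>D\<in>\<F>. if neighbour C D then averaged v C * of_nat (occurrences m X D) else 0)"
    by (rule sum.swap)
  also have "\<dots> = (\<Sum>C\<in>\<F>. averaged v C * of_nat (\<Sum>D | D \<in> \<F> \<and> neighbour C D. occurrences m X D))"
    by (intro sum.cong refl) (simp add: sum_distrib_left sum.If_cases Int_def)
  finally show ?thesis .
qed

lemma T_in_code_space: "T v \<in> code_space \<F>"
  unfolding code_space_def mem_Collect_eq
proof (intro allI impI)
  fix L assume "L \<notin> \<K>"
  hence "basis_vec (code_class D) L = 0" if "D \<in> \<F>" for D
    using that by (auto simp: basis_vec_def code_classes_def)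
  thus "T v L = 0" by (simp add: kneser_hecke_def)
qed

lemma code_inner_self_eq_0:
  assumes v: "v \<in> code_space \<F>" and 0: "code_inner \<F> v v = 0"
  shows "v = (\<lambda>K. 0)"
proof
  fix K
  let ?w = "\<lambda>K. real (card (code_aut (class_rep K))) * (cmod (v K))\<^sup>2"
  have "of_real (\<Sum>K\<in>\<K>. ?w K) = code_inner \<F> v v"
    by (simp add: code_inner_def mult.assoc complex_norm_square del: of_real_power)
  hence "(\<Sum>K\<in>\<K>. ?w K) = 0" by (simp only: 0 of_real_eq_0_iff)
  hence "\<forall>K\<in>\<K>. ?w K = 0" by (subst (asm) sum_nonneg_eq_0_iff) auto
  hence "v K = 0" if "K \<in> \<K>"
    using that card_code_aut_pos[of "class_rep K"] by fastforce
  thus "v K = 0" using v by (auto simp: code_space_def)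
qed

section \<open>Coefficients of weight-enumerators\<close>

lemma cwe_eq_0_imp_mon_coeff:
  assumes "v \<in> V_space \<F> (int m)"
  shows "mon_coeff \<F> m X v = 0"
proof -
  have cwe: "cwe \<F> m v = 0" using assms by (simp add: V_space_def)
  have single: "Poly_Mapping.lookup (Poly_Mapping.single 0 c * p) Y = c * Poly_Mapping.lookup p Y"
    for c :: complex and p :: "((nat \<Rightarrow> 'a) \<Rightarrow>\<^sub>0 nat) \<Rightarrow>\<^sub>0 complex" and Y
    by (simp add: map.rep_eq when_def flip: mult_map_scale_conv_mult)
  have lookup: "(\<Sum>K\<in>\<K>. v K * Poly_Mapping.lookup (cwe_code m (class_rep K)) Y) = 0" for Y
    using arg_cong[OF cwe, of "\<lambda>p. Poly_Mapping.lookup p Y"]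
    by (simp add: cwe_def lookup_sum single)
  have fin: "finite (tuples m C)" for C :: "('a ^ 'n) set"
    by (rule finite_subset[OF _ finite_lists_length_eq[of UNIV m]]) (auto simp: tuples_def)
  show ?thesis
  proof (cases "m = 0")
    case False
    have "Poly_Mapping.lookup (cwe_code m C) X = of_nat (card {cs \<in> tuples m C. mon cs = X})"
      for C :: "('a ^ 'n) set"
      using False fin by (simp add: cwe_code_def lookup_sum lookup_single when_def sum.If_cases Int_def)
    thus ?thesis using lookup[of X] by (simp add: mon_coeff_def)
  next
    \<comment> \<open>By convention \<open>cwe_code 0\<close> is the constant 1 and not the monomial
      of the empty tuple. All codes share that tuple, so \<open>mon_coeff\<close> is either 0 or the
      coefficient sum of v, which the convention makes vanish.\<close>
    case True
    have "{cs \<in> tuples 0 C. mon cs = X} = (if mon ([] :: ('a ^ 'n) list) = X then {[]} else {})"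
      for C :: "('a ^ 'n) set" by (auto simp: tuples_def)
    moreover have "(\<Sum>K\<in>\<K>. v K) = 0"
      using lookup[of 0] True by (simp add: cwe_code_def lookup_one)
    ultimately show ?thesis using True by (simp add: mon_coeff_def)
  qed
qed

text \<open>A code of dimension \<open>n\<close> is determined up to equivalence by the monomial of one of its bases.\<close>

lemma cwe_n_injective:
  assumes v: "v \<in> V_space \<F> (int n)"
  shows "v = (\<lambda>K. 0)"
proof
  fix K
  show "v K = 0"
  proof (cases "K \<in> \<K>")
    case False
    thus ?thesis using v by (auto simp: V_space_def code_space_def)
  next
    case True
    define C where "C = class_rep K"
    have C: "C \<in> \<F>" "code_class C = K"
      using class_in_family[OF True] class_rep_mem[OF True] by (auto simp: C_def)
    obtain B where B: "B \<subseteq> C" "vec.independent B" "C \<subseteq> vec.span B" "card B = vec.dim C"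
      by (rule vec.basis_exists)
    have "CARD('a) ^ n = CARD('a) ^ vec.dim C"
      using card_subspace[OF family_subspace[OF C(1)]] card_family[OF C(1)] by simp
    hence "card B = n" using B(4) q_gt_1 by simp
    then obtain cs where cs: "set cs = B" "length cs = n"
      using finite_distinct_list[OF finite, of B] distinct_card by metis
    have C_span: "vec.span (set cs) = C"
      using B(1,3) cs(1) family_subspace[OF C(1)] vec.span_subspace by blast
    let ?a = "\<lambda>L. card {ds \<in> tuples n (class_rep L). mon ds = mon cs}"
    have zero: "?a L = 0" if L: "L \<in> \<K>" "L \<noteq> K" for L
    proof (rule ccontr)
      assume "?a L \<noteq> 0"
      then obtain ds where ds: "ds \<in> tuples n (class_rep L)" "mon cs = mon ds"
        by (metis (mono_tags, lifting) Collect_empty_eq card.empty)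
      obtain \<pi> where \<pi>: "\<pi> permutes UNIV" "ds = map (perm_vec \<pi>) cs"
        using mon_eq_imp_perm[OF ds(2)] ds(1) cs(2) by (auto simp: tuples_def)
      have L': "class_rep L \<in> \<F>" "code_class (class_rep L) = L"
        using class_in_family[OF L(1)] class_rep_mem[OF L(1)] by auto
      have "perm_code \<pi> C = vec.span (set ds)"
        unfolding perm_code_def C_span[symmetric] \<pi>(2)
        using vec.linear_span_image[OF linear_perm_vec, of \<pi> "set cs"] by simp
      moreover have "vec.span (set ds) \<subseteq> class_rep L"
        using ds(1) by (intro vec.span_minimal family_subspace[OF L'(1)]) (auto simp: tuples_def)
      moreover have "card (perm_code \<pi> C) = card (class_rep L)"
        using card_family[OF family_perm[OF C(1) \<pi>(1)]] card_family[OF L'(1)] by simp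
      ultimately have "perm_code \<pi> C = class_rep L" by (intro card_subset_eq) auto
      hence "code_class C = code_class (class_rep L)" using code_class_perm[OF \<pi>(1)] by metis
      thus False using C(2) L'(2) L(2) by simp
    qed
    have "0 = mon_coeff \<F> n (mon cs) v" using cwe_eq_0_imp_mon_coeff[OF v] by simp
    also have "\<dots> = v K * of_nat (?a K)"
      unfolding mon_coeff_def
      by (subst sum.remove[OF finite True]) (simp add: zero)
    finally have "v K * of_nat (?a K) = 0" by simp
    moreover have "cs \<in> {ds \<in> tuples n (class_rep K). mon ds = mon cs}"
      using cs B(1) by (simp add: tuples_def flip: C_def)
    moreover have "finite {ds \<in> tuples n (class_rep K). mon ds = mon cs}"
      by (rule finite_subset[OF _ finite_lists_length_eq[of UNIV n]]) (auto simp: tuples_def)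
    ultimately show ?thesis by auto
  qed
qed

end

section \<open>The eigenspaces\<close>

lemma mon_coeff_lincomb:
  "mon_coeff \<F> m X (\<lambda>K. v K - c * w K) = mon_coeff \<F> m X v - c * mon_coeff \<F> m X w"
  by (simp add: mon_coeff_def sum_subtractf left_diff_distrib sum_distrib_left mult.assoc)

lemma code_inner_lincomb:
  "code_inner \<F> (\<lambda>K. v K - c * u K) w = code_inner \<F> v w - c * code_inner \<F> u w"
  "code_inner \<F> w (\<lambda>K. v K - c * u K) = code_inner \<F> w v - cnj c * code_inner \<F> w u"
  by (simp_all add: code_inner_def right_diff_distrib left_diff_distrib sum_subtractf
      sum_distrib_left mult_ac)

lemma code_inner_scale_right:
  "code_inner \<F> w (\<lambda>K. c * v K) = cnj c * code_inner \<F> w v"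
  by (simp add: code_inner_def sum_distrib_left mult_ac)

lemma code_space_lincomb:
  "v \<in> code_space \<F> \<Longrightarrow> w \<in> code_space \<F> \<Longrightarrow> (\<lambda>K. v K - c * w K) \<in> code_space \<F>"
  by (simp add: code_space_def)

locale graded_family = code_family bar \<Phi> n \<F>
  for bar :: "'a::{field,finite} \<Rightarrow> 'a" and \<Phi> n and \<F> :: "('a ^ 'n::finite) set set" +
  fixes M0 :: "nat \<Rightarrow> ((nat \<Rightarrow> 'a) \<Rightarrow>\<^sub>0 nat) set" and \<alpha> :: "nat \<Rightarrow> nat"
  assumes M0: "\<And>m. m \<le> n \<Longrightarrow> M0 m \<subseteq> full_rank_monomials (2 * n) m"
    and V_step: "\<And>m. m \<le> n \<Longrightarrow>
      V_space \<F> (int m) = {v \<in> V_space \<F> (int m - 1). \<forall>X\<in>M0 m. mon_coeff \<F> m X v = 0}"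
    and \<alpha>: "\<And>m C cs. m \<le> n \<Longrightarrow> C \<in> \<F> \<Longrightarrow> cs \<in> tuples m C \<Longrightarrow> mon cs \<in> M0 m \<Longrightarrow>
      (\<Sum>E\<in>hyperplanes_through n C cs. neighbour_count \<F> E C) = \<alpha> m"
begin

section \<open>The filtration and the scalars on its steps\<close>

definition eig :: "nat \<Rightarrow> complex" where
  "eig m = of_nat (\<alpha> m) - of_nat (\<Sum>i<m. CARD('a) ^ i)"

definition defined_at :: "nat \<Rightarrow> bool" where
  "defined_at m \<longleftrightarrow> (\<exists>C\<in>\<F>. \<exists>cs\<in>tuples m C. mon cs \<in> M0 m)"

text \<open>The space V with index m - 1, rewritten by condition (1). The shift gives natural
  indices: level 0 is the whole space and level n + 1 is zero.\<close>

definition U :: "nat \<Rightarrow> ('a, 'n) code_vec set" where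
  "U m = {v \<in> code_space \<F>. \<forall>i<m. \<forall>X\<in>M0 i. mon_coeff \<F> i X v = 0}"

lemma V_eq_U: "m \<le> n + 1 \<Longrightarrow> V_space \<F> (int m - 1) = U m"
proof (induction m)
  case 0
  thus ?case by (simp add: V_space_def U_def)
next
  case (Suc m)
  thus ?case using V_step[of m] by (auto simp: U_def less_Suc_eq)
qed

lemma U_lincomb: "v \<in> U m \<Longrightarrow> w \<in> U m \<Longrightarrow> (\<lambda>K. v K - c * w K) \<in> U m"
  by (simp add: U_def mon_coeff_lincomb code_space_lincomb)

lemma mon_coeff_not_occurring:
  assumes "\<not> (\<exists>C\<in>\<F>. \<exists>cs\<in>tuples m C. mon cs = X)"
  shows "mon_coeff \<F> m X v = 0"
proof -
  have "occurrences m X C = 0" if "C \<in> \<F>" for C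
  proof -
    have "{cs \<in> tuples m C. mon cs = X} = {}" using assms that by blast
    thus ?thesis by (simp only: occurrences_def card.empty)
  qed
  thus ?thesis by (simp add: mon_coeff_eq)
qed

text \<open>Weighting the counting identity by \<open>averaged v\<close> turns its remainder into
  coefficients of v at (m - 1)-tuples, and these vanish on V with index m - 1.\<close>

lemma mon_coeff_T_eig:
  assumes m: "m \<le> n" and v: "v \<in> U m" and X: "X \<in> M0 m"
  shows "mon_coeff \<F> m X (T v) = eig m * mon_coeff \<F> m X v"
proof (cases "\<exists>C\<in>\<F>. \<exists>cs\<in>tuples m C. mon cs = X")
  case False
  thus ?thesis by (simp add: mon_coeff_not_occurring)
next
  case True
  then obtain D0 ds0 where D0: "D0 \<in> \<F>" "m = length ds0" "set ds0 \<subseteq> D0" "mon ds0 = X"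
    by (auto simp: tuples_def)
  let ?b = "\<Sum>i<m. CARD('a) ^ i"
  let ?\<kappa> = "\<lambda>l u. card {es \<in> tuples_of_mon m X. reduce l u es = reduce l u ds0}"
  let ?Y = "\<lambda>l u. mon (reduce l u ds0)"
  let ?R = "\<lambda>C. \<Sum>l<m. \<Sum>u\<in>tails m l. ?\<kappa> l u * occurrences (m - 1) (?Y l u) C"
  have eq: "of_nat (\<Sum>D | D \<in> \<F> \<and> neighbour C D. occurrences m X D)
      = eig m * of_nat (occurrences m X C) + (of_nat (?R C) :: complex)" if C: "C \<in> \<F>" for C
  proof -
    have "(\<Sum>D | D \<in> \<F> \<and> neighbour C D. occurrences m X D) + ?b * occurrences m X C
        = \<alpha> m * occurrences m X C + ?R C"
      by (rule sum_neighbours_occurrences[OF D0(2,4,1,3) C]) (use \<alpha>[OF m C] X in auto)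
    from arg_cong[OF this, of "of_nat :: nat \<Rightarrow> complex"] show ?thesis
      unfolding eig_def of_nat_add of_nat_mult by (simp only: algebra_simps)
  qed
  \<comment> \<open>For m = 0 the remainder is an empty sum, so only positive m needs this.\<close>
  have lower: "mon_coeff \<F> (m - 1) Y v = 0" if "m > 0" for Y
  proof -
    have "v \<in> V_space \<F> (int (m - 1))"
      using v V_eq_U[of m] m that by (simp add: of_nat_diff)
    thus ?thesis by (rule cwe_eq_0_imp_mon_coeff)
  qed
  have "(\<Sum>C\<in>\<F>. averaged v C * of_nat (?R C))
      = (\<Sum>C\<in>\<F>. \<Sum>l<m. \<Sum>u\<in>tails m l. of_nat (?\<kappa> l u) * (averaged v C * of_nat (occurrences (m - 1) (?Y l u) C)))"
    by (simp add: sum_distrib_left mult_ac)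
  also have "\<dots> = (\<Sum>l<m. \<Sum>u\<in>tails m l. \<Sum>C\<in>\<F>. of_nat (?\<kappa> l u) * (averaged v C * of_nat (occurrences (m - 1) (?Y l u) C)))"
    by (subst sum.swap, rule sum.cong, rule refl, rule sum.swap)
  also have "\<dots> = (\<Sum>l<m. \<Sum>u\<in>tails m l. of_nat (?\<kappa> l u) * mon_coeff \<F> (m - 1) (?Y l u) v)"
    by (simp only: mon_coeff_eq sum_distrib_left)
  also have "\<dots> = 0"
    using lower by (intro sum.neutral ballI) simp
  finally have 0: "(\<Sum>C\<in>\<F>. averaged v C * of_nat (?R C)) = 0" .
  have "mon_coeff \<F> m X (T v)
      = (\<Sum>C\<in>\<F>. eig m * (averaged v C * of_nat (occurrences m X C)) + averaged v C * of_nat (?R C))"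
    unfolding mon_coeff_T
    by (rule sum.cong[OF refl]) (simp only: eq distrib_left mult.left_commute)
  also have "\<dots> = eig m * mon_coeff \<F> m X v"
    by (simp only: sum.distrib 0 mon_coeff_eq sum_distrib_left add_0_right)
  finally show ?thesis .
qed

lemma T_U: "v \<in> U m \<Longrightarrow> m \<le> n + 1 \<Longrightarrow> T v \<in> U m"
proof -
  assume v: "v \<in> U m" and m: "m \<le> n + 1"
  have "mon_coeff \<F> i X (T v) = 0" if "i < m" "X \<in> M0 i" for i X
  proof -
    have "v \<in> U i" using v that(1) by (auto simp: U_def)
    thus ?thesis using mon_coeff_T_eig[of i v X] v that m by (simp add: U_def)
  qed
  thus ?thesis by (simp add: U_def T_in_code_space)
qed

text \<open>T acts on each step of the filtration as the scalar \<open>eig m\<close>; this single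
  fact drives both inclusions of the eigenspace theorem.\<close>

lemma T_minus_eig_U:
  assumes "v \<in> U m" "m \<le> n"
  shows "(\<lambda>K. T v K - eig m * v K) \<in> U (Suc m)"
proof -
  have "(\<lambda>K. T v K - eig m * v K) \<in> U m"
    using assms by (intro U_lincomb T_U) auto
  moreover have "mon_coeff \<F> m X (\<lambda>K. T v K - eig m * v K) = 0" if "X \<in> M0 m" for X
    using mon_coeff_T_eig[OF assms(2,1) that] by (simp add: mon_coeff_lincomb)
  ultimately show ?thesis by (auto simp: U_def less_Suc_eq)
qed

text \<open>Monomials that occur in no code impose no condition. Distinct scalars are therefore
  required only between levels where \<open>\<alpha>\<close> is defined.\<close>

lemma U_Suc_undefined:
  assumes "\<not> defined_at m"
  shows "U (Suc m) = U m"
proof -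
  have "mon_coeff \<F> m X v = 0" if "X \<in> M0 m" for X v
    using assms that by (intro mon_coeff_not_occurring) (auto simp: defined_at_def)
  thus ?thesis by (auto simp: U_def less_Suc_eq)
qed

lemma U_top: "v \<in> U (Suc n) \<Longrightarrow> v = (\<lambda>K. 0)"
  using cwe_n_injective V_eq_U[of "Suc n"] by simp

text \<open>The first tuple spans at most q^i vectors because of its length, the second at least q^j
  because of its rank, so i < j provides the factor q for \<open>sum_neighbour_count_mono\<close>.
  Strictness is due to the geometric sums; both sides are arranged to avoid subtraction.\<close>

lemma eig_less:
  assumes "i < j" "j \<le> n" "defined_at i" "defined_at j"
  shows "\<alpha> j + (\<Sum>k<i. CARD('a) ^ k) < \<alpha> i + (\<Sum>k<j. CARD('a) ^ k)"
proof -
  obtain C cs where C: "C \<in> \<F>" "cs \<in> tuples i C" "mon cs \<in> M0 i"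
    using assms(3) by (auto simp: defined_at_def)
  obtain D ds where D: "D \<in> \<F>" "ds \<in> tuples j D" "mon ds \<in> M0 j"
    using assms(4) by (auto simp: defined_at_def)
  have "CARD('a) * card (vec.span (set cs)) \<le> CARD('a) * CARD('a) ^ i"
    using card_span_set_le[of cs] C(2) by (simp add: tuples_def)
  also have "\<dots> \<le> CARD('a) ^ j"
    using assms(1) q_gt_1 by (simp flip: power_Suc add: power_increasing del: power_Suc)
  also have "\<dots> \<le> card (vec.span (set ds))"
    using M0[OF assms(2)] D(2,3) by (intro card_span_full_rank[of ds "2 * n"]) (auto simp: tuples_def)
  finally have "\<alpha> j \<le> \<alpha> i"
    using sum_neighbour_count_mono[of C cs D ds] C D assms \<alpha>[of i C cs] \<alpha>[of j D ds]
    by (simp add: tuples_def)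
  moreover have "(\<Sum>k<i. CARD('a) ^ k) < (\<Sum>k<j. CARD('a) ^ k)"
  proof (rule sum_strict_mono2)
    show "i \<in> {..<j} - {..<i}" using assms(1) by simp
  qed (use assms(1) q_gt_1 in auto)
  ultimately show ?thesis by simp
qed

lemma eig_inj:
  assumes "i \<le> n" "j \<le> n" "defined_at i" "defined_at j" "eig i = eig j"
  shows "i = j"
proof -
  have "(of_nat (\<alpha> i + (\<Sum>k<j. CARD('a) ^ k)) :: complex) = of_nat (\<alpha> j + (\<Sum>k<i. CARD('a) ^ k))"
    using assms(5) unfolding eig_def of_nat_add by (simp only: algebra_simps)
  hence "\<alpha> i + (\<Sum>k<j. CARD('a) ^ k) = \<alpha> j + (\<Sum>k<i. CARD('a) ^ k)"
    by (simp only: of_nat_eq_iff)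
  thus ?thesis
    using eig_less[of i j] eig_less[of j i] assms by (cases i j rule: linorder_cases) auto
qed

lemma cnj_eig [simp]: "cnj (eig m) = eig m"
  unfolding eig_def by (simp only: complex_cnj_diff complex_cnj_of_nat)

lemma Y_eq: "m \<le> n \<Longrightarrow> Y_space \<F> m = {w \<in> U m. \<forall>v\<in>U (Suc m). code_inner \<F> v w = 0}"
  using V_eq_U[of m] V_eq_U[of "Suc m"]
  by (auto simp: Y_space_def W_space_def U_def)

theorem Y_eq_eigenspace:
  assumes m: "m \<le> n" and def: "defined_at m"
  shows "Y_space \<F> m = {v \<in> code_space \<F>. T v = (\<lambda>K. eig m * v K)}"
proof (intro equalityI subsetI)
  fix v assume "v \<in> Y_space \<F> m"
  hence v: "v \<in> U m" "\<And>w. w \<in> U (Suc m) \<Longrightarrow> code_inner \<F> w v = 0"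
    using Y_eq[OF m] by auto
  \<comment> \<open>Both w and \<open>T w\<close> lie in the next level, to which v is orthogonal;
    self-adjointness then gives w norm 0.\<close>
  define w where "w = (\<lambda>K. T v K - eig m * v K)"
  have w: "w \<in> U (Suc m)" unfolding w_def by (rule T_minus_eig_U[OF v(1) m])
  have "code_inner \<F> w w = code_inner \<F> (T w) v - eig m * code_inner \<F> w v"
    by (subst (2) w_def) (simp add: code_inner_lincomb(2) code_inner_T)
  also have "\<dots> = 0"
    using v(2)[OF w] v(2)[OF T_U[OF w]] m by simp
  finally have "w = (\<lambda>K. 0)"
    using w by (intro code_inner_self_eq_0) (auto simp: U_def)
  hence "T v = (\<lambda>K. eig m * v K)"
    by (auto simp: w_def fun_eq_iff)
  thus "v \<in> {v \<in> code_space \<F>. T v = (\<lambda>K. eig m * v K)}"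
    using v(1) by (simp add: U_def)
next
  fix v assume "v \<in> {v \<in> code_space \<F>. T v = (\<lambda>K. eig m * v K)}"
  hence v: "v \<in> code_space \<F>" "T v = (\<lambda>K. eig m * v K)" by auto
  \<comment> \<open>On coefficients at level i < m, T acts on v both by \<open>eig i\<close> and by
    \<open>eig m\<close>, so they vanish and v descends one level further.\<close>
  have "v \<in> U i" if "i \<le> m" for i
    using that
  proof (induction i)
    case 0
    thus ?case using v(1) by (simp add: U_def)
  next
    case (Suc i)
    hence IH: "v \<in> U i" and i: "i < m" "i \<le> n" using m by auto
    show ?case
    proof (cases "defined_at i")
      case False
      thus ?thesis using U_Suc_undefined[OF False] IH by simp
    next
      case True
      hence ne: "eig i \<noteq> eig m" using eig_inj[OF i(2) m True def] i(1) by auto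
      have "mon_coeff \<F> i X v = 0" if X: "X \<in> M0 i" for X
      proof -
        have "mon_coeff \<F> i X (T v) = eig m * mon_coeff \<F> i X v"
          unfolding v(2) by (simp add: mon_coeff_def sum_distrib_left mult.assoc)
        thus ?thesis using mon_coeff_T_eig[OF i(2) IH X] ne by simp
      qed
      thus ?thesis using IH by (auto simp: U_def less_Suc_eq)
    qed
  qed
  hence vU: "v \<in> U m" by simp
  \<comment> \<open>Downward from the zero space at level n + 1: for w at level j + 1, the vector
    \<open>T w\<close> minus \<open>eig (Suc j)\<close> times w is one level deeper and hence
    orthogonal to v. Self-adjointness turns this product into (\<open>eig m - eig (Suc j)\<close>)
    times that of w with v.\<close>
  have orth: "\<forall>w\<in>U (Suc j). code_inner \<F> w v = 0" if "m \<le> j" "j \<le> n" for j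
    using that(2,1)
  proof (induction j rule: inc_induct)
    case base
    have "code_inner \<F> (\<lambda>K. 0) v = 0" by (simp add: code_inner_def)
    thus ?case using U_top by metis
  next
    case (step j)
    have IH: "\<forall>w\<in>U (Suc (Suc j)). code_inner \<F> w v = 0" using step by simp
    have j: "Suc j \<le> n" "m < Suc j" using step by auto
    show ?case
    proof (cases "defined_at (Suc j)")
      case False
      thus ?thesis using U_Suc_undefined[OF False] IH by simp
    next
      case True
      hence ne: "eig m \<noteq> eig (Suc j)" using eig_inj[OF m j(1) def True] j(2) by auto
      show ?thesis
      proof
        fix w assume w: "w \<in> U (Suc j)"
        have "0 = code_inner \<F> (\<lambda>K. T w K - eig (Suc j) * w K) v"
          using IH T_minus_eig_U[OF w j(1)] by simp
        also have "\<dots> = (eig m - eig (Suc j)) * code_inner \<F> w v"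
          by (simp add: code_inner_lincomb code_inner_T v(2) code_inner_scale_right left_diff_distrib)
        finally show "code_inner \<F> w v = 0" using ne by simp
      qed
    qed
  qed
  show "v \<in> Y_space \<F> m"
    using vU orth[OF order_refl m] by (simp add: Y_eq[OF m])
qed

end

theorem theorem8:
  fixes bar :: "'a::{field,finite} \<Rightarrow> 'a"
    and \<Phi> :: "('a \<Rightarrow> qmodz) set"
    and n :: nat
    and \<F> :: "('a ^ 'n::finite) set set"
    and M0 :: "nat \<Rightarrow> ((nat \<Rightarrow> 'a) \<Rightarrow>\<^sub>0 nat) set"
    and \<alpha> :: "nat \<Rightarrow> nat"
    and \<beta> \<nu> :: "nat \<Rightarrow> complex"
  assumes length: "CARD('n) = 2 * n"
    and conj: "admissible_conj bar"
    and type: "is_type bar \<Phi>"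
    and family: "\<F> = self_dual_codes bar \<Phi>"
    and M0: "\<And>m. m \<le> n \<Longrightarrow> M0 m \<subseteq> full_rank_monomials (2 * n) m"
    and cond1: "\<And>m. m \<le> n \<Longrightarrow>
      V_space \<F> (int m) = {v \<in> V_space \<F> (int m - 1). \<forall>X\<in>M0 m. mon_coeff \<F> m X v = 0}"
    and cond2: "\<And>m C cs. m \<le> n \<Longrightarrow> C \<in> \<F> \<Longrightarrow> cs \<in> tuples m C \<Longrightarrow> mon cs \<in> M0 m \<Longrightarrow>
      (\<Sum>E\<in>hyperplanes_through n C cs. neighbour_count \<F> E C) = \<alpha> m"
    and \<beta>: "\<And>m. \<beta> m = (of_nat CARD('a) ^ m - 1) / (of_nat CARD('a) - 1)"
    and \<nu>: "\<And>m. \<nu> m = of_nat (\<alpha> m) - \<beta> m"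
    and m: "m \<le> n"
    and defined: "\<exists>C\<in>\<F>. \<exists>cs\<in>tuples m C. mon cs \<in> M0 m"
  shows "Y_space \<F> m = {v \<in> code_space \<F>. kneser_hecke \<F> n v = (\<lambda>K. \<nu> m * v K)}"
proof -
  interpret graded_family bar \<Phi> n \<F> M0 \<alpha>
    by (intro graded_family.intro code_family.intro conj_form.intro code_family_axioms.intro
        graded_family_axioms.intro) (fact assms)+
  \<comment> \<open>The denominator in \<open>\<beta>\<close> is nonzero, so the quotient is the
    geometric sum that counts pivots and tails.\<close>
  have "(of_nat CARD('a) :: complex) \<noteq> 1"
    using q_gt_1 by (simp only: of_nat_eq_1_iff)
  hence "\<beta> m = of_nat (\<Sum>i<m. CARD('a) ^ i)"
    unfolding \<beta> by (simp add: geometric_sum)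
  hence "\<nu> m = eig m" by (simp only: \<nu> eig_def)
  thus ?thesis
    using Y_eq_eigenspace[OF m] defined by (simp only: defined_at_def)
qed

end
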